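(* Let $\Gamma_1$ and $\Gamma_2$ be two finite graphs such that $A(\Gamma_1)$ and $A(\Gamma_2)$ are commensurable, and let $n \geq 0$ be an integer. If $\Gamma_1$ contains a complete subgraph of size $n$ that has a subgraph separating $\Gamma_1$, then $\Gamma_2$ contains a complete subgraph of size $n$ that has a subgraph separating $\Gamma_2$.
   Context: Graphs are simplicial (no loops, no multiple edges). The right-angled Artin group $A(\Gamma)$ is given by the presentation $\langle u \text{ vertex of } \Gamma \mid [u,v]=1 \text{ whenever } u,v \text{ are adjacent in } \Gamma\rangle$. Two groups are (abstractly) commensurable if they have isomorphic finite-index subgroups. The size of a complete graph is its number of vertices. A subgraph $\Lambda_0$ of $\Gamma$ separates $\Gamma$ if $\Gamma \setminus \Lambda_0$ (the graph obtained by removing the vertices of $\Lambda_0$ and all edges incident to them) is disconnected, i.e. has at least two connected components. The separating subgraph is allowed to be empty (which separates $\Gamma$ exactly when $\Gamma$ is disconnected) and is allowed to be the whole complete subgraph of size $n$. *)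

theory Defs
  imports "HOL-Algebra.Algebra" "Graph_Theory.Kuratowski"
begin

section \<open>Free groups and presentations\<close>

text \<open>
  A letter \<^term>\<open>(x, True)\<close> stands for the generator \<open>x\<close> and \<^term>\<open>(x, False)\<close> for its
  formal inverse. The elements of the free group are the reduced words, multiplied by
  concatenation followed by reduction.
\<close>

definition inv_letter :: "'a \<times> bool \<Rightarrow> 'a \<times> bool" where
  "inv_letter l = (fst l, \<not> snd l)"

fun reduced :: "('a \<times> bool) list \<Rightarrow> bool" where
  "reduced (k # l # w) \<longleftrightarrow> l \<noteq> inv_letter k \<and> reduced (l # w)"
| "reduced _ \<longleftrightarrow> True"

fun reduce_cons :: "'a \<times> bool \<Rightarrow> ('a \<times> bool) list \<Rightarrow> ('a \<times> bool) list" where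
  "reduce_cons k [] = [k]"
| "reduce_cons k (l # w) = (if l = inv_letter k then w else k # l # w)"

definition reduced_mult :: "('a \<times> bool) list \<Rightarrow> ('a \<times> bool) list \<Rightarrow> ('a \<times> bool) list" where
  "reduced_mult u v = foldr reduce_cons u v"

definition free_group :: "'a set \<Rightarrow> ('a \<times> bool) list monoid" where
  "free_group S =
     \<lparr>carrier = {w. reduced w \<and> fst ` set w \<subseteq> S}, monoid.mult = reduced_mult, one = []\<rparr>"

definition free_gen :: "'a \<Rightarrow> ('a \<times> bool) list" where
  "free_gen x = [(x, True)]"

definition normal_closure :: "('a, 'b) monoid_scheme \<Rightarrow> 'a set \<Rightarrow> 'a set" where
  "normal_closure G R = (\<lambda>N. N \<lhd> G) hull R"

text \<open>The group \<open>\<langle>S | R\<rangle>\<close>; the relators \<open>R\<close> are elements of the free group on \<open>S\<close>.\<close>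

definition presented_group ::
  "'a set \<Rightarrow> ('a \<times> bool) list set \<Rightarrow> ('a \<times> bool) list set monoid" where
  "presented_group S R = free_group S Mod normal_closure (free_group S) R"

definition commutator :: "('a, 'b) monoid_scheme \<Rightarrow> 'a \<Rightarrow> 'a \<Rightarrow> 'a" where
  "commutator G x y = x \<otimes>\<^bsub>G\<^esub> y \<otimes>\<^bsub>G\<^esub> inv\<^bsub>G\<^esub> x \<otimes>\<^bsub>G\<^esub> inv\<^bsub>G\<^esub> y"

lemma inv_letter_inv_letter [simp]: "inv_letter (inv_letter l) = l"
  by (simp add: inv_letter_def)

lemma inv_letter_neq [simp]: "inv_letter l \<noteq> l"
  by (cases l) (simp add: inv_letter_def)

lemma fst_inv_letter [simp]: "fst (inv_letter l) = fst l"
  by (simp add: inv_letter_def)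

lemma reduced_tl: "reduced (l # w) \<Longrightarrow> reduced w"
  by (cases w) auto

lemma reduced_reduce_cons: "reduced w \<Longrightarrow> reduced (reduce_cons l w)"
  by (cases w) (auto dest: reduced_tl)

lemma set_reduce_cons: "set (reduce_cons l w) \<subseteq> insert l (set w)"
  by (cases w) auto

lemma reduce_cons_inv_letter:
  "reduced w \<Longrightarrow> reduce_cons l (reduce_cons (inv_letter l) w) = w"
proof (cases w)
  case (Cons k v)
  assume "reduced w"
  with Cons show ?thesis by (cases v) auto
qed auto

lemma reduced_reduced_mult: "reduced v \<Longrightarrow> reduced (reduced_mult u v)"
  unfolding reduced_mult_def by (induction u) (auto intro: reduced_reduce_cons)

lemma set_reduced_mult: "set (reduced_mult u v) \<subseteq> set u \<union> set v"
proof (induction u)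
  case (Cons l u)
  then show ?case
    using set_reduce_cons[of l "reduced_mult u v"] by (auto simp: reduced_mult_def)
qed (simp add: reduced_mult_def)

lemma reduced_mult_reduce_cons:
  assumes "reduced w"
  shows "reduced_mult (reduce_cons l v) w = reduce_cons l (reduced_mult v w)"
proof (cases v)
  case (Cons k u)
  then show ?thesis
    using reduce_cons_inv_letter[OF reduced_reduced_mult[OF assms, of u], of l]
    by (auto simp: reduced_mult_def)
qed (simp add: reduced_mult_def)

lemma reduced_mult_assoc:
  assumes "reduced w"
  shows "reduced_mult (reduced_mult u v) w = reduced_mult u (reduced_mult v w)"
proof (induction u)
  case (Cons l u)
  have "reduced_mult (l # u) x = reduce_cons l (reduced_mult u x)" for x
    by (simp add: reduced_mult_def)
  then show ?case using Cons reduced_mult_reduce_cons[OF assms] by simp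
qed (simp add: reduced_mult_def)

lemma reduced_mult_Nil: "reduced w \<Longrightarrow> reduced_mult w [] = w"
proof (induction w)
  case (Cons l w)
  then have "reduced_mult w [] = w" by (blast dest: reduced_tl)
  then have "reduced_mult (l # w) [] = reduce_cons l w" by (simp add: reduced_mult_def)
  then show ?case using Cons.prems by (cases w) auto
qed (simp add: reduced_mult_def)

lemma reduced_mult_left_inv:
  assumes "reduced w"
  obtains v where "reduced v" "fst ` set v \<subseteq> fst ` set w" "reduced_mult v w = []"
proof -
  have "\<exists>v. reduced v \<and> fst ` set v \<subseteq> fst ` set w \<and> reduced_mult v w = []"
    using assms
  proof (induction w)
    case Nil
    then show ?case by (intro exI[of _ "[]"]) (simp add: reduced_mult_def)
  next
    case (Cons l w)
    then obtain v where v: "reduced v" "fst ` set v \<subseteq> fst ` set w" "reduced_mult v w = []"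
      by (blast dest: reduced_tl)
    let ?v = "reduced_mult v [inv_letter l]"
    have "reduced_mult ?v (l # w) = reduced_mult v (reduced_mult [inv_letter l] (l # w))"
      by (rule reduced_mult_assoc[OF Cons.prems])
    also have "\<dots> = []" using v by (simp add: reduced_mult_def)
    finally have "reduced_mult ?v (l # w) = []" .
    moreover have "reduced ?v" by (simp add: reduced_reduced_mult)
    moreover have "fst ` set ?v \<subseteq> fst ` set (l # w)"
    proof -
      have "fst ` set ?v \<subseteq> fst ` (set v \<union> {inv_letter l})"
        using set_reduced_mult[of v "[inv_letter l]"] by (intro image_mono) simp
      then have "fst ` set ?v \<subseteq> insert (fst l) (fst ` set v)" by simp
      moreover have "insert (fst l) (fst ` set v) \<subseteq> fst ` set (l # w)" using v(2) by auto
      ultimately show ?thesis by (rule subset_trans)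
    qed
    ultimately show ?case by blast
  qed
  then show ?thesis using that by blast
qed

lemma group_free_group: "group (free_group S)"
proof (rule groupI)
  fix u v
  assume "u \<in> carrier (free_group S)" "v \<in> carrier (free_group S)"
  then show "u \<otimes>\<^bsub>free_group S\<^esub> v \<in> carrier (free_group S)"
    using set_reduced_mult[of u v] by (fastforce simp: free_group_def reduced_reduced_mult)
next
  fix w
  assume w: "w \<in> carrier (free_group S)"
  then obtain v where "reduced v" "fst ` set v \<subseteq> fst ` set w" "reduced_mult v w = []"
    using reduced_mult_left_inv[of w] by (auto simp: free_group_def)
  then show "\<exists>v \<in> carrier (free_group S). v \<otimes>\<^bsub>free_group S\<^esub> w = \<one>\<^bsub>free_group S\<^esub>"
    using w by (auto simp: free_group_def)
qed (auto simp: free_group_def reduced_mult_assoc, auto simp: reduced_mult_def)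

lemma normal_normal_closure:
  assumes "group G" "R \<subseteq> carrier G"
  shows "normal_closure G R \<lhd> G"
proof -
  interpret group G by fact
  have car: "carrier G \<lhd> G"
    by (auto simp: normal_inv_iff subgroup_self)
  let ?M = "{N. N \<lhd> G \<and> R \<subseteq> N}"
  have "subgroup (\<Inter>?M) G"
    using car assms(2) by (intro subgroups_Inter) (auto dest: normal_imp_subgroup)
  then have "\<Inter>?M \<lhd> G" by (auto simp: normal_inv_iff)
  then show ?thesis by (simp add: normal_closure_def hull_def)
qed

lemma group_presented_group:
  "R \<subseteq> carrier (free_group S) \<Longrightarrow> group (presented_group S R)"
  unfolding presented_group_def
  by (intro normal.factorgroup_is_group normal_normal_closure group_free_group)


section \<open>Right-angled Artin groups and commensurability\<close>

text \<open>
  The locale \<^locale>\<open>graph\<close> models a finite simplicial graph as a finite symmetric digraph without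
  loops or parallel arcs, so each edge is a pair of opposite arcs. Each edge thus contributes
  the relators \<open>[u,v]\<close> and \<open>[v,u] = [u,v]\<^sup>-\<^sup>1\<close>, which have the same normal closure
  as \<open>[u,v]\<close> alone.
\<close>

definition raag :: "('a, 'b) pre_digraph \<Rightarrow> ('a \<times> bool) list set monoid" where
  "raag \<Gamma> = presented_group (verts \<Gamma>)
     {commutator (free_group (verts \<Gamma>)) (free_gen u) (free_gen v) | u v.
        (u, v) \<in> arcs_ends \<Gamma>}"

lemma (in wf_digraph) group_raag: "group (raag G)"
proof -
  interpret F: group "free_group (verts G)" by (rule group_free_group)
  have gen: "free_gen u \<in> carrier (free_group (verts G))" if "u \<in> verts G" for u
    using that by (simp add: free_gen_def free_group_def)
  have "commutator (free_group (verts G)) (free_gen u) (free_gen v) \<in> carrier (free_group (verts G))"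
    if "(u, v) \<in> arcs_ends G" for u v
  proof -
    have "u \<in> verts G" "v \<in> verts G"
      using that by (auto simp: arcs_ends_def arc_to_ends_def)
    then show ?thesis unfolding commutator_def by (intro F.m_closed F.inv_closed gen)
  qed
  then show ?thesis
    unfolding raag_def by (intro group_presented_group) auto
qed

definition finite_index_subgroup :: "'a set \<Rightarrow> ('a, 'b) monoid_scheme \<Rightarrow> bool" where
  "finite_index_subgroup H G \<longleftrightarrow> subgroup H G \<and> finite (rcosets\<^bsub>G\<^esub> H)"

definition commensurable ::
  "('a, 'b) monoid_scheme \<Rightarrow> ('c, 'd) monoid_scheme \<Rightarrow> bool" where
  "commensurable G\<^sub>1 G\<^sub>2 \<longleftrightarrow>
     (\<exists>H\<^sub>1 H\<^sub>2. finite_index_subgroup H\<^sub>1 G\<^sub>1 \<and> finite_index_subgroup H\<^sub>2 G\<^sub>2 \<and>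
        G\<^sub>1\<lparr>carrier := H\<^sub>1\<rparr> \<cong> G\<^sub>2\<lparr>carrier := H\<^sub>2\<rparr>)"


section \<open>Separating subgraphs\<close>

text \<open>
  In a symmetric digraph the strongly connected components are the connected components.
  Counting components, rather than negating \<^const>\<open>Digraph_Component.connected\<close>, matters when nothing is left:
  \<^const>\<open>Digraph_Component.connected\<close> is false for the graph without vertices, which is not disconnected in the
  sense intended here.
\<close>

definition separates :: "('a, 'b) pre_digraph \<Rightarrow> ('a, 'b) pre_digraph \<Rightarrow> bool" where
  "separates \<Lambda>\<^sub>0 \<Gamma> \<longleftrightarrow>
     card (pre_digraph.sccs (\<Gamma> \<restriction> (verts \<Gamma> - verts \<Lambda>\<^sub>0))) \<ge> 2"

end

theory Submission
  imports Defs
begin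

text \<open>
  A separating subclique \<open>S\<close> of a clique \<open>K\<close> splits \<open>A(\<Gamma>\<^sub>1)\<close> as an amalgam over \<open>A(S)\<close>, so a common
  finite-index subgroup acts on the Bass--Serre tree of this splitting with edge stabilizers
  contained in conjugates of the free abelian group \<open>A(K)\<close>. Let \<open>x\<close> run through the conjugates of
  large powers of the generators of \<open>A(\<Gamma>\<^sub>2)\<close>. If some \<open>x\<close>, belonging to the vertex \<open>v\<close>, translates
  along an axis, then the elements commuting with it fix that axis up to translation, so the link of
  \<open>v\<close> is a clique, and it separates \<open>v\<close> from the rest. Otherwise every \<open>x\<close> is elliptic; the vertices
  whose conjugate fixes a given edge form a clique, and adjacent vertices outside it fix points on the
  same side of the edge. If no such clique separates, then all \<open>x\<close> lie on one side of every edge, and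
  pushing the edge along a hyperbolic element gives a contradiction. Finally, the
  separating clique found in \<open>\<Gamma>\<^sub>2\<close> has at most \<open>n\<close> vertices because it spans a free abelian group
  that embeds in \<open>A(K)\<close> up to finite index, and it lies in a clique with \<open>n\<close> vertices because it
  commutes with a free abelian group of rank \<open>n\<close>.

  The tree itself is replaced by the action on normal forms of cosets of \<open>A(S)\<close>, i.e. on its edges.
\<close>

section \<open>Presentations of right-angled Artin groups\<close>

text \<open>Killing the generators outside \<open>S\<close> is a retraction onto
  \<open>par S\<close>. So each vertex group \<open>par (P t)\<close> is a semidirect product of the
  kernel \<open>N t\<close> and \<open>par S\<close>, and the whole group is the free product of
  \<open>N True\<close> and \<open>N False\<close> extended by \<open>par S\<close>. The edges, i.e.
  the cosets of \<open>par S\<close>, thus have canonical representatives: alternating words in the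
  \<open>N t\<close>, with no transversal to choose.

  The groups are known only by presentations, so lower bounds on them come from homomorphisms:
  retractions, exponent sums and the action on words.

  An isomorphism of finite-index subgroups ignores generators and carries over little besides
  commutation and ranks of abelian subgroups. Only the subgroup \<open>H2\<close> of the second
  group acts on the tree; a fixed exponent \<open>k\<close> puts all conjugates of all
  \<open>k\<close>-th powers into it. Commuting nontrivial powers of generators come from equal or
  adjacent vertices, so commutation in turn recovers adjacency.

  The size \<open>n\<close> requires a clique that contains a prescribed set \<open>S\<close>, and
  rank alone does not place \<open>S\<close> in it. Hence the extension argument carries along
  elements \<open>q s\<close> that mark the vertices of \<open>S\<close>.\<close>

lemma (in group) normal_closure_minimal:
  assumes "N \<lhd> G" "R \<subseteq> N"
  shows "normal_closure G R \<subseteq> N"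
  unfolding normal_closure_def by (rule hull_minimal) (use assms in auto)

lemma reduced_mult_simps [simp]:
  "reduced_mult [] w = w"
  "reduced_mult (l # u) w = reduce_cons l (reduced_mult u w)"
  by (simp_all add: reduced_mult_def)

lemma reduced_Cons_eq: "reduced (l # w) \<Longrightarrow> reduce_cons l w = l # w"
  by (cases w) auto

context group
begin

definition letter_val :: "('v \<Rightarrow> 'a) \<Rightarrow> 'v \<times> bool \<Rightarrow> 'a" where
  "letter_val f l = (if snd l then f (fst l) else inv f (fst l))"

definition word_val :: "('v \<Rightarrow> 'a) \<Rightarrow> ('v \<times> bool) list \<Rightarrow> 'a" where
  "word_val f w = foldr (\<lambda>l a. letter_val f l \<otimes> a) w \<one>"

context
  fixes S :: "'v set" and f :: "'v \<Rightarrow> 'a"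
  assumes f: "\<And>v. v \<in> S \<Longrightarrow> f v \<in> carrier G"
begin

lemma letter_val_closed: "fst l \<in> S \<Longrightarrow> letter_val f l \<in> carrier G"
  using f by (auto simp: letter_val_def)

lemma word_val_closed: "fst ` set w \<subseteq> S \<Longrightarrow> word_val f w \<in> carrier G"
  by (induction w) (auto simp: word_val_def letter_val_closed)

lemma letter_val_inv_letter:
  "fst l \<in> S \<Longrightarrow> x \<in> carrier G \<Longrightarrow> letter_val f l \<otimes> (letter_val f (inv_letter l) \<otimes> x) = x"
  using f by (auto simp: letter_val_def inv_letter_def m_assoc[symmetric])

lemma word_val_reduce_cons:
  assumes "fst l \<in> S" "fst ` set w \<subseteq> S"
  shows "word_val f (reduce_cons l w) = letter_val f l \<otimes> word_val f w"
proof (cases w)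
  case (Cons k v)
  then show ?thesis
    using assms letter_val_inv_letter[of l "word_val f v"] word_val_closed[of v]
    by (auto simp: word_val_def)
qed (simp add: word_val_def)

lemma word_val_reduced_mult:
  assumes "fst ` set u \<subseteq> S" "fst ` set w \<subseteq> S"
  shows "word_val f (reduced_mult u w) = word_val f u \<otimes> word_val f w"
  using assms(1)
proof (induction u)
  case Nil
  then show ?case using assms(2) word_val_closed[of w] by (simp add: word_val_def)
next
  case (Cons l u)
  have "fst ` set (reduced_mult u w) \<subseteq> S"
    by (rule subset_trans[OF image_mono[OF set_reduced_mult]]) (use Cons.prems assms(2) in auto)
  then have "word_val f (reduced_mult (l # u) w) = letter_val f l \<otimes> word_val f (reduced_mult u w)"
    using Cons.prems by (simp add: word_val_reduce_cons)
  also have "\<dots> = letter_val f l \<otimes> (word_val f u \<otimes> word_val f w)"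
    using Cons by simp
  also have "\<dots> = word_val f (l # u) \<otimes> word_val f w"
    using Cons.prems assms(2) letter_val_closed[of l] word_val_closed[of u] word_val_closed[of w]
    by (simp add: word_val_def m_assoc)
  finally show ?case .
qed

lemma word_val_hom: "word_val f \<in> hom (free_group S) G"
  by (rule homI) (auto simp: free_group_def word_val_closed word_val_reduced_mult)

end

lemma word_val_free_gen: "f v \<in> carrier G \<Longrightarrow> word_val f (free_gen v) = f v"
  by (simp add: word_val_def free_gen_def letter_val_def)

lemma hom_Mod_factor:
  assumes "group H" "h \<in> hom H G" "N \<lhd> H" "\<And>x. x \<in> N \<Longrightarrow> h x = \<one>"
  obtains \<Phi> where "\<Phi> \<in> hom (H Mod N) G" "\<And>x. x \<in> carrier H \<Longrightarrow> \<Phi> (N #>\<^bsub>H\<^esub> x) = h x"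
proof -
  interpret H: group H by fact
  interpret N: normal N H by fact
  interpret h: group_hom H G h by (simp add: group_hom_def group_hom_axioms_def assms is_group)
  \<comment> \<open>\<open>h\<close> is constant on every coset of \<open>N\<close>, so the image of
    a coset is a singleton.\<close>
  define \<Phi> where "\<Phi> = (\<lambda>C. the_elem (h ` C))"
  have \<Phi>: "\<Phi> (N #>\<^bsub>H\<^esub> x) = h x" if x: "x \<in> carrier H" for x
  proof -
    have "h ` (N #>\<^bsub>H\<^esub> x) = {h x}"
    proof
      show "h ` (N #>\<^bsub>H\<^esub> x) \<subseteq> {h x}"
        using x assms(4) N.subset by (auto simp: r_coset_def)
      have "x \<in> N #>\<^bsub>H\<^esub> x" using x by (simp add: H.rcos_self N.is_subgroup)
      then show "{h x} \<subseteq> h ` (N #>\<^bsub>H\<^esub> x)" by blast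
    qed
    then show ?thesis by (simp add: \<Phi>_def)
  qed
  moreover have "\<Phi> \<in> hom (H Mod N) G"
  proof (rule homI)
    fix C assume "C \<in> carrier (H Mod N)"
    then show "\<Phi> C \<in> carrier G" using \<Phi> by (auto simp: FactGroup_def RCOSETS_def)
  next
    fix C D assume "C \<in> carrier (H Mod N)" "D \<in> carrier (H Mod N)"
    then obtain x y where xy: "x \<in> carrier H" "y \<in> carrier H" "C = N #>\<^bsub>H\<^esub> x" "D = N #>\<^bsub>H\<^esub> y"
      by (auto simp: FactGroup_def RCOSETS_def)
    then show "\<Phi> (C \<otimes>\<^bsub>H Mod N\<^esub> D) = \<Phi> C \<otimes> \<Phi> D"
      using \<Phi> by (simp add: FactGroup_def N.rcos_sum)
  qed
  ultimately show thesis by (rule that[rotated])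
qed

lemma commutator_eq_one_iff:
  assumes "x \<in> carrier G" "y \<in> carrier G"
  shows "commutator G x y = \<one> \<longleftrightarrow> x \<otimes> y = y \<otimes> x"
proof -
  have "commutator G x y = (x \<otimes> y) \<otimes> inv (y \<otimes> x)"
    using assms by (simp add: commutator_def m_assoc inv_mult_group)
  then show ?thesis
    using assms inv_solve_right'[of "\<one>" "x \<otimes> y" "y \<otimes> x"] by simp
qed

end

text \<open>Adjacency is a bare relation on a vertex set; the splittings below work with subsets of
  \<open>V\<close>, and digraphs return only at the end.\<close>

locale artin_group =
  fixes V :: "'v set" and R :: "('v \<times> 'v) set" and G :: "('v \<times> bool) list set monoid" (structure)
  assumes finite_V: "finite V"
    and R_sub: "R \<subseteq> V \<times> V"
    and R_sym: "(u, v) \<in> R \<Longrightarrow> (v, u) \<in> R"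
    and R_irrefl: "(u, u) \<notin> R"
    and G_eq: "G = presented_group V
                {commutator (free_group V) (free_gen u) (free_gen v) | u v. (u, v) \<in> R}"
begin

abbreviation relators where
  "relators \<equiv> {commutator (free_group V) (free_gen u) (free_gen v) | u v. (u, v) \<in> R}"

abbreviation relation_kernel where
  "relation_kernel \<equiv> normal_closure (free_group V) relators"

definition gen :: "'v \<Rightarrow> ('v \<times> bool) list set" where
  "gen v = relation_kernel #>\<^bsub>free_group V\<^esub> free_gen v"

lemma free_gen_closed: "v \<in> V \<Longrightarrow> free_gen v \<in> carrier (free_group V)"
  by (simp add: free_gen_def free_group_def)

lemma relators_closed: "relators \<subseteq> carrier (free_group V)"
proof -
  interpret F: group "free_group V" by (rule group_free_group)
  show ?thesis
    using R_sub free_gen_closed by (auto simp: commutator_def intro!: F.m_closed F.inv_closed)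
qed

lemma normal_relation_kernel: "relation_kernel \<lhd> free_group V"
  by (intro normal_normal_closure group_free_group relators_closed)

lemma group_G: "group G"
  unfolding G_eq by (intro group_presented_group relators_closed)

sublocale group G by (rule group_G)

lemma gen_closed [simp, intro]: "v \<in> V \<Longrightarrow> gen v \<in> carrier G"
  using free_gen_closed by (auto simp: gen_def G_eq presented_group_def FactGroup_def RCOSETS_def)

lemma gen_comm:
  assumes "(u, v) \<in> R" shows "gen u \<otimes> gen v = gen v \<otimes> gen u"
proof -
  interpret F: group "free_group V" by (rule group_free_group)
  interpret N: normal relation_kernel "free_group V" by (rule normal_relation_kernel)
  have uv: "u \<in> V" "v \<in> V" using assms R_sub by auto
  let ?q = "\<lambda>x. relation_kernel #>\<^bsub>free_group V\<^esub> x"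
  have q: "?q \<in> hom (free_group V) G"
    unfolding G_eq presented_group_def by (rule N.r_coset_hom_Mod)
  interpret q: group_hom "free_group V" G ?q
    by (simp add: group_hom_def group_hom_axioms_def q F.is_group is_group)
  have "commutator (free_group V) (free_gen u) (free_gen v) \<in> relation_kernel"
    using assms unfolding normal_closure_def by (intro hull_inc) blast
  then have "?q (commutator (free_group V) (free_gen u) (free_gen v)) = \<one>"
    using N.rcos_const by (auto simp: G_eq presented_group_def FactGroup_def)
  then have "?q (free_gen u) \<otimes> ?q (free_gen v) \<otimes> inv ?q (free_gen u) \<otimes> inv ?q (free_gen v) = \<one>"
    using uv free_gen_closed unfolding commutator_def[of "free_group V" "free_gen u" "free_gen v"]
    by (simp del: q.hom_mult q.hom_inv add: q.hom_mult[symmetric] q.hom_inv[symmetric])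
  then have "commutator G (gen u) (gen v) = \<one>"
    unfolding commutator_def gen_def .
  then show ?thesis using uv by (simp add: commutator_eq_one_iff)
qed

text \<open>The source of every homomorphism out of the group: the retractions, the exponent sums
  and the action on words are all obtained from it.\<close>

lemma universal_property:
  assumes "group K" "\<And>v. v \<in> V \<Longrightarrow> f v \<in> carrier K"
    and "\<And>u v. (u, v) \<in> R \<Longrightarrow> f u \<otimes>\<^bsub>K\<^esub> f v = f v \<otimes>\<^bsub>K\<^esub> f u"
  obtains \<Phi> where "\<Phi> \<in> hom G K" "\<And>v. v \<in> V \<Longrightarrow> \<Phi> (gen v) = f v"
proof -
  interpret K: group K by fact
  interpret F: group "free_group V" by (rule group_free_group)
  interpret h: group_hom "free_group V" K "K.word_val f"
    by (simp add: group_hom_def group_hom_axioms_def K.is_group F.is_group K.word_val_hom assms(2))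
  have "relators \<subseteq> kernel (free_group V) K (K.word_val f)"
  proof
    fix r assume r: "r \<in> relators"
    then obtain u v where uv: "(u, v) \<in> R" "r = commutator (free_group V) (free_gen u) (free_gen v)"
      by blast
    then have "K.word_val f r = commutator K (f u) (f v)"
      using R_sub free_gen_closed assms(2) K.word_val_free_gen[of f] by (auto simp: commutator_def)
    moreover have "commutator K (f u) (f v) = \<one>\<^bsub>K\<^esub>"
      using uv R_sub assms(2,3) by (subst K.commutator_eq_one_iff) auto
    ultimately show "r \<in> kernel (free_group V) K (K.word_val f)"
      using r relators_closed by (auto simp: kernel_def)
  qed
  then have "relation_kernel \<subseteq> kernel (free_group V) K (K.word_val f)"
    by (intro F.normal_closure_minimal h.normal_kernel)
  then have "K.word_val f x = \<one>\<^bsub>K\<^esub>" if "x \<in> relation_kernel" for x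
    using that by (auto simp: kernel_def)
  then obtain \<Phi> where "\<Phi> \<in> hom (free_group V Mod relation_kernel) K"
    "\<And>x. x \<in> carrier (free_group V) \<Longrightarrow> \<Phi> (relation_kernel #>\<^bsub>free_group V\<^esub> x) = K.word_val f x"
    by (rule K.hom_Mod_factor[OF F.is_group h.homh normal_relation_kernel]) blast+
  then show thesis
    using that[of \<Phi>] free_gen_closed assms(2)
    by (simp add: gen_def K.word_val_free_gen G_eq presented_group_def)
qed

lemma carrier_generate: "carrier G = generate G (gen ` V)"
proof
  interpret F: group "free_group V" by (rule group_free_group)
  interpret N: normal relation_kernel "free_group V" by (rule normal_relation_kernel)
  let ?q = "\<lambda>x. relation_kernel #>\<^bsub>free_group V\<^esub> x"
  have q: "?q \<in> hom (free_group V) G"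
    unfolding G_eq presented_group_def by (rule N.r_coset_hom_Mod)
  interpret q: group_hom "free_group V" G ?q
    by (simp add: group_hom_def group_hom_axioms_def q F.is_group is_group)
  have letter: "?q [l] \<in> generate G (gen ` V)" if "fst l \<in> V" for l
  proof (cases "snd l")
    case True
    then have "?q [l] = gen (fst l)" by (cases l) (simp add: gen_def free_gen_def)
    then show ?thesis using that by (auto intro: generate.incl)
  next
    case False
    have "[l] = inv\<^bsub>free_group V\<^esub> (free_gen (fst l))"
      by (rule F.inv_equality[symmetric])
        (use that False in \<open>auto simp: free_gen_def free_group_def inv_letter_def prod_eq_iff\<close>)
    then have "?q [l] = inv (gen (fst l))"
      using that free_gen_closed[of "fst l"] by (simp add: gen_def)
    then show ?thesis using that by (auto intro: generate.inv)
  qed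
  have "?q w \<in> generate G (gen ` V)" if "w \<in> carrier (free_group V)" for w
    using that
  proof (induction w)
    case Nil
    have "?q [] = \<one>" using q.hom_one by (simp add: free_group_def)
    then show ?case by (simp add: generate.one)
  next
    case (Cons l w)
    then have w: "w \<in> carrier (free_group V)" "[l] \<in> carrier (free_group V)" "fst l \<in> V"
      by (auto simp: free_group_def dest: reduced_tl)
    have "l # w = [l] \<otimes>\<^bsub>free_group V\<^esub> w"
      using Cons.prems reduced_Cons_eq[of l w] by (simp add: free_group_def)
    then have "?q (l # w) = ?q [l] \<otimes> ?q w" using w by simp
    then show ?case using Cons.IH[OF w(1)] letter[OF w(3)] by (simp add: generate.eng)
  qed
  then show "carrier G \<subseteq> generate G (gen ` V)"
    by (auto simp: G_eq presented_group_def FactGroup_def RCOSETS_def)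
  show "generate G (gen ` V) \<subseteq> carrier G" by (rule generate_incl) auto
qed

end

section \<open>Parabolic subgroups, retractions and exponents\<close>

context group
begin

lemma inv_cancel_left [simp]:
  "x \<in> carrier G \<Longrightarrow> y \<in> carrier G \<Longrightarrow> inv x \<otimes> (x \<otimes> y) = y"
  "x \<in> carrier G \<Longrightarrow> y \<in> carrier G \<Longrightarrow> x \<otimes> (inv x \<otimes> y) = y"
  by (simp_all flip: m_assoc)

lemma subgroup_commutant:
  assumes "B \<subseteq> carrier G"
  shows "subgroup {x \<in> carrier G. \<forall>b\<in>B. x \<otimes> b = b \<otimes> x} G"
proof (rule subgroupI)
  fix x assume x: "x \<in> {x \<in> carrier G. \<forall>b\<in>B. x \<otimes> b = b \<otimes> x}"
  have "inv x \<otimes> b = b \<otimes> inv x" if "b \<in> B" for b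
  proof -
    have b: "b \<in> carrier G" "x \<in> carrier G" "x \<otimes> b = b \<otimes> x" using that x assms by auto
    have "inv x \<otimes> b = inv x \<otimes> (b \<otimes> x) \<otimes> inv x" using b(1,2) by (simp add: m_assoc)
    also have "\<dots> = inv x \<otimes> (x \<otimes> b) \<otimes> inv x" by (simp only: b(3))
    also have "\<dots> = b \<otimes> inv x" using b(1,2) by simp
    finally show ?thesis .
  qed
  then show "inv x \<in> {x \<in> carrier G. \<forall>b\<in>B. x \<otimes> b = b \<otimes> x}" using x by auto
next
  fix x y
  assume x: "x \<in> {x \<in> carrier G. \<forall>b\<in>B. x \<otimes> b = b \<otimes> x}" and y: "y \<in> {x \<in> carrier G. \<forall>b\<in>B. x \<otimes> b = b \<otimes> x}"
  have "x \<otimes> y \<otimes> b = b \<otimes> (x \<otimes> y)" if "b \<in> B" for b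
  proof -
    have b: "b \<in> carrier G" "x \<in> carrier G" "y \<in> carrier G" "x \<otimes> b = b \<otimes> x" "y \<otimes> b = b \<otimes> y"
      using that x y assms by auto
    have "x \<otimes> y \<otimes> b = x \<otimes> (b \<otimes> y)" using b by (simp add: m_assoc)
    also have "\<dots> = (b \<otimes> x) \<otimes> y" using b by (simp add: m_assoc[symmetric])
    finally show ?thesis using b by (simp add: m_assoc)
  qed
  then show "x \<otimes> y \<in> {x \<in> carrier G. \<forall>b\<in>B. x \<otimes> b = b \<otimes> x}" using x y by auto
next
  show "{x \<in> carrier G. \<forall>b\<in>B. x \<otimes> b = b \<otimes> x} \<noteq> {}"
    using assms by (auto intro!: exI[of _ \<one>])
qed auto

lemma generate_commute:
  assumes "A \<subseteq> carrier G" "B \<subseteq> carrier G" "\<And>a b. a \<in> A \<Longrightarrow> b \<in> B \<Longrightarrow> a \<otimes> b = b \<otimes> a"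
    and "x \<in> generate G A" "y \<in> generate G B"
  shows "x \<otimes> y = y \<otimes> x"
proof -
  have B: "generate G B \<subseteq> carrier G" by (rule generate_incl[OF assms(2)])
  have "generate G A \<subseteq> {x \<in> carrier G. \<forall>b\<in>B. x \<otimes> b = b \<otimes> x}"
    using assms(1-3) by (intro generate_subgroup_incl subgroup_commutant) auto
  then have x: "x \<in> carrier G" "\<And>b. b \<in> B \<Longrightarrow> b \<otimes> x = x \<otimes> b" using assms(4) by auto
  have "generate G B \<subseteq> {y \<in> carrier G. \<forall>b\<in>{x}. y \<otimes> b = b \<otimes> y}"
    using x assms(2) by (intro generate_subgroup_incl subgroup_commutant) auto
  then show ?thesis using assms(5) by auto
qed

lemma commute_int_pow:
  assumes "x \<in> carrier G" "y \<in> carrier G" "x \<otimes> y = y \<otimes> x"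
  shows "x \<otimes> y [^] (k::int) = y [^] k \<otimes> x"
proof -
  have C: "subgroup {z \<in> carrier G. \<forall>b\<in>{x}. z \<otimes> b = b \<otimes> z} G"
    by (rule subgroup_commutant) (use assms(1) in simp)
  have "y \<in> {z \<in> carrier G. \<forall>b\<in>{x}. z \<otimes> b = b \<otimes> z}"
    using assms(2) assms(3)[symmetric] by simp
  then have "y [^] k \<in> {z \<in> carrier G. \<forall>b\<in>{x}. z \<otimes> b = b \<otimes> z}"
    by (rule subgroup_int_pow_closed[OF C])
  then show ?thesis by auto
qed

lemma hom_eq_on_generate:
  assumes "group K" "f \<in> hom G K" "h \<in> hom G K" "A \<subseteq> carrier G"
    and "\<And>a. a \<in> A \<Longrightarrow> f a = h a" "x \<in> generate G A"
  shows "f x = h x"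
proof -
  interpret f: group_hom G K f by (simp add: group_hom_def group_hom_axioms_def is_group assms)
  interpret h: group_hom G K h by (simp add: group_hom_def group_hom_axioms_def is_group assms)
  have "subgroup {x \<in> carrier G. f x = h x} G"
    by (rule subgroupI) auto
  then have "generate G A \<subseteq> {x \<in> carrier G. f x = h x}"
    using assms by (intro generate_subgroup_incl) auto
  then show ?thesis using assms by auto
qed

lemma conj_hom: "g \<in> carrier G \<Longrightarrow> (\<lambda>x. g \<otimes> x \<otimes> inv g) \<in> hom G G"
  by (rule homI) (auto simp: m_assoc)

lemma conj_conj:
  "\<lbrakk>g \<in> carrier G; h \<in> carrier G; x \<in> carrier G\<rbrakk> \<Longrightarrow>
    g \<otimes> (h \<otimes> x \<otimes> inv h) \<otimes> inv g = (g \<otimes> h) \<otimes> x \<otimes> inv (g \<otimes> h)"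
  by (simp add: m_assoc inv_mult_group)

lemma conj_eq_one_iff:
  assumes "g \<in> carrier G" "x \<in> carrier G"
  shows "g \<otimes> x \<otimes> inv g = \<one> \<longleftrightarrow> x = \<one>"
proof
  assume "g \<otimes> x \<otimes> inv g = \<one>"
  then have "g \<otimes> x = g" using assms inv_solve_right'[of \<one> "g \<otimes> x" g] by simp
  then show "x = \<one>" using assms by simp
qed (use assms in simp)

end

context artin_group
begin

definition par :: "'v set \<Rightarrow> ('v \<times> bool) list set set" where
  "par U = generate G (gen ` U)"

definition clique :: "'v set \<Rightarrow> bool" where
  "clique K \<longleftrightarrow> K \<subseteq> V \<and> (\<forall>u\<in>K. \<forall>v\<in>K. u \<noteq> v \<longrightarrow> (u, v) \<in> R)"

text \<open>\<open>SOME\<close> is harmless here: the values on generators leave at most one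
  homomorphism on the carrier, and the universal property supplies one.\<close>

definition retract :: "'v set \<Rightarrow> ('v \<times> bool) list set \<Rightarrow> ('v \<times> bool) list set" where
  "retract U = (SOME \<Phi>. \<Phi> \<in> hom G G \<and> (\<forall>v\<in>V. \<Phi> (gen v) = (if v \<in> U then gen v else \<one>)))"

text \<open>Exponent sums are invariant under conjugation, so they detect which vertices a conjugate
  of a parabolic subgroup involves, and they certify infinite order.\<close>

definition expo :: "'v \<Rightarrow> ('v \<times> bool) list set \<Rightarrow> int" where
  "expo v = (SOME \<Phi>. \<Phi> \<in> hom G integer_group \<and> (\<forall>u\<in>V. \<Phi> (gen u) = (if u = v then 1 else 0)))"

lemma R_in_V: "(u, v) \<in> R \<Longrightarrow> u \<in> V \<and> v \<in> V"
  using R_sub by auto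

lemma retract_props: "retract U \<in> hom G G \<and> (\<forall>v\<in>V. retract U (gen v) = (if v \<in> U then gen v else \<one>))"
proof -
  let ?f = "\<lambda>v. if v \<in> U then gen v else \<one>"
  obtain \<Phi> where "\<Phi> \<in> hom G G" "\<And>v. v \<in> V \<Longrightarrow> \<Phi> (gen v) = ?f v"
  proof (rule universal_property[of G ?f])
    show "?f u \<otimes> ?f v = ?f v \<otimes> ?f u" if "(u, v) \<in> R" for u v
      using gen_comm[OF that] R_in_V[OF that] by simp
  qed (auto simp: is_group)
  then have "\<exists>\<Phi>. \<Phi> \<in> hom G G \<and> (\<forall>v\<in>V. \<Phi> (gen v) = ?f v)" by blast
  from someI_ex[OF this] show ?thesis unfolding retract_def .
qed

lemma expo_props: "expo v \<in> hom G integer_group \<and> (\<forall>u\<in>V. expo v (gen u) = (if u = v then 1 else 0))"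
proof -
  let ?f = "\<lambda>u. if u = v then 1 else 0 :: int"
  obtain \<Phi> where "\<Phi> \<in> hom G integer_group" "\<And>u. u \<in> V \<Longrightarrow> \<Phi> (gen u) = ?f u"
    by (rule universal_property[of integer_group ?f]) auto
  then have "\<exists>\<Phi>. \<Phi> \<in> hom G integer_group \<and> (\<forall>u\<in>V. \<Phi> (gen u) = ?f u)" by blast
  from someI_ex[OF this] show ?thesis unfolding expo_def .
qed

lemmas retract_hom = retract_props[THEN conjunct1]
lemmas expo_hom = expo_props[THEN conjunct1]

lemma retract_gen: "v \<in> V \<Longrightarrow> retract U (gen v) = (if v \<in> U then gen v else \<one>)"
  using retract_props by auto

lemma expo_gen: "u \<in> V \<Longrightarrow> expo v (gen u) = (if u = v then 1 else 0)"
  using expo_props by auto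

sublocale retract: group_hom G G "retract U" for U
  by (simp add: group_hom_def group_hom_axioms_def is_group retract_hom)

sublocale expo: group_hom G integer_group "expo v" for v
  by (simp add: group_hom_def group_hom_axioms_def is_group expo_hom)

lemma expo_mult [simp]: "x \<in> carrier G \<Longrightarrow> y \<in> carrier G \<Longrightarrow> expo v (x \<otimes> y) = expo v x + expo v y"
  using expo.hom_mult by simp

lemma expo_inv [simp]: "x \<in> carrier G \<Longrightarrow> expo v (inv x) = - expo v x"
  using expo.hom_inv by simp

lemma expo_int_pow [simp]: "x \<in> carrier G \<Longrightarrow> expo v (x [^] (k::int)) = k * expo v x"
  using expo.hom_int_pow by simp

lemma expo_nat_pow [simp]: "x \<in> carrier G \<Longrightarrow> expo v (x [^] (k::nat)) = int k * expo v x"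
  using expo.hom_nat_pow by simp

lemma gen_image_closed: "U \<subseteq> V \<Longrightarrow> gen ` U \<subseteq> carrier G"
  by auto

lemma par_subgroup: "U \<subseteq> V \<Longrightarrow> subgroup (par U) G"
  unfolding par_def by (intro generate_is_subgroup gen_image_closed)

lemma par_closed: "U \<subseteq> V \<Longrightarrow> x \<in> par U \<Longrightarrow> x \<in> carrier G"
  by (rule subgroup.mem_carrier[OF par_subgroup])

lemma par_mono: "U \<subseteq> W \<Longrightarrow> par U \<subseteq> par W"
  unfolding par_def by (intro mono_generate image_mono)

lemma gen_in_par: "v \<in> U \<Longrightarrow> gen v \<in> par U"
  unfolding par_def by (auto intro: generate.incl)

lemma par_V: "par V = carrier G"
  using carrier_generate by (simp add: par_def)

lemma par_least: "subgroup H G \<Longrightarrow> gen ` U \<subseteq> H \<Longrightarrow> par U \<subseteq> H"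
  unfolding par_def by (rule generate_subgroup_incl)

lemma par_empty: "par {} = {\<one>}"
  unfolding par_def by (simp add: generate_empty)

lemma retract_par:
  assumes "W \<subseteq> V" "x \<in> par W"
  shows "retract U x \<in> par (U \<inter> W)"
proof -
  have "subgroup (par (U \<inter> W)) G" using assms by (intro par_subgroup) auto
  then have "subgroup {x \<in> carrier G. retract U x \<in> par (U \<inter> W)} G"
    by (intro subgroupI)
      (auto intro: subgroup.m_closed subgroup.m_inv_closed subgroup.one_closed intro!: exI[of _ \<one>])
  moreover have "gen ` W \<subseteq> {x \<in> carrier G. retract U x \<in> par (U \<inter> W)}"
    using assms \<open>subgroup (par (U \<inter> W)) G\<close>
    by (auto simp: retract_gen gen_in_par subset_iff intro: subgroup.one_closed)
  ultimately have "par W \<subseteq> {x \<in> carrier G. retract U x \<in> par (U \<inter> W)}"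
    by (rule par_least)
  then show ?thesis using assms by auto
qed

lemma retract_in_par: "U \<subseteq> V \<Longrightarrow> x \<in> carrier G \<Longrightarrow> retract U x \<in> par U"
  using retract_par[of V x U] by (simp add: par_V Int_absorb2)

lemma retract_id:
  assumes "W \<subseteq> V" "W \<subseteq> U" "x \<in> par W"
  shows "retract U x = x"
proof -
  have "(\<lambda>x. x) \<in> hom G G" by (auto simp: hom_def)
  then have "retract U x = (\<lambda>x. x) x"
    by (rule hom_eq_on_generate[OF is_group retract_hom, where A = "gen ` W"])
      (use assms in \<open>auto simp: par_def retract_gen subset_iff\<close>)
  then show ?thesis .
qed

lemma expo_retract:
  assumes "x \<in> carrier G" "v \<in> U"
  shows "expo v (retract U x) = expo v x"
proof -
  have "expo v \<circ> retract U \<in> hom G integer_group" by (rule Group.hom_compose[OF retract_hom expo_hom])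
  then have "(expo v \<circ> retract U) x = expo v x"
    by (rule hom_eq_on_generate[OF group_integer_group _ expo_hom, where A = "gen ` V"])
      (use assms carrier_generate in \<open>auto simp: retract_gen expo_gen\<close>)
  then show ?thesis by simp
qed

lemma expo_par:
  assumes "U \<subseteq> V" "x \<in> par U" "v \<notin> U"
  shows "expo v x = 0"
proof -
  have "(\<lambda>_. 0) \<in> hom G integer_group" by (auto simp: hom_def)
  then have "expo v x = (\<lambda>_. 0) x"
    by (rule hom_eq_on_generate[OF group_integer_group expo_hom, where A = "gen ` U"])
      (use assms in \<open>auto simp: par_def expo_gen subset_iff\<close>)
  then show ?thesis .
qed

lemma par_commute:
  assumes "U \<subseteq> V" "W \<subseteq> V" "\<And>u w. u \<in> U \<Longrightarrow> w \<in> W \<Longrightarrow> u = w \<or> (u, w) \<in> R"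
    and "x \<in> par U" "y \<in> par W"
  shows "x \<otimes> y = y \<otimes> x"
proof (rule generate_commute)
  show "x \<in> generate G (gen ` U)" "y \<in> generate G (gen ` W)" using assms by (auto simp: par_def)
  show "a \<otimes> b = b \<otimes> a" if "a \<in> gen ` U" "b \<in> gen ` W" for a b
    using that assms(3) gen_comm by (metis imageE)
  show "gen ` U \<subseteq> carrier G" "gen ` W \<subseteq> carrier G" using assms by auto
qed

lemma par_clique_commute:
  assumes "clique K" "x \<in> par K" "y \<in> par K"
  shows "x \<otimes> y = y \<otimes> x"
  by (rule par_commute[of K K]) (use assms in \<open>auto simp: clique_def\<close>)

lemma clique_subset: "clique K \<Longrightarrow> L \<subseteq> K \<Longrightarrow> clique L"
  by (auto simp: clique_def)

lemma clique_in_V: "clique K \<Longrightarrow> K \<subseteq> V"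
  by (simp add: clique_def)

text \<open>\<open>gen z\<close> commutes with all of \<open>par U\<close>, so the products of this
  shape already form a subgroup containing the generators. Hence the kernel of \<open>expo z\<close>
  on \<open>par (insert z U)\<close> is \<open>par U\<close>, which is how ranks are lowered one
  vertex at a time.\<close>

lemma par_insert:
  assumes "z \<in> V" "U \<subseteq> V" "\<And>u. u \<in> U \<Longrightarrow> (z, u) \<in> R" "x \<in> par (insert z U)"
  obtains i :: int and a where "a \<in> par U" "x = gen z [^] i \<otimes> a"
proof -
  let ?H = "{gen z [^] i \<otimes> a | (i::int) a. a \<in> par U}"
  interpret P: subgroup "par U" G by (rule par_subgroup[OF assms(2)])
  have z: "gen z \<in> carrier G" using assms by auto
  have comm: "a \<otimes> gen z [^] (i::int) = gen z [^] i \<otimes> a" if "a \<in> par U" for a i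
  proof (rule commute_int_pow)
    show "a \<otimes> gen z = gen z \<otimes> a"
      by (rule par_commute[of U "{z}"]) (use assms that R_sym gen_in_par in auto)
  qed (use that z in auto)
  have "subgroup ?H G"
  proof (rule subgroupI)
    fix x assume "x \<in> ?H"
    then obtain i :: int and a where ia: "a \<in> par U" "x = gen z [^] i \<otimes> a" by auto
    then have "inv x = inv a \<otimes> gen z [^] (- i)" using z by (simp add: inv_mult_group int_pow_neg)
    also have "\<dots> = gen z [^] (- i) \<otimes> inv a" using ia comm[of "inv a" "- i"] by simp
    finally show "inv x \<in> ?H" using ia by blast
  next
    fix x y assume "x \<in> ?H" "y \<in> ?H"
    then obtain i j :: int and a b where
      ia: "a \<in> par U" "x = gen z [^] i \<otimes> a" "b \<in> par U" "y = gen z [^] j \<otimes> b" by blast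
    have "x \<otimes> y = gen z [^] i \<otimes> (a \<otimes> gen z [^] j) \<otimes> b"
      using ia z by (simp add: m_assoc)
    also have "\<dots> = gen z [^] i \<otimes> (gen z [^] j \<otimes> a) \<otimes> b" using comm ia by simp
    also have "\<dots> = gen z [^] (i + j) \<otimes> (a \<otimes> b)"
      unfolding int_pow_mult[OF z] using ia(1,3) z by (simp add: m_assoc)
    finally show "x \<otimes> y \<in> ?H" using ia by blast
  next
    have "gen z [^] (0::int) \<otimes> \<one> \<in> ?H" using P.one_closed by blast
    then show "?H \<noteq> {}" by blast
  qed (use z in auto)
  moreover have "gen ` insert z U \<subseteq> ?H"
  proof -
    have "gen z = gen z [^] (1::int) \<otimes> \<one>" using z by simp
    then have "gen z \<in> ?H" using P.one_closed by blast
    moreover have "gen u \<in> ?H" if "u \<in> U" for u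
    proof -
      have "gen u = gen z [^] (0::int) \<otimes> gen u" using that assms by auto
      then show ?thesis using gen_in_par[OF that] by blast
    qed
    ultimately show ?thesis by blast
  qed
  ultimately have "par (insert z U) \<subseteq> ?H" by (rule par_least)
  then show thesis using that assms(4) by blast
qed

lemma par_insert_expo_zero:
  assumes "z \<in> V" "U \<subseteq> V" "\<And>u. u \<in> U \<Longrightarrow> (z, u) \<in> R" "x \<in> par (insert z U)" "expo z x = 0"
  shows "x \<in> par U"
proof -
  obtain i :: int and a where ia: "a \<in> par U" "x = gen z [^] i \<otimes> a"
    using par_insert[OF assms(1-4)] by metis
  have a: "a \<in> carrier G" using par_closed[OF assms(2) ia(1)] .
  have "z \<notin> U" using assms(3) R_irrefl by blast
  then have "expo z x = i" using ia a assms expo_par[of U a z] by (simp add: expo_gen)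
  then show ?thesis using ia a assms(5) by simp
qed

end

section \<open>Amalgamated products acting on alternating words\<close>

locale free_factors = group +
  fixes N :: "bool \<Rightarrow> 'a set"
  assumes N_subgroup: "subgroup (N t) G"
begin

definition words :: "(bool \<times> 'a) list set" where
  "words = {w. (\<forall>(t, n) \<in> set w. n \<in> N t \<and> n \<noteq> \<one>) \<and> successively (\<lambda>p q. fst p \<noteq> fst q) w}"

text \<open>Left multiplication by a syllable in the free product, on normal forms. A trivial
  \<open>n\<close> is treated apart because words contain no trivial syllables.\<close>

definition fcons :: "bool \<Rightarrow> 'a \<Rightarrow> (bool \<times> 'a) list \<Rightarrow> (bool \<times> 'a) list" where
  "fcons t n w = (if n = \<one> then w else
     (case w of [] \<Rightarrow> [(t, n)]
      | p # w' \<Rightarrow> if fst p = t then (if n \<otimes> snd p = \<one> then w' else (t, n \<otimes> snd p) # w')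
                 else (t, n) # w))"

text \<open>How \<open>par S\<close> acts on the free product inside the semidirect product.\<close>

definition conj_word :: "'a \<Rightarrow> (bool \<times> 'a) list \<Rightarrow> (bool \<times> 'a) list" where
  "conj_word c w = map (\<lambda>(t, n). (t, c \<otimes> n \<otimes> inv c)) w"

definition ev :: "(bool \<times> 'a) list \<Rightarrow> 'a" where
  "ev w = foldr (\<lambda>(t, n) a. n \<otimes> a) w \<one>"

definition fmul :: "(bool \<times> 'a) list \<Rightarrow> (bool \<times> 'a) list \<Rightarrow> (bool \<times> 'a) list" where
  "fmul u w = foldr (\<lambda>(t, n). fcons t n) u w"

lemma N_closed: "n \<in> N t \<Longrightarrow> n \<in> carrier G"
  by (rule subgroup.mem_carrier[OF N_subgroup])

lemma N_mult: "n \<in> N t \<Longrightarrow> m \<in> N t \<Longrightarrow> n \<otimes> m \<in> N t"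
  by (rule subgroup.m_closed[OF N_subgroup])

lemma N_inv: "n \<in> N t \<Longrightarrow> inv n \<in> N t"
  by (rule subgroup.m_inv_closed[OF N_subgroup])

lemma words_Nil [simp]: "[] \<in> words"
  by (simp add: words_def)

lemma words_Cons:
  "(t, n) # w \<in> words \<longleftrightarrow> n \<in> N t \<and> n \<noteq> \<one> \<and> w \<in> words \<and> (w = [] \<or> fst (hd w) \<noteq> t)"
  by (cases w) (auto simp: words_def)

lemma words_append:
  "u @ w \<in> words \<longleftrightarrow> u \<in> words \<and> w \<in> words \<and> (u = [] \<or> w = [] \<or> fst (last u) \<noteq> fst (hd w))"
  by (auto simp: words_def successively_append_iff)

lemma fcons_words: "n \<in> N t \<Longrightarrow> w \<in> words \<Longrightarrow> fcons t n w \<in> words"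
  by (cases w) (auto simp: fcons_def words_Cons N_mult)

lemma fcons_one [simp]: "fcons t \<one> w = w"
  by (simp add: fcons_def)

text \<open>Van der Waerden's device: each factor acts on the set of normal forms, so associativity
  of a product of normal forms never has to be proved.\<close>

lemma fcons_mult:
  assumes "n \<in> N t" "m \<in> N t" "w \<in> words"
  shows "fcons t n (fcons t m w) = fcons t (n \<otimes> m) w"
proof -
  have nm: "n \<in> carrier G" "m \<in> carrier G" using assms N_closed by auto
  show ?thesis
  proof (cases w)
    case Nil
    then show ?thesis using nm by (auto simp: fcons_def)
  next
    case (Cons p w')
    obtain s k where p: "p = (s, k)" by fastforce
    have k: "k \<in> N s" "k \<noteq> \<one>" "k \<in> carrier G" "w' = [] \<or> fst (hd w') \<noteq> s"
      using assms(3) Cons p N_closed by (auto simp: words_Cons)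
    show ?thesis
    proof (cases "s = t")
      case False
      then show ?thesis using nm Cons p k by (auto simp: fcons_def m_assoc)
    next
      case True
      show ?thesis
      proof (cases "m = \<one> \<or> n = \<one>")
        case True
        then show ?thesis using nm by auto
      next
        case mn: False
        show ?thesis
        proof (cases "m \<otimes> k = \<one>")
          case mk: True
          then have "n \<otimes> m \<otimes> k = n" using nm k by (simp add: m_assoc)
          moreover have "n \<otimes> m = \<one> \<longleftrightarrow> n = k"
          proof -
            have "k = inv m" using mk nm k by (metis inv_equality inv_inv inv_closed)
            then show ?thesis using nm by (metis inv_equality l_inv)
          qed
          ultimately show ?thesis using mk mn \<open>s = t\<close> Cons p k
            by (cases w') (auto simp: fcons_def)
        next
          case mk: False
          then show ?thesis using mn \<open>s = t\<close> Cons p nm k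
            by (auto simp: fcons_def m_assoc[symmetric])
        qed
      qed
    qed
  qed
qed

lemma ev_Nil [simp]: "ev [] = \<one>"
  and ev_Cons [simp]: "ev ((t, n) # w) = n \<otimes> ev w"
  by (simp_all add: ev_def)

lemma ev_closed [simp]: "w \<in> words \<Longrightarrow> ev w \<in> carrier G"
  by (induction w) (auto simp: words_Cons N_closed)

lemma ev_fcons:
  assumes "n \<in> N t" "w \<in> words"
  shows "ev (fcons t n w) = n \<otimes> ev w"
proof (cases w)
  case Nil
  then show ?thesis using assms by (auto simp: fcons_def N_closed)
next
  case (Cons p w')
  then obtain s k where p: "p = (s, k)" by fastforce
  have "k \<in> carrier G" "ev w' \<in> carrier G" "n \<in> carrier G"
    using assms Cons p by (auto simp: words_Cons N_closed)
  then show ?thesis using Cons p by (auto simp: fcons_def m_assoc[symmetric])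
qed

lemma conj_word_Nil [simp]: "conj_word c [] = []"
  and conj_word_Cons [simp]: "conj_word c ((t, n) # w) = (t, c \<otimes> n \<otimes> inv c) # conj_word c w"
  and conj_word_eq_Nil [simp]: "conj_word c w = [] \<longleftrightarrow> w = []"
  and length_conj_word [simp]: "length (conj_word c w) = length w"
  by (simp_all add: conj_word_def)

lemma conj_word_hd_last:
  "w \<noteq> [] \<Longrightarrow> fst (hd (conj_word c w)) = fst (hd w)"
  "w \<noteq> [] \<Longrightarrow> fst (last (conj_word c w)) = fst (last w)"
  by (simp_all add: conj_word_def hd_map last_map case_prod_unfold)

lemma conj_word_words:
  assumes "c \<in> carrier G" "\<And>t n. n \<in> N t \<Longrightarrow> c \<otimes> n \<otimes> inv c \<in> N t" "w \<in> words"
  shows "conj_word c w \<in> words"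
  using assms(3)
proof (induction w)
  case (Cons p w)
  then show ?case using assms(1,2) N_closed
    by (cases p) (auto simp: words_Cons conj_eq_one_iff conj_word_hd_last)
qed simp

lemma conj_word_fcons:
  assumes "c \<in> carrier G" "n \<in> N t" "w \<in> words"
  shows "conj_word c (fcons t n w) = fcons t (c \<otimes> n \<otimes> inv c) (conj_word c w)"
proof (cases w)
  case Nil
  then show ?thesis using assms by (auto simp: fcons_def N_closed conj_eq_one_iff)
next
  case (Cons p w')
  then obtain s k where p: "p = (s, k)" by fastforce
  have k: "k \<in> carrier G" "n \<in> carrier G" using assms Cons p by (auto simp: words_Cons N_closed)
  have "(c \<otimes> n \<otimes> inv c) \<otimes> (c \<otimes> k \<otimes> inv c) = c \<otimes> (n \<otimes> k) \<otimes> inv c"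
    using k assms by (simp add: m_assoc)
  then show ?thesis using Cons p k assms by (auto simp: fcons_def conj_eq_one_iff)
qed

lemma conj_word_conj_word:
  assumes "c \<in> carrier G" "d \<in> carrier G" "w \<in> words"
  shows "conj_word c (conj_word d w) = conj_word (c \<otimes> d) w"
  using assms(3)
proof (induction w)
  case (Cons p w)
  then show ?case using assms(1,2) N_closed by (cases p) (auto simp: words_Cons conj_conj)
qed simp

lemma conj_word_one: "w \<in> words \<Longrightarrow> conj_word \<one> w = w"
proof (induction w)
  case (Cons p w)
  then show ?case using N_closed by (cases p) (auto simp: words_Cons)
qed simp

lemma ev_conj_word: "c \<in> carrier G \<Longrightarrow> w \<in> words \<Longrightarrow> ev (conj_word c w) = c \<otimes> ev w \<otimes> inv c"
proof (induction w)
  case (Cons p w)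
  then show ?case using N_closed by (cases p) (auto simp: words_Cons m_assoc)
qed simp

lemma fmul_Nil [simp]: "fmul [] w = w"
  and fmul_Cons [simp]: "fmul ((t, n) # u) w = fcons t n (fmul u w)"
  by (simp_all add: fmul_def)

lemma fmul_append: "fmul (u @ u') w = fmul u (fmul u' w)"
  by (simp add: fmul_def)

lemma fmul_words: "u \<in> words \<Longrightarrow> w \<in> words \<Longrightarrow> fmul u w \<in> words"
proof (induction u)
  case (Cons p u)
  then show ?case by (cases p) (auto simp: words_Cons fcons_words)
qed simp

lemma fcons_Cons: "(t, n) # w \<in> words \<Longrightarrow> fcons t n w = (t, n) # w"
  by (cases w) (auto simp: words_Cons fcons_def)

lemma fmul_eq_append: "u @ w \<in> words \<Longrightarrow> fmul u w = u @ w"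
proof (induction u)
  case (Cons p u)
  then show ?case using fcons_Cons by (cases p) (auto simp: words_Cons)
qed simp

end

section \<open>The group acting on the edges of its Bass--Serre tree\<close>

locale artin_amalgam = artin_group V R G
  for V :: "'v set" and R and G (structure) +
  fixes P :: "bool \<Rightarrow> 'v set"
  assumes P_cover: "P True \<union> P False = V"
    and P_separated: "u \<in> P True - P False \<Longrightarrow> w \<in> P False - P True \<Longrightarrow> (u, w) \<notin> R"
begin

definition S where "S = P True \<inter> P False"

abbreviation \<rho> where "\<rho> \<equiv> retract S"

text \<open>Every left coset of \<open>par S\<close> in \<open>par (P t)\<close> contains exactly
  one element of this kernel, and \<open>par S\<close> normalizes it.\<close>

definition N where "N t = {x \<in> par (P t). \<rho> x = \<one>}"

lemma P_sub: "P t \<subseteq> V"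
  using P_cover by (cases t) auto

lemma S_sub_P: "S \<subseteq> P t"
  by (cases t) (auto simp: S_def)

lemma S_sub: "S \<subseteq> V"
  using S_sub_P P_sub by blast

lemma par_S_sub: "par S \<subseteq> par (P t)"
  by (rule par_mono[OF S_sub_P])

lemma P_cases:
  assumes "v \<in> V" obtains "v \<in> S" | t where "v \<in> P t" "v \<notin> P (\<not> t)"
proof (cases "v \<in> P True \<and> v \<in> P False")
  case False
  then show thesis using assms P_cover that(2)[of True] that(2)[of False] by auto
qed (use that in \<open>auto simp: S_def\<close>)

lemma par_P_closed: "x \<in> par (P t) \<Longrightarrow> x \<in> carrier G"
  by (rule par_closed[OF P_sub])

lemma par_S_closed: "x \<in> par S \<Longrightarrow> x \<in> carrier G"
  by (rule par_closed[OF S_sub])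

lemma \<rho>_id: "x \<in> par S \<Longrightarrow> \<rho> x = x"
  by (rule retract_id[OF S_sub order_refl])

lemma \<rho>_in: "x \<in> carrier G \<Longrightarrow> \<rho> x \<in> par S"
  by (rule retract_in_par[OF S_sub])

lemma \<rho>_\<rho>: "x \<in> carrier G \<Longrightarrow> \<rho> (\<rho> x) = \<rho> x"
  by (intro \<rho>_id \<rho>_in)

lemma subgroup_par_P: "subgroup (par (P t)) G"
  by (rule par_subgroup[OF P_sub])

lemma subgroup_par_S: "subgroup (par S) G"
  by (rule par_subgroup[OF S_sub])

lemma subgroup_N: "subgroup (N t) G"
proof -
  interpret P: subgroup "par (P t)" G by (rule subgroup_par_P)
  show ?thesis
    unfolding N_def by (rule subgroupI) (auto intro!: exI[of _ \<one>])
qed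

sublocale free_factors G N
  by (intro free_factors.intro free_factors_axioms.intro is_group subgroup_N)

lemma N_conj:
  assumes "c \<in> par S" "n \<in> N t" shows "c \<otimes> n \<otimes> inv c \<in> N t"
proof -
  interpret P: subgroup "par (P t)" G by (rule subgroup_par_P)
  have c: "c \<in> par (P t)" "c \<in> carrier G" using assms par_S_sub par_S_closed by auto
  have n: "n \<in> par (P t)" "\<rho> n = \<one>" using assms by (auto simp: N_def)
  then have "\<rho> (c \<otimes> n \<otimes> inv c) = \<one>" using c by simp
  then show ?thesis using c n by (simp add: N_def)
qed

lemma conj_words: "c \<in> par S \<Longrightarrow> w \<in> words \<Longrightarrow> conj_word c w \<in> words"
  by (rule conj_word_words) (auto intro: N_conj par_S_closed)

text \<open>Split \<open>a\<close> as \<open>n\<close> times \<open>c\<close> with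
  \<open>c = \<rho> a\<close>. The part \<open>c\<close> conjugates, because the coset of
  \<open>c w\<close> modulo \<open>par S\<close> is also that of \<open>c w inv c\<close>; the part
  \<open>n\<close> then multiplies from the left.\<close>

definition sact :: "bool \<Rightarrow> ('v \<times> bool) list set \<Rightarrow> _ \<Rightarrow> _" where
  "sact t a w = fcons t (a \<otimes> inv (\<rho> a)) (conj_word (\<rho> a) w)"

lemma N_part: "a \<in> par (P t) \<Longrightarrow> a \<otimes> inv (\<rho> a) \<in> N t"
proof -
  assume a: "a \<in> par (P t)"
  interpret P: subgroup "par (P t)" G by (rule subgroup_par_P)
  have c: "a \<in> carrier G" using a by simp
  have "\<rho> a \<in> par (P t)" using \<rho>_in[OF c] par_S_sub by auto
  then show "a \<otimes> inv (\<rho> a) \<in> N t" using a c by (simp add: N_def \<rho>_\<rho>)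
qed

lemma sact_words: "a \<in> par (P t) \<Longrightarrow> w \<in> words \<Longrightarrow> sact t a w \<in> words"
  unfolding sact_def by (intro fcons_words N_part conj_words \<rho>_in par_P_closed)

lemma sact_sact:
  assumes "a \<in> par (P t)" "b \<in> par (P t)" "w \<in> words"
  shows "sact t a (sact t b w) = sact t (a \<otimes> b) w"
proof -
  have c: "a \<in> carrier G" "b \<in> carrier G" using assms par_P_closed by auto
  have r: "\<rho> a \<in> carrier G" "\<rho> b \<in> carrier G" using c by auto
  note w = conj_words[OF \<rho>_in[OF c(2)] assms(3)]
  have "sact t a (sact t b w) = fcons t (a \<otimes> inv (\<rho> a))
      (fcons t (\<rho> a \<otimes> (b \<otimes> inv (\<rho> b)) \<otimes> inv (\<rho> a)) (conj_word (\<rho> a) (conj_word (\<rho> b) w)))"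
    unfolding sact_def using conj_word_fcons[OF r(1) N_part[OF assms(2)] w] by simp
  also have "\<dots> = fcons t (a \<otimes> inv (\<rho> a) \<otimes> (\<rho> a \<otimes> (b \<otimes> inv (\<rho> b)) \<otimes> inv (\<rho> a)))
      (conj_word (\<rho> a) (conj_word (\<rho> b) w))"
    by (intro fcons_mult N_part N_conj \<rho>_in conj_words assms c w)
  also have "\<dots> = sact t (a \<otimes> b) w"
    using c r assms(3) by (simp add: sact_def conj_word_conj_word m_assoc inv_mult_group)
  finally show ?thesis .
qed

lemma sact_one: "w \<in> words \<Longrightarrow> sact t \<one> w = w"
  by (simp add: sact_def conj_word_one)

lemma sact_par_S: "a \<in> par S \<Longrightarrow> sact t a w = conj_word a w"
  using par_S_closed by (simp add: sact_def \<rho>_id)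

lemma sact_Bij: "a \<in> par (P t) \<Longrightarrow> restrict (sact t a) words \<in> Bij words"
proof -
  assume a: "a \<in> par (P t)"
  then have i: "inv a \<in> par (P t)" "a \<in> carrier G"
    using subgroup.m_inv_closed[OF subgroup_par_P] par_P_closed by auto
  have "bij_betw (sact t a) words words"
    by (rule bij_betw_byWitness[where f' = "sact t (inv a)"])
      (use a i in \<open>auto simp: sact_words sact_sact sact_one\<close>)
  then show ?thesis by (auto simp: Bij_def)
qed

definition act :: "('v \<times> bool) list set \<Rightarrow> _ \<Rightarrow> _" where
  "act = (SOME \<Phi>. \<Phi> \<in> hom G (BijGroup words) \<and>
     (\<forall>t. \<forall>v\<in>P t. \<Phi> (gen v) = restrict (sact t (gen v)) words))"

text \<open>A generator in \<open>S\<close> belongs to both sides, but there both prescriptions are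
  conjugation. Adjacent vertices never lie strictly on opposite sides, so each relation holds inside
  one vertex group, where \<open>sact\<close> is already an action.\<close>

lemma act_props: "act \<in> hom G (BijGroup words) \<and>
     (\<forall>t. \<forall>v\<in>P t. act (gen v) = restrict (sact t (gen v)) words)"
proof -
  define f where "f v = restrict (sact (v \<in> P True) (gen v)) words" for v
  have side: "v \<in> P (v \<in> P True)" if "v \<in> V" for v
    using that P_cover by (cases "v \<in> P True") auto
  have f_eq: "f v = restrict (sact t (gen v)) words" if "v \<in> P t" for v t
  proof (cases "(v \<in> P True) = t")
    case False
    then have "v \<in> S" using that by (cases t) (auto simp: S_def)
    then show ?thesis by (auto simp: f_def sact_par_S[OF gen_in_par])
  qed (simp add: f_def)
  have f_Bij: "f v \<in> Bij words" if "v \<in> V" for v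
    unfolding f_def by (intro sact_Bij gen_in_par side that)
  obtain \<Phi> where \<Phi>: "\<Phi> \<in> hom G (BijGroup words)" "\<And>v. v \<in> V \<Longrightarrow> \<Phi> (gen v) = f v"
  proof (rule universal_property[OF group_BijGroup, of f])
    show "f v \<in> carrier (BijGroup words)" if "v \<in> V" for v
      using f_Bij[OF that] by (simp add: BijGroup_def)
    show "f u \<otimes>\<^bsub>BijGroup words\<^esub> f v = f v \<otimes>\<^bsub>BijGroup words\<^esub> f u" if uv: "(u, v) \<in> R" for u v
    proof -
      have V: "u \<in> V" "v \<in> V" using R_in_V[OF uv] by auto
      obtain t where t: "u \<in> P t" "v \<in> P t"
      proof (rule P_cases[OF V(1)])
        assume "u \<in> S" then show thesis using that side[OF V(2)] S_sub_P by blast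
      next
        fix t assume u: "u \<in> P t" "u \<notin> P (\<not> t)"
        show thesis
        proof (rule P_cases[OF V(2)])
          assume "v \<in> S" then show thesis using that u S_sub_P by blast
        next
          fix t' assume v: "v \<in> P t'" "v \<notin> P (\<not> t')"
          have "t = t'"
            using u v uv R_sym[OF uv] P_separated[of u v] P_separated[of v u]
            by (cases t; cases t') auto
          then show thesis using that u v by simp
        qed
      qed
      have "f u \<otimes>\<^bsub>BijGroup words\<^esub> f v = restrict (sact t (gen u \<otimes> gen v)) words" if
        "u \<in> P t" "v \<in> P t" "u \<in> V" "v \<in> V" for u v
        using f_Bij[OF that(3)] f_Bij[OF that(4)] that
        by (auto simp: BijGroup_def f_eq compose_def restrict_def fun_eq_iff sact_sact gen_in_par
            sact_words)
      then show ?thesis using t V gen_comm[OF uv] by simp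
    qed
  qed blast
  have "\<Phi> (gen v) = restrict (sact t (gen v)) words" if "v \<in> P t" for v t
    using \<Phi>(2)[of v] f_eq[OF that] P_sub[of t] that by auto
  then have "\<exists>\<Phi>. \<Phi> \<in> hom G (BijGroup words) \<and>
     (\<forall>t. \<forall>v\<in>P t. \<Phi> (gen v) = restrict (sact t (gen v)) words)"
    using \<Phi>(1) by (intro exI[of _ \<Phi>]) simp
  from someI_ex[OF this] show ?thesis unfolding act_def .
qed

lemma act_Bij: "g \<in> carrier G \<Longrightarrow> act g \<in> Bij words"
  using act_props hom_in_carrier[of act G "BijGroup words" g] by (simp add: BijGroup_def)

lemma act_words [simp]: "g \<in> carrier G \<Longrightarrow> w \<in> words \<Longrightarrow> act g w \<in> words"
  using act_Bij Bij_imp_funcset by blast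

lemma act_mult:
  "g \<in> carrier G \<Longrightarrow> h \<in> carrier G \<Longrightarrow> w \<in> words \<Longrightarrow> act (g \<otimes> h) w = act g (act h w)"
  using act_props hom_mult[of act G "BijGroup words" g h] act_Bij[of g] act_Bij[of h]
  by (simp add: BijGroup_def compose_def)

lemma act_one [simp]: "w \<in> words \<Longrightarrow> act \<one> w = w"
proof -
  assume "w \<in> words"
  moreover have "act \<one> = \<one>\<^bsub>BijGroup words\<^esub>"
    using act_props is_group group_BijGroup by (intro hom_one) auto
  ultimately show ?thesis by (simp add: BijGroup_def)
qed

lemma act_inv_act [simp]:
  "g \<in> carrier G \<Longrightarrow> w \<in> words \<Longrightarrow> act (inv g) (act g w) = w"
  "g \<in> carrier G \<Longrightarrow> w \<in> words \<Longrightarrow> act g (act (inv g) w) = w"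
  by (simp_all flip: act_mult)

lemma act_par:
  assumes "a \<in> par (P t)" "w \<in> words"
  shows "act a w = sact t a w"
proof -
  let ?H = "{a \<in> par (P t). \<forall>w\<in>words. act a w = sact t a w}"
  interpret P: subgroup "par (P t)" G by (rule subgroup_par_P)
  have "subgroup ?H G"
  proof (rule subgroupI)
    show "?H \<noteq> {}" using sact_one by (auto intro!: exI[of _ \<one>])
    fix a assume a: "a \<in> ?H"
    have "act (inv a) w = sact t (inv a) w" if w: "w \<in> words" for w
    proof -
      have "sact t (inv a) w \<in> words" using a w by (intro sact_words) auto
      then have "act (inv a) (act a (sact t (inv a) w)) = sact t (inv a) w" using a by (intro act_inv_act) auto
      moreover have "act a (sact t (inv a) w) = w"
        using a w sact_words[of "inv a" t w] by (simp add: sact_sact sact_one)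
      ultimately show ?thesis by simp
    qed
    then show "inv a \<in> ?H" using a by auto
  next
    fix a b assume "a \<in> ?H" "b \<in> ?H"
    then show "a \<otimes> b \<in> ?H" by (auto simp: act_mult sact_sact sact_words)
  qed auto
  moreover have "gen ` P t \<subseteq> ?H" using act_props by (auto simp: gen_in_par)
  ultimately have "par (P t) \<subseteq> ?H" by (rule par_least)
  then show ?thesis using assms by auto
qed

lemma act_N: "n \<in> N t \<Longrightarrow> w \<in> words \<Longrightarrow> act n w = fcons t n w"
  using act_par[of n t w] N_closed[of n t] by (simp add: N_def sact_def conj_word_one)

lemma act_par_S: "c \<in> par S \<Longrightarrow> w \<in> words \<Longrightarrow> act c w = conj_word c w"
  using act_par[of c True w] par_S_sub sact_par_S by auto

lemma act_ev: "u \<in> words \<Longrightarrow> w \<in> words \<Longrightarrow> act (ev u) w = fmul u w"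
proof (induction u)
  case (Cons p u)
  then show ?case
    by (cases p) (auto simp: words_Cons act_mult N_closed act_N fmul_words)
qed simp

text \<open>Words name cosets of \<open>par S\<close> by representatives in the kernel of
  \<open>\<rho>\<close>; the factor \<open>inv (\<rho> g)\<close> returns the product to that kernel
  without leaving the coset.\<close>

lemma ev_act:
  assumes "g \<in> carrier G" "w \<in> words"
  shows "ev (act g w) = g \<otimes> ev w \<otimes> inv (\<rho> g)"
proof -
  let ?H = "{g \<in> carrier G. \<forall>w\<in>words. ev (act g w) = g \<otimes> ev w \<otimes> inv (\<rho> g)}"
  have "subgroup ?H G"
  proof (rule subgroupI)
    show "?H \<noteq> {}" by (auto intro!: exI[of _ \<one>])
    fix g assume g: "g \<in> ?H"
    have "ev (act (inv g) w) = inv g \<otimes> ev w \<otimes> inv (\<rho> (inv g))" if w: "w \<in> words" for w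
    proof -
      have "ev w = ev (act g (act (inv g) w))" using g w by simp
      also have "\<dots> = g \<otimes> ev (act (inv g) w) \<otimes> inv (\<rho> g)"
        using g w act_words[of "inv g" w] by blast
      finally show ?thesis using g w by (simp add: m_assoc)
    qed
    then show "inv g \<in> ?H" using g by auto
  next
    fix g h assume "g \<in> ?H" "h \<in> ?H"
    then show "g \<otimes> h \<in> ?H" by (auto simp: act_mult m_assoc inv_mult_group)
  qed auto
  moreover have "gen ` V \<subseteq> ?H"
  proof -
    have "gen v \<in> ?H" if v: "v \<in> V" for v
    proof -
      obtain t where t: "v \<in> P t" using v P_cover by auto
      have a: "gen v \<in> par (P t)" "gen v \<in> carrier G" using t v gen_in_par by auto
      have "ev (act (gen v) w) = gen v \<otimes> ev w \<otimes> inv (\<rho> (gen v))" if w: "w \<in> words" for w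
      proof -
        have "ev (act (gen v) w) = gen v \<otimes> inv (\<rho> (gen v)) \<otimes> ev (conj_word (\<rho> (gen v)) w)"
          unfolding act_par[OF a(1) w] sact_def
          by (intro ev_fcons N_part a conj_words \<rho>_in w)
        also have "\<dots> = gen v \<otimes> ev w \<otimes> inv (\<rho> (gen v))"
          using a w by (simp add: ev_conj_word m_assoc)
        finally show ?thesis .
      qed
      then show ?thesis using a by auto
    qed
    then show ?thesis by auto
  qed
  ultimately have "par V \<subseteq> ?H" by (rule par_least)
  then show ?thesis using assms by (auto simp: par_V)
qed

text \<open>\<open>lst g\<close> is the normal form of the coset of \<open>g\<close> modulo the amalgamated subgroup.\<close>

definition lst where "lst g = act g []"

lemma lst_words [simp]: "g \<in> carrier G \<Longrightarrow> lst g \<in> words"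
  by (simp add: lst_def)

lemma ev_lst: "g \<in> carrier G \<Longrightarrow> g = ev (lst g) \<otimes> \<rho> g"
  by (simp add: lst_def ev_act m_assoc)

lemma act_eq:
  assumes "g \<in> carrier G" "w \<in> words"
  shows "act g w = fmul (lst g) (conj_word (\<rho> g) w)"
proof -
  have "act g w = act (ev (lst g) \<otimes> \<rho> g) w" using ev_lst[OF assms(1)] by simp
  also have "\<dots> = act (ev (lst g)) (act (\<rho> g) w)" using assms by (intro act_mult) auto
  also have "\<dots> = fmul (lst g) (conj_word (\<rho> g) w)"
    using assms \<rho>_in by (simp add: act_par_S act_ev conj_words)
  finally show ?thesis .
qed

lemma lst_Nil_iff: "g \<in> carrier G \<Longrightarrow> lst g = [] \<longleftrightarrow> g \<in> par S"
proof
  assume g: "g \<in> carrier G" "lst g = []"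
  then have "g = \<rho> g" using ev_lst[OF g(1)] by simp
  then show "g \<in> par S" using \<rho>_in[OF g(1)] by simp
qed (simp add: lst_def act_par_S)

lemma lst_eq_iff:
  assumes "g \<in> carrier G" "h \<in> carrier G"
  shows "lst g = lst h \<longleftrightarrow> inv g \<otimes> h \<in> par S"
proof -
  have "inv g \<otimes> h \<in> par S \<longleftrightarrow> lst (inv g \<otimes> h) = []" using assms lst_Nil_iff by simp
  also have "\<dots> \<longleftrightarrow> act (inv g) (lst h) = []" using assms by (simp add: lst_def act_mult)
  also have "\<dots> \<longleftrightarrow> lst g = lst h"
  proof
    assume "act (inv g) (lst h) = []"
    then have "act g (act (inv g) (lst h)) = lst g" by (simp add: lst_def)
    then show "lst g = lst h" using assms by simp
  next
    assume "lst g = lst h"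
    then have "act (inv g) (lst h) = act (inv g) (act g [])" by (simp add: lst_def)
    then show "act (inv g) (lst h) = []" using assms by simp
  qed
  finally show ?thesis by simp
qed

text \<open>Nothing cancels when the junction alternates, and conjugation by \<open>\<rho> g\<close>
  keeps the sides of the syllables.\<close>

lemma act_append:
  assumes "g \<in> carrier G" "w \<in> words" "lst g = [] \<or> w = [] \<or> fst (last (lst g)) \<noteq> fst (hd w)"
  shows "act g w = lst g @ conj_word (\<rho> g) w"
  unfolding act_eq[OF assms(1,2)]
  by (rule fmul_eq_append) (use assms \<rho>_in conj_words conj_word_hd_last in \<open>auto simp: words_append\<close>)

lemma lst_mult:
  assumes "g \<in> carrier G" "h \<in> carrier G"
  shows "lst (g \<otimes> h) = act g (lst h)"
  using assms by (simp add: lst_def act_mult)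

end

section \<open>Hyperbolic elements and common fixed points\<close>

context group
begin

lemma commute_int_pow_int_pow:
  assumes "x \<in> carrier G" "y \<in> carrier G" "x \<otimes> y = y \<otimes> x"
  shows "x [^] (j::int) \<otimes> y [^] (k::int) = y [^] k \<otimes> x [^] j"
  using commute_int_pow[OF _ assms(1), of "y [^] k"] commute_int_pow[OF assms] assms by simp

lemma inv_conj_conj:
  "\<lbrakk>g \<in> carrier G; h \<in> carrier G; x \<in> carrier G\<rbrakk> \<Longrightarrow>
    inv g \<otimes> (inv h \<otimes> x \<otimes> h) \<otimes> g = inv (h \<otimes> g) \<otimes> x \<otimes> (h \<otimes> g)"
  by (simp add: m_assoc inv_mult_group)

lemma inv_conj_mult:
  "\<lbrakk>g \<in> carrier G; x \<in> carrier G; y \<in> carrier G\<rbrakk> \<Longrightarrow>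
    (inv g \<otimes> x \<otimes> g) \<otimes> (inv g \<otimes> y \<otimes> g) = inv g \<otimes> (x \<otimes> y) \<otimes> g"
  by (simp add: m_assoc)

end

section \<open>Half-trees, ping-pong and axes\<close>

context artin_amalgam
begin

text \<open>The half-tree of edges on side \<open>t\<close> of the base edge \<open>[]\<close>, the
  base edge itself excluded.\<close>

definition headed where "headed t w \<longleftrightarrow> w \<noteq> [] \<and> fst (hd w) = t"

text \<open>\<open>f\<close> tells on which side of the base edge its translate by \<open>g\<close>
  lies, and \<open>l\<close> does the same for \<open>inv g\<close>. If \<open>f \<noteq> l\<close>,
  the base edge is moved coherently: \<open>g\<close> is hyperbolic with axis through it. If both
  are \<open>t\<close>, the fixed points or the axis of \<open>g\<close> lie on side
  \<open>t\<close>.\<close>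

definition ends where
  "ends g f l \<longleftrightarrow> g \<in> carrier G \<and> lst g \<noteq> [] \<and> fst (hd (lst g)) = f \<and> fst (last (lst g)) = l"

lemma ends_closed: "ends g f l \<Longrightarrow> g \<in> carrier G"
  by (simp add: ends_def)

lemma par_S_or_ends: "g \<in> carrier G \<Longrightarrow> g \<in> par S \<or> (\<exists>f l. ends g f l)"
  using lst_Nil_iff by (auto simp: ends_def)

lemma ends_unique: "ends g f l \<Longrightarrow> ends g f' l' \<Longrightarrow> f = f' \<and> l = l'"
  by (auto simp: ends_def)

text \<open>Ping-pong: everything outside the half-tree \<open>l\<close> is sent into the half-tree
  \<open>f\<close>, since no syllable cancels.\<close>

lemma act_ends:
  assumes "ends g f l" "w \<in> words" "\<not> headed l w"
  shows "act g w = lst g @ conj_word (\<rho> g) w" "headed f (act g w)"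
proof -
  show "act g w = lst g @ conj_word (\<rho> g) w"
    by (rule act_append) (use assms in \<open>auto simp: ends_def headed_def\<close>)
  then show "headed f (act g w)" using assms by (auto simp: ends_def headed_def)
qed

text \<open>If \<open>lst (inv g)\<close> did not start on side \<open>l\<close>, acting by
  \<open>g\<close> would only append to \<open>lst g\<close> and could not return to the base
  edge.\<close>

lemma ends_inv: 
  assumes "ends g f l" shows "ends (inv g) l f"
proof -
  have *: "headed l (lst (inv g))" if "ends g f l" for g f l
  proof (rule ccontr)
    assume n: "\<not> headed l (lst (inv g))"
    have g: "g \<in> carrier G" "lst g \<noteq> []" using that by (auto simp: ends_def)
    have "act g (lst (inv g)) = []" using g by (simp add: lst_def)
    then show False using act_ends(1)[OF that _ n] g by simp
  qed
  have g: "g \<in> carrier G" using assms by (rule ends_closed)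
  obtain l' where l': "ends (inv g) l l'"
    using *[OF assms] g by (auto simp: ends_def headed_def)
  have "headed l' (lst g)" using *[OF l'] g by simp
  then have "l' = f" using assms by (simp add: headed_def ends_def)
  then show ?thesis using l' by simp
qed

lemma ends_mult:
  assumes "ends g f l" "ends h f' l'" "l \<noteq> f'"
  shows "ends (g \<otimes> h) f l'"
proof -
  have c: "g \<in> carrier G" "h \<in> carrier G" using assms ends_closed by auto
  have "\<not> headed l (lst h)" using assms by (auto simp: headed_def ends_def)
  then have "lst (g \<otimes> h) = lst g @ conj_word (\<rho> g) (lst h)"
    using act_ends(1)[OF assms(1)] c by (simp add: lst_mult)
  then show ?thesis using assms c by (auto simp: ends_def conj_word_hd_last)
qed

lemma ends_par_S_mult:
  assumes "c \<in> par S" "ends g f l" shows "ends (c \<otimes> g) f l" "ends (g \<otimes> c) f l"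
proof -
  have g: "g \<in> carrier G" "c \<in> carrier G" using assms ends_closed par_S_closed by auto
  have "lst (c \<otimes> g) = conj_word c (lst g)"
    using g assms by (simp add: lst_mult act_par_S)
  then show "ends (c \<otimes> g) f l" using assms g by (auto simp: ends_def conj_word_hd_last)
  have "lst c = []" using assms g lst_Nil_iff by simp
  then have "lst (g \<otimes> c) = lst g" using g by (simp add: lst_mult, simp add: lst_def)
  then show "ends (g \<otimes> c) f l" using assms g by (auto simp: ends_def)
qed

text \<open>The two products start on opposite sides. From this come \<open>commuting_powers\<close>
  and the separation of vertices that lie on different sides of an edge.\<close>

lemma ends_opposite_not_commute:
  assumes "ends g t t" "ends h (\<not> t) (\<not> t)" shows "g \<otimes> h \<noteq> h \<otimes> g"
proof
  assume "g \<otimes> h = h \<otimes> g"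
  moreover have "ends (g \<otimes> h) t (\<not> t)" "ends (h \<otimes> g) (\<not> t) t"
    using ends_mult[OF assms] ends_mult[OF assms(2,1)] by auto
  ultimately show False using ends_unique by metis
qed

lemma lst_N: "n \<in> N t \<Longrightarrow> n \<noteq> \<one> \<Longrightarrow> lst n = [(t, n)]"
  by (simp add: lst_def act_N fcons_def)

lemma ends_N: "n \<in> N t \<Longrightarrow> n \<noteq> \<one> \<Longrightarrow> ends n t t"
  using lst_N by (simp add: ends_def N_closed)

lemma gen_pow_N:
  assumes "v \<in> P t" "v \<notin> P (\<not> t)" shows "gen v [^] (k::int) \<in> N t"
proof -
  have "v \<notin> S" using assms S_sub_P by blast
  then have "gen v \<in> N t"
    using assms P_sub[of t] by (auto simp: N_def gen_in_par retract_gen)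
  then show ?thesis by (rule subgroup_int_pow_closed[OF subgroup_N])
qed

lemma ends_gen_pow:
  assumes "v \<in> P t" "v \<notin> P (\<not> t)" "k \<noteq> 0" shows "ends (gen v [^] (k::int)) t t"
proof (rule ends_N[OF gen_pow_N[OF assms(1,2)]])
  have "v \<in> V" using assms P_sub[of t] by auto
  then have "expo v (gen v [^] k) = k" by (simp add: expo_gen)
  then show "gen v [^] k \<noteq> \<one>" using assms(3) by auto
qed

text \<open>Such a \<open>g\<close> moves the base edge forward in direction \<open>t\<close> or
  fixes it; this replaces the order along an axis.\<close>

definition pos where "pos t g \<longleftrightarrow> g \<in> par S \<or> ends g t (\<not> t)"

lemma pos_closed: "pos t g \<Longrightarrow> g \<in> carrier G"
  using ends_closed par_S_closed by (auto simp: pos_def)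

lemma pos_mult: "pos t g \<Longrightarrow> pos t h \<Longrightarrow> pos t (g \<otimes> h)"
  using ends_mult[of g t "\<not> t" h t "\<not> t"] ends_par_S_mult subgroup.m_closed[OF subgroup_par_S]
  by (auto simp: pos_def)

lemma pos_headed:
  assumes "pos t g" "w \<in> words" "headed t w" shows "headed t (act g w)"
proof (cases "g \<in> par S")
  case True
  then show ?thesis using assms by (auto simp: act_par_S headed_def conj_word_hd_last)
next
  case False
  then have "ends g t (\<not> t)" using assms by (simp add: pos_def)
  then show ?thesis by (rule act_ends) (use assms in \<open>auto simp: headed_def\<close>)
qed

lemma act_pow_Suc:
  "h \<in> carrier G \<Longrightarrow> w \<in> words \<Longrightarrow> act (h [^] Suc i) w = act h (act (h [^] i) w)"
  by (subst nat_pow_Suc2) (auto simp: act_mult)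

lemma pow_stays_unheaded:
  assumes "ends h t (\<not> t)" "w \<in> words" "\<not> headed t w"
  shows "\<not> headed t (act (inv h [^] (i::nat)) w)"
proof (induction i)
  case 0
  then show ?case using assms by simp
next
  case (Suc i)
  have h: "inv h \<in> carrier G" using assms ends_closed by auto
  have "headed (\<not> t) (act (inv h) (act (inv h [^] i) w))"
    by (rule act_ends(2)[OF ends_inv[OF assms(1)]]) (use Suc h assms in auto)
  moreover have "act (inv h [^] Suc i) w = act (inv h) (act (inv h [^] i) w)"
    using h assms by (intro act_pow_Suc)
  ultimately show ?case by (auto simp: headed_def)
qed

text \<open>As long as the edge stays in the half-tree \<open>t\<close>, each application of
  \<open>inv h\<close> strips all of \<open>lst h\<close> from the front of its word. Once the edge
  is outside, ping-pong with \<open>inv h\<close> keeps it outside.\<close>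

lemma eventually_unheaded:
  assumes "ends h t (\<not> t)" "w \<in> words"
  shows "\<exists>i0. \<forall>i\<ge>i0. \<not> headed t (act (inv h [^] (i::nat)) w)"
proof -
  have h: "h \<in> carrier G" using assms ends_closed by auto
  have "\<exists>i::nat. \<not> headed t (act (inv h [^] i) w)"
    using assms(2)
  proof (induction "length w" arbitrary: w rule: less_induct)
    case less
    let ?w = "act (inv h) w"
    have w: "?w \<in> words" using h less.prems by simp
    show ?case
    proof (cases "headed t ?w")
      case True
      then have "act h ?w = lst h @ conj_word (\<rho> h) ?w"
        by (intro act_ends(1)[OF assms(1) w]) (auto simp: headed_def)
      then have "w = lst h @ conj_word (\<rho> h) ?w" using h less.prems by simp
      then have "length w = length (lst h) + length ?w" by (metis length_append length_conj_word)
      then have "length ?w < length w" using assms(1) by (simp add: ends_def)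
      then obtain i :: nat where "\<not> headed t (act (inv h [^] i) ?w)" using less.hyps w by blast
      then have "\<not> headed t (act (inv h [^] Suc i) w)" using h less.prems by (simp add: act_mult)
      then show ?thesis by blast
    next
      case False
      then have "\<not> headed t (act (inv h [^] (1::nat)) w)" using h by simp
      then show ?thesis by blast
    qed
  qed
  then obtain i0 :: nat where i0: "\<not> headed t (act (inv h [^] i0) w)" by blast
  have "\<not> headed t (act (inv h [^] i) w)" if "i \<ge> i0" for i
  proof -
    have "inv h [^] i = inv h [^] (i - i0) \<otimes> inv h [^] i0"
      using that h by (simp add: nat_pow_mult)
    then have "act (inv h [^] i) w = act (inv h [^] (i - i0)) (act (inv h [^] i0) w)"
      using h assms(2) by (simp add: act_mult)
    then show ?thesis using pow_stays_unheaded[OF assms(1) _ i0, of "i - i0"] h assms(2) by simp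
  qed
  then show ?thesis by blast
qed

lemma eventually_headed:
  assumes "ends h t (\<not> t)" "w \<in> words"
  shows "\<exists>i0. \<forall>i\<ge>i0. headed t (act (h [^] (i::nat)) w)"
proof -
  have h: "h \<in> carrier G" using assms ends_closed by auto
  have "ends (inv h) (\<not> t) (\<not> \<not> t)" using ends_inv[OF assms(1)] by simp
  from eventually_unheaded[OF this assms(2)] obtain i0 where
    i0: "\<And>i. i \<ge> i0 \<Longrightarrow> \<not> headed (\<not> t) (act (h [^] (i::nat)) w)" using h by auto
  have "headed t (act (h [^] i) w)" if i: "i \<ge> Suc i0" for i
  proof -
    obtain j where j: "i = Suc j" "j \<ge> i0" using i by (cases i) auto
    have "headed t (act h (act (h [^] j) w))"
      by (rule act_ends(2)[OF assms(1)]) (use i0[OF j(2)] h assms in auto)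
    then show ?thesis unfolding j(1) act_pow_Suc[OF h assms(2)] .
  qed
  then show ?thesis by blast
qed

text \<open>Test the conjugate on the edge \<open>act (inv h [^] i) []\<close>. For large
  \<open>i\<close> both this edge and its image, which is \<open>inv h [^] i\<close> applied to
  \<open>act x []\<close>, have left the half-tree \<open>t\<close>; an element with both ends
  \<open>t\<close> would have to send the former into it.\<close>

lemma eventually_conj_not_ends:
  assumes "ends h t (\<not> t)" "x \<in> carrier G"
  shows "\<exists>i0. \<forall>i\<ge>i0. \<not> ends (inv h [^] (i::nat) \<otimes> x \<otimes> h [^] i) t t"
proof -
  have h: "h \<in> carrier G" using assms ends_closed by auto
  obtain i0 where i0: "\<And>i. i \<ge> i0 \<Longrightarrow> \<not> headed t (act (inv h [^] (i::nat)) [])"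
    using eventually_unheaded[OF assms(1) words_Nil] by blast
  obtain i1 where i1: "\<And>i. i \<ge> i1 \<Longrightarrow> \<not> headed t (act (inv h [^] (i::nat)) (act x []))"
    using eventually_unheaded[OF assms(1) act_words[OF assms(2) words_Nil]] by blast
  have "\<not> ends (inv h [^] i \<otimes> x \<otimes> h [^] i) t t" if "i \<ge> max i0 i1" for i
  proof
    assume e: "ends (inv h [^] i \<otimes> x \<otimes> h [^] i) t t"
    have "headed t (act (inv h [^] i \<otimes> x \<otimes> h [^] i) (act (inv h [^] i) []))"
      by (rule act_ends(2)[OF e]) (use i0 that h in auto)
    moreover have "act (inv h [^] i \<otimes> x \<otimes> h [^] i) (act (inv h [^] i) []) = act (inv h [^] i) (act x [])"
      using h assms by (simp add: act_mult nat_pow_inv)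
    ultimately show False using i1[of i] that by simp
  qed
  then show ?thesis by blast
qed

text \<open>Conjugation by powers of \<open>h\<close> leaves \<open>k\<close> unchanged, so
  \<open>eventually_conj_not_ends\<close> applies to \<open>k\<close> itself, once along
  \<open>h\<close> and once along \<open>inv h\<close>.\<close>

lemma commuting_not_elliptic:
  assumes "ends h t (\<not> t)" "k \<in> carrier G" "h \<otimes> k = k \<otimes> h"
  shows "k \<in> par S \<or> ends k t (\<not> t) \<or> ends k (\<not> t) t"
proof -
  have h: "h \<in> carrier G" using assms ends_closed by auto
  have conj: "inv h [^] (i::nat) \<otimes> k \<otimes> h [^] i = k" "h [^] i \<otimes> k \<otimes> inv h [^] i = k" for i
  proof -
    have *: "k \<otimes> h [^] i = h [^] i \<otimes> k"
      using commute_int_pow[OF assms(2) h assms(3)[symmetric], of "int i"] by (simp add: int_pow_int)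
    have "inv h [^] i \<otimes> k \<otimes> h [^] i = inv (h [^] i) \<otimes> (k \<otimes> h [^] i)"
      using h assms(2) by (simp add: m_assoc nat_pow_inv)
    also have "\<dots> = k" unfolding * using h assms(2) by simp
    finally show "inv h [^] i \<otimes> k \<otimes> h [^] i = k" .
    have "h [^] i \<otimes> k \<otimes> inv h [^] i = k \<otimes> h [^] i \<otimes> inv (h [^] i)"
      unfolding * using h by (simp add: nat_pow_inv)
    also have "\<dots> = k" using h assms(2) by (simp add: m_assoc)
    finally show "h [^] i \<otimes> k \<otimes> inv h [^] i = k" .
  qed
  have "\<not> ends k t t" using eventually_conj_not_ends[OF assms(1,2)] conj by auto
  moreover have "ends (inv h) (\<not> t) (\<not> \<not> t)" using ends_inv[OF assms(1)] by simp
  then have "\<not> ends k (\<not> t) (\<not> t)"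
    using eventually_conj_not_ends[of "inv h" "\<not> t" k] assms(2) h conj by auto
  ultimately show ?thesis using par_S_or_ends[OF assms(2)] by (cases t) (auto, (metis (full_types))+)
qed

text \<open>\<open>z\<close> preserves the axis of \<open>x\<close>, so a power of \<open>x\<close>
  brings the translate of the base edge by \<open>z\<close> into the segment between the base edge
  and its image under \<open>x\<close>. The exponent is the one at which
  \<open>z \<otimes> x [^] b\<close> turns positive.\<close>

lemma pos_interval:
  assumes "ends x t (\<not> t)" "z \<in> carrier G" "x \<otimes> z = z \<otimes> x"
  obtains b :: int where "pos t (z \<otimes> x [^] b)" "pos t (inv (z \<otimes> x [^] b) \<otimes> x)"
proof -
  have x: "x \<in> carrier G" using assms ends_closed by auto
  have pos_x: "pos t x" using assms by (simp add: pos_def)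
  define f where "f b = z \<otimes> x [^] (b::int)" for b
  have f: "f b \<in> carrier G" for b using x assms by (simp add: f_def)
  have f_Suc: "f (b + 1) = f b \<otimes> x" for b
    using x assms(2) by (simp add: f_def int_pow_mult m_assoc)
  have f_comm: "x \<otimes> f b = f b \<otimes> x" for b
  proof -
    have "x \<otimes> x [^] b = x [^] b \<otimes> x" using x by (intro commute_int_pow) auto
    then have "z \<otimes> (x \<otimes> x [^] b) = z \<otimes> (x [^] b \<otimes> x)" by simp
    moreover have "x \<otimes> (z \<otimes> x [^] b) = (z \<otimes> x) \<otimes> x [^] b"
      unfolding assms(3)[symmetric] using x assms(2) by (simp add: m_assoc)
    ultimately show ?thesis using x assms(2) by (simp add: f_def m_assoc)
  qed
  have not_pos: "ends (inv (f b)) t (\<not> t)" if "\<not> pos t (f b)" for b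
  proof -
    have "ends (f b) (\<not> t) t"
      using commuting_not_elliptic[OF assms(1) f f_comm] that by (auto simp: pos_def)
    then show ?thesis by (rule ends_inv)
  qed
  have f_nat: "f (int i) = z \<otimes> x [^] i" for i by (simp add: f_def int_pow_int)
  have f_neg: "f (- int i) = z \<otimes> inv (x [^] i)" for i using x by (simp add: f_def int_pow_neg_int)
  \<comment> \<open>Otherwise all \<open>inv (f (int i))\<close> would keep \<open>lst x\<close> in
    the half-tree \<open>t\<close>, although the powers of \<open>inv x\<close> eventually push
    every edge out of it.\<close>
  have "\<exists>i::nat. pos t (f (int i))"
  proof (rule ccontr)
    assume "\<nexists>i::nat. pos t (f (int i))"
    then have e: "ends (inv (f (int i))) t (\<not> t)" for i using not_pos by blast
    have hx: "headed t (lst x)" "lst x \<in> words" using assms(1) x by (auto simp: headed_def ends_def)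
    have "headed t (act (inv x [^] i) (act (inv z) (lst x)))" for i :: nat
    proof -
      have "headed t (act (inv (f (int i))) (lst x))"
        by (rule act_ends(2)[OF e]) (use hx in \<open>auto simp: headed_def\<close>)
      then show ?thesis using x assms(2) by (simp add: f_nat inv_mult_group act_mult nat_pow_inv)
    qed
    then show False
      using eventually_unheaded[OF assms(1), of "act (inv z) (lst x)"] x assms(2) by auto
  qed
  then obtain b1 where b1: "pos t (f b1)" by blast
  have "\<exists>i::nat. \<not> pos t (f (- int i))"
  proof (rule ccontr)
    assume a: "\<nexists>i::nat. \<not> pos t (f (- int i))"
    obtain i :: nat where i: "headed t (act (x [^] i) (act (inv z) []))"
      using eventually_headed[OF assms(1), of "act (inv z) []"] assms(2) by auto
    have "headed t (act (f (- int i)) (act (x [^] i) (act (inv z) [])))"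
      by (rule pos_headed) (use a i x assms(2) in auto)
    moreover have "act (f (- int i)) (act (x [^] i) (act (inv z) [])) = []"
      using x assms(2) by (simp add: f_neg act_mult)
    ultimately show False by (simp add: headed_def)
  qed
  then obtain b0 where b0: "\<not> pos t (f b0)" by blast
  have up: "pos t (f (b + int i))" if "pos t (f b)" for b i
  proof (induction i)
    case (Suc i)
    then have "pos t (f (b + int i) \<otimes> x)" using pos_x by (rule pos_mult)
    then show ?case using f_Suc[of "b + int i"] by (simp add: algebra_simps)
  qed (use that in simp)
  have "b0 < b1"
  proof (rule ccontr)
    assume "\<not> b0 < b1"
    then have "b1 + int (nat (b0 - b1)) = b0" by simp
    then show False using up[OF b1, of "nat (b0 - b1)"] b0 by simp
  qed
  \<comment> \<open>At the sign change, \<open>inv (f (b + 1)) \<otimes> x\<close> equals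
    \<open>inv (f b)\<close>, which is positive because \<open>f b\<close> is not.\<close>
  have "\<exists>b. \<not> pos t (f b) \<and> pos t (f (b + 1))"
  proof (rule ccontr)
    assume c: "\<nexists>b. \<not> pos t (f b) \<and> pos t (f (b + 1))"
    have "\<not> pos t (f (b0 + int i))" for i
    proof (induction i)
      case (Suc i)
      then show ?case using c by (metis add.assoc add.commute of_nat_Suc)
    qed (use b0 in simp)
    from this[of "nat (b1 - b0)"] show False using b1 \<open>b0 < b1\<close> by simp
  qed
  then obtain b where b: "\<not> pos t (f b)" "pos t (f (b + 1))" by blast
  have "inv (f (b + 1)) \<otimes> x = inv x \<otimes> inv (f b) \<otimes> x" using f x by (simp add: f_Suc inv_mult_group)
  also have "inv (f b) \<otimes> x = x \<otimes> inv (f b)"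
  proof -
    have "inv (f b) \<otimes> x = inv (f b) \<otimes> (x \<otimes> f b) \<otimes> inv (f b)" using f x by (simp add: m_assoc)
    also have "\<dots> = x \<otimes> inv (f b)" unfolding f_comm using f x by simp
    finally show ?thesis .
  qed
  then have "inv x \<otimes> inv (f b) \<otimes> x = inv (f b)" using f x by (simp add: m_assoc)
  finally have "pos t (inv (f (b + 1)) \<otimes> x)" using not_pos[OF b(1)] by (simp add: pos_def)
  then show thesis using that b(2) by (simp add: f_def)
qed

text \<open>\<open>x\<close> is the product of \<open>g\<close> and \<open>inv g \<otimes> x\<close>
  without cancellation. Only finitely many edges thus fit between the base edge and its image under
  \<open>x\<close>.\<close>

lemma pos_prefix:
  assumes "pos t g" "pos t (inv g \<otimes> x)" "x \<in> carrier G"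
  shows "lst g = take (length (lst g)) (lst x)"
proof -
  have g: "g \<in> carrier G" using assms pos_closed by auto
  have "lst x = lst (g \<otimes> (inv g \<otimes> x))" using g assms by simp
  also have "\<dots> = act g (lst (inv g \<otimes> x))" using g assms by (intro lst_mult) auto
  finally have x: "lst x = act g (lst (inv g \<otimes> x))" .
  have "\<exists>s. act g (lst (inv g \<otimes> x)) = lst g @ s"
  proof -
    have "lst g = [] \<or> lst (inv g \<otimes> x) = [] \<or> fst (last (lst g)) \<noteq> fst (hd (lst (inv g \<otimes> x)))"
      using assms(1,2) g assms(3) lst_Nil_iff[of g] lst_Nil_iff[of "inv g \<otimes> x"]
      by (auto simp: pos_def ends_def)
    then show ?thesis using act_append[OF g, of "lst (inv g \<otimes> x)"] g assms(3) by auto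
  qed
  then show ?thesis using x by auto
qed

text \<open>The centralizer of a hyperbolic element preserves its axis; modulo translations only finitely
  many edges remain, so the pigeonhole principle applies to the powers of \<open>y\<close>.\<close>

lemma centralizer_axis:
  assumes "ends x t (\<not> t)" "y \<in> carrier G" "x \<otimes> y = y \<otimes> x"
  obtains j :: nat and b :: int where "j > 0" "y [^] int j \<otimes> x [^] b \<in> par S"
proof -
  have x: "x \<in> carrier G" using assms ends_closed by auto
  have "\<exists>b::int. pos t (y [^] int i \<otimes> x [^] b) \<and> pos t (inv (y [^] int i \<otimes> x [^] b) \<otimes> x)" for i
    by (rule pos_interval[OF assms(1), of "y [^] int i"])
      (use assms(2) commute_int_pow[OF x assms(2,3)] in auto)
  then obtain b :: "nat \<Rightarrow> int" where b: "\<And>i. pos t (y [^] int i \<otimes> x [^] b i)"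
    "\<And>i. pos t (inv (y [^] int i \<otimes> x [^] b i) \<otimes> x)" by metis
  define L where "L i = lst (y [^] int i \<otimes> x [^] b i)" for i
  have L: "L i = take (length (L i)) (lst x)" for i
    unfolding L_def by (rule pos_prefix[OF b x])
  have "L i \<in> (\<lambda>n. take n (lst x)) ` {..length (lst x)}" for i
  proof -
    have "length (L i) \<le> length (lst x)" using L[of i] by (metis length_take min.cobounded1)
    then show ?thesis using L[of i] by blast
  qed
  then have "finite (range L)" by (auto intro: finite_subset)
  then have "\<not> inj L" using finite_imageD by blast
  then obtain i j where ij: "L i = L j" "i < j" unfolding inj_on_def by (metis nat_neq_iff)
  let ?g = "\<lambda>i. y [^] int i \<otimes> x [^] b i"
  have "inv (?g i) \<otimes> ?g j \<in> par S"
    using ij(1) x assms(2) by (subst lst_eq_iff[symmetric]) (auto simp: L_def)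
  also have "inv (?g i) \<otimes> ?g j = x [^] (- b i) \<otimes> (y [^] (- int i) \<otimes> y [^] int j) \<otimes> x [^] b j"
    using x assms(2) by (simp add: inv_mult_group int_pow_neg m_assoc)
  also have "\<dots> = x [^] (- b i) \<otimes> y [^] (int j - int i) \<otimes> x [^] b j"
    using assms(2) by (simp flip: int_pow_mult)
  also have "\<dots> = y [^] (int j - int i) \<otimes> x [^] (- b i) \<otimes> x [^] b j"
    using commute_int_pow_int_pow[OF x assms(2,3)] by simp
  also have "\<dots> = y [^] int (j - i) \<otimes> x [^] (b j - b i)"
    using x assms(2) ij by (simp add: m_assoc of_nat_diff flip: int_pow_mult)
  finally show thesis using that[of "j - i"] ij by simp
qed

section \<open>Moving the base edge towards a common fixed vertex\<close>

lemma length_fcons_le: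
  "length (fcons t n w) \<le> Suc (length w)" "headed t w \<Longrightarrow> length (fcons t n w) \<le> length w"
  by (cases w; auto simp: fcons_def headed_def)+

text \<open>Conjugating by \<open>n\<close> turns the base edge around the vertex on side
  \<open>t\<close>. In \<open>inv n \<otimes> m \<otimes> n\<close> the right factor merges, up to
  conjugation by \<open>\<rho> m\<close>, into the last syllable of \<open>m\<close>, and
  \<open>inv n\<close> cancels the first syllable if that is \<open>n\<close>. The maximum with 1
  allows for \<open>m\<close> in \<open>par S\<close>, whose conjugate may acquire one
  syllable.\<close>

lemma length_lst_conj:
  assumes "n \<in> N t" "n \<noteq> \<one>" "m \<in> carrier G" "m \<in> par S \<or> ends m t t"
  shows "length (lst (inv n \<otimes> m \<otimes> n)) \<le> max 1 (length (lst m))"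
    and "length (lst m) > 1 \<Longrightarrow> hd (lst m) = (t, n) \<Longrightarrow>
      length (lst (inv n \<otimes> m \<otimes> n)) < length (lst m)"
proof -
  have n: "n \<in> carrier G" "inv n \<in> N t" using assms N_closed N_inv by auto
  let ?n = "\<rho> m \<otimes> n \<otimes> inv (\<rho> m)"
  have n': "?n \<in> N t" by (intro N_conj \<rho>_in assms)
  have w: "act m [(t, n)] \<in> words"
    using assms n by (intro act_words) (auto simp: words_Cons)
  have "lst (inv n \<otimes> m \<otimes> n) = act (inv n) (act m (lst n))"
    using n assms by (simp add: lst_mult act_mult)
  also have "\<dots> = fcons t (inv n) (act m [(t, n)])"
    using assms n w by (simp add: lst_N act_N)
  also have "act m [(t, n)] = fmul (lst m) [(t, ?n)]"
    using assms n by (subst act_eq) (auto simp: words_Cons)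
  finally have lst: "lst (inv n \<otimes> m \<otimes> n) = fcons t (inv n) (fmul (lst m) [(t, ?n)])" .
  have "length (lst (inv n \<otimes> m \<otimes> n)) \<le> max 1 (length (lst m)) \<and>
    (length (lst m) > 1 \<and> hd (lst m) = (t, n) \<longrightarrow> length (lst (inv n \<otimes> m \<otimes> n)) < length (lst m))"
  proof (cases "lst m" rule: rev_cases)
    case Nil
    have "length (fcons t (inv n) [(t, ?n)]) \<le> 1"
      using length_fcons_le(2)[of t "[(t, ?n)]"] by (simp add: headed_def)
    then show ?thesis using lst Nil by simp
  next
    case (snoc w p)
    then have "ends m t t" using assms(4) lst_Nil_iff[OF assms(3)] by simp
    then obtain k where p: "p = (t, k)" using snoc by (cases p) (auto simp: ends_def)
    have wds: "w @ [(t, k)] \<in> words" using snoc p assms(3) lst_words by metis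
    then have k: "k \<in> N t" by (simp add: words_append words_Cons)
    define r where "r = fcons t k [(t, ?n)]"
    have r_len: "length r \<le> 1" unfolding r_def
      using length_fcons_le(2)[of t "[(t, ?n)]"] by (simp add: headed_def)
    have r_tag: "r = [] \<or> fst (hd r) = t" by (auto simp: r_def fcons_def)
    have "[(t, ?n)] \<in> words"
      using n' assms n by (auto simp: words_Cons conj_eq_one_iff)
    then have "r \<in> words" unfolding r_def by (rule fcons_words[OF k])
    then have "w @ r \<in> words" using wds r_tag by (auto simp: words_append)
    then have "fmul (lst m) [(t, ?n)] = w @ r"
      by (simp add: snoc p fmul_append fmul_eq_append flip: r_def)
    then have l: "lst (inv n \<otimes> m \<otimes> n) = fcons t (inv n) (w @ r)" using lst by simp
    show ?thesis
    proof (cases w)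
      case Nil
      have "length (fcons t (inv n) r) \<le> 1"
        using length_fcons_le(1)[of t "inv n" "[]"] length_fcons_le(2)[of t r "inv n"] r_len r_tag
        by (cases r) (auto simp: headed_def)
      then show ?thesis using l snoc Nil by simp
    next
      case (Cons q w')
      then have "headed t (w @ r)" using \<open>ends m t t\<close> snoc by (auto simp: ends_def headed_def)
      then have "length (lst (inv n \<otimes> m \<otimes> n)) \<le> length (w @ r)"
        unfolding l by (rule length_fcons_le(2))
      moreover have "length (lst (inv n \<otimes> m \<otimes> n)) < length (lst m)" if "hd (lst m) = (t, n)"
      proof -
        have "q = (t, n)" using that snoc Cons by simp
        then have "fcons t (inv n) (w @ r) = w' @ r"
          using Cons n assms by (auto simp: fcons_def)
        then show ?thesis using l snoc Cons r_len by simp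
      qed
      ultimately show ?thesis using snoc r_len by auto
    qed
  qed
  then show "length (lst (inv n \<otimes> m \<otimes> n)) \<le> max 1 (length (lst m))"
    and "length (lst m) > 1 \<Longrightarrow> hd (lst m) = (t, n) \<Longrightarrow>
      length (lst (inv n \<otimes> m \<otimes> n)) < length (lst m)" by auto
qed

lemma short_in_par:
  assumes "m \<in> carrier G" "m \<in> par S \<or> ends m t t" "length (lst m) \<le> 1"
  shows "m \<in> par (P t)"
proof (cases "lst m")
  case Nil
  then show ?thesis using lst_Nil_iff[OF assms(1)] par_S_sub by auto
next
  case (Cons p w)
  then have "lst m = [p]" using assms(3) by simp
  moreover have "m \<notin> par S" using lst_Nil_iff[OF assms(1)] Cons by simp
  ultimately obtain k where k: "lst m = [(t, k)]" using assms(2) by (cases p) (auto simp: ends_def)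
  then have "k \<in> N t" using lst_words[OF assms(1)] by (simp add: words_Cons)
  then have "k \<in> par (P t)" "\<rho> m \<in> par (P t)" "k \<in> carrier G"
    using \<rho>_in[OF assms(1)] par_S_sub N_closed by (auto simp: N_def)
  moreover have "m = k \<otimes> \<rho> m" using ev_lst[OF assms(1)] k \<open>k \<in> carrier G\<close> by simp
  ultimately show ?thesis using subgroup.m_closed[OF subgroup_par_P] by metis
qed

text \<open>Induction on the total length. If no member translates the base edge along an axis,
  commutation puts all members on the same side \<open>t\<close>; conjugating by the first syllable
  of a long member then shortens it and raises no other summand. Once all have at most one syllable,
  they lie in one vertex group.\<close>

lemma commuting_family_trichotomy:
  assumes "finite I" "\<And>i. i \<in> I \<Longrightarrow> f i \<in> carrier G"
    and "\<And>i j. i \<in> I \<Longrightarrow> j \<in> I \<Longrightarrow> f i \<otimes> f j = f j \<otimes> f i"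
  shows "\<exists>g\<in>carrier G. (\<exists>t. \<forall>i\<in>I. inv g \<otimes> f i \<otimes> g \<in> par (P t)) \<or>
            (\<exists>t. \<exists>i\<in>I. ends (inv g \<otimes> f i \<otimes> g) t (\<not> t))"
  using assms(2,3)
proof (induction "\<Sum>i\<in>I. max 1 (length (lst (f i)))" arbitrary: f rule: less_induct)
  case less
  show ?case
  proof (cases "\<exists>t. \<exists>i\<in>I. ends (f i) t (\<not> t)")
    case True
    then show ?thesis using less.prems by (auto intro!: bexI[of _ \<one>])
  next
    case False
    have ell: "f i \<in> par S \<or> (\<exists>t. ends (f i) t t)" if "i \<in> I" for i
    proof -
      have "q = p" if "ends (f i) p q" for p q
      proof (rule ccontr)
        assume "q \<noteq> p"
        then have "q = (\<not> p)" by simp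
        then show False using False that \<open>i \<in> I\<close> by blast
      qed
      then show ?thesis using par_S_or_ends[OF less.prems(1)[OF that]] by blast
    qed
    have "\<exists>t. \<forall>i\<in>I. f i \<in> par S \<or> ends (f i) t t"
    proof (cases "\<exists>i\<in>I. f i \<notin> par S")
      case True
      then obtain i t where i: "i \<in> I" "ends (f i) t t" using ell by blast
      have "f j \<in> par S \<or> ends (f j) t t" if j: "j \<in> I" for j
      proof -
        have "\<not> ends (f j) (\<not> t) (\<not> t)"
          using ends_opposite_not_commute[OF i(2)] less.prems(2)[OF i(1) j] by blast
        moreover have "ends (f j) t t \<or> ends (f j) (\<not> t) (\<not> t)" if "ends (f j) t' t'" for t'
          using that by (cases "t' = t") auto
        ultimately show ?thesis using ell[OF j] by auto
      qed
      then show ?thesis by blast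
    qed blast
    then obtain t where t: "\<And>i. i \<in> I \<Longrightarrow> f i \<in> par S \<or> ends (f i) t t" by blast
    show ?thesis
    proof (cases "\<forall>i\<in>I. length (lst (f i)) \<le> 1")
      case True
      then have "\<forall>i\<in>I. inv \<one> \<otimes> f i \<otimes> \<one> \<in> par (P t)"
        using short_in_par[OF _ t] less.prems(1) by simp
      then show ?thesis using one_closed by blast
    next
      case False
      then obtain i where i: "i \<in> I" "length (lst (f i)) > 1" by auto
      then have "ends (f i) t t" using t[OF i(1)] lst_Nil_iff[OF less.prems(1)[OF i(1)]] by auto
      then obtain n w where n: "lst (f i) = (t, n) # w"
        by (cases "lst (f i)") (auto simp: ends_def)
      have nN: "n \<in> N t" "n \<noteq> \<one>" "n \<in> carrier G"
        using lst_words[OF less.prems(1)[OF i(1)]] n N_closed by (auto simp: words_Cons)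
      define f' where "f' j = inv n \<otimes> f j \<otimes> n" for j
      have f': "f' j \<in> carrier G" if "j \<in> I" for j
        using less.prems(1)[OF that] nN by (simp add: f'_def)
      have "(\<Sum>j\<in>I. max 1 (length (lst (f' j)))) < (\<Sum>j\<in>I. max 1 (length (lst (f j))))"
      proof (rule sum_strict_mono_ex1[OF assms(1)])
        show "\<forall>j\<in>I. max 1 (length (lst (f' j))) \<le> max 1 (length (lst (f j)))"
        proof
          fix j assume j: "j \<in> I"
          show "max 1 (length (lst (f' j))) \<le> max 1 (length (lst (f j)))"
            using length_lst_conj(1)[OF nN(1,2) less.prems(1)[OF j] t[OF j]] by (simp add: f'_def)
        qed
        have "length (lst (f' i)) < length (lst (f i))"
          unfolding f'_def
          by (rule length_lst_conj(2)[OF nN(1,2) less.prems(1)[OF i(1)] t[OF i(1)] i(2)]) (simp add: n)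
        then show "\<exists>j\<in>I. max 1 (length (lst (f' j))) < max 1 (length (lst (f j)))"
          using i by (intro bexI[of _ i]) auto
      qed
      moreover have "f' j \<otimes> f' k = f' k \<otimes> f' j" if "j \<in> I" "k \<in> I" for j k
        using that less.prems nN by (simp add: f'_def inv_conj_mult)
      ultimately obtain g where g: "g \<in> carrier G"
        "(\<exists>t. \<forall>i\<in>I. inv g \<otimes> f' i \<otimes> g \<in> par (P t)) \<or> (\<exists>t. \<exists>i\<in>I. ends (inv g \<otimes> f' i \<otimes> g) t (\<not> t))"
        using less.hyps[of f'] f' by blast
      have "inv g \<otimes> f' j \<otimes> g = inv (n \<otimes> g) \<otimes> f j \<otimes> (n \<otimes> g)" if "j \<in> I" for j
        unfolding f'_def using g less.prems(1)[OF that] nN by (intro inv_conj_conj) auto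
      then show ?thesis using g nN by (intro bexI[of _ "n \<otimes> g"]) auto
    qed
  qed
qed

end

section \<open>Splitting over the link of a vertex\<close>

context artin_group
begin

definition link :: "'v \<Rightarrow> 'v set" where "link v = {w. (v, w) \<in> R}"

lemma link_sub: "link v \<subseteq> V"
  using R_sub by (auto simp: link_def)

lemma not_in_link [simp]: "v \<notin> link v"
  using R_irrefl by (auto simp: link_def)

text \<open>The sides meet in \<open>link z\<close>, and \<open>z\<close> has no neighbours
  elsewhere. If \<open>z\<close> is joined to everything, the side \<open>False\<close> is just
  \<open>link z\<close>; degenerate amalgams are permitted.\<close>

definition star_split :: "'v \<Rightarrow> bool \<Rightarrow> 'v set" where
  "star_split z t = (if t then insert z (link z) else V - {z})"

lemma star_amalgam: "z \<in> V \<Longrightarrow> artin_amalgam V R G (star_split z)"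
  using artin_group_axioms link_sub[of z]
  by (auto simp: artin_amalgam_def artin_amalgam_axioms_def star_split_def link_def)

text \<open>If \<open>u\<close> lay outside the star of \<open>v\<close>, the two powers would lie
  in opposite factors of the splitting over \<open>link v\<close>.\<close>

lemma commuting_powers:
  assumes "u \<in> V" "v \<in> V" "k \<noteq> 0" "l \<noteq> 0"
    and comm: "gen u [^] (k::int) \<otimes> gen v [^] (l::int) = gen v [^] l \<otimes> gen u [^] k"
  shows "u = v \<or> (u, v) \<in> R"
proof (rule ccontr)
  assume n: "\<not> (u = v \<or> (u, v) \<in> R)"
  interpret A: artin_amalgam V R G "star_split v" by (rule star_amalgam[OF assms(2)])
  have "A.ends (gen u [^] k) False False"
    by (rule A.ends_gen_pow) (use n assms R_sym in \<open>auto simp: star_split_def link_def\<close>)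
  moreover have "A.ends (gen v [^] l) True True"
    by (rule A.ends_gen_pow) (use assms in \<open>auto simp: star_split_def\<close>)
  ultimately show False using A.ends_opposite_not_commute[of "gen u [^] k" False] comm by auto
qed

end

section \<open>Free abelian subgroups and cliques\<close>

text \<open>A dual family certifies that the \<open>p i\<close> generate a free abelian group of rank \<open>card I\<close>; the
  functionals \<open>\<theta> i\<close> survive passing to subgroups and spare us products over \<open>I\<close>.\<close>

definition dual_family ::
  "('z, 'y) monoid_scheme \<Rightarrow> 'i set \<Rightarrow> ('i \<Rightarrow> 'z) \<Rightarrow> ('i \<Rightarrow> 'z \<Rightarrow> int) \<Rightarrow> bool" where
  "dual_family Z I p \<theta> \<longleftrightarrow> (\<forall>i\<in>I. p i \<in> carrier Z \<and> \<theta> i \<in> hom Z integer_group) \<and>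
     (\<forall>i\<in>I. \<forall>j\<in>I. \<theta> i (p j) \<noteq> 0 \<longleftrightarrow> i = j)"

context group
begin

lemma int_hom_simps:
  assumes "\<tau> \<in> hom G integer_group"
  shows "x \<in> carrier G \<Longrightarrow> y \<in> carrier G \<Longrightarrow> \<tau> (x \<otimes> y) = \<tau> x + \<tau> y"
    and "x \<in> carrier G \<Longrightarrow> \<tau> (x [^] (k::int)) = k * \<tau> x"
    and "\<tau> \<one> = 0"
proof -
  interpret \<tau>: group_hom G integer_group \<tau>
    by (simp add: group_hom_def group_hom_axioms_def assms is_group)
  show "x \<in> carrier G \<Longrightarrow> y \<in> carrier G \<Longrightarrow> \<tau> (x \<otimes> y) = \<tau> x + \<tau> y"
    and "x \<in> carrier G \<Longrightarrow> \<tau> (x [^] (k::int)) = k * \<tau> x"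
    and "\<tau> \<one> = 0"
    using \<tau>.hom_mult \<tau>.hom_int_pow \<tau>.hom_one by auto
qed

text \<open>If some \<open>\<theta> k\<close> is nonzero on \<open>m\<close>, sacrificing the index
  \<open>k\<close> buys functionals that vanish on \<open>m\<close>, and then the factors
  \<open>m [^] b i\<close> are invisible.\<close>

lemma dual_family_drop:
  assumes "finite I" "dual_family G I p \<theta>" "m \<in> carrier G" "\<And>i. i \<in> I \<Longrightarrow> a i \<noteq> (0::int)"
  obtains I' \<theta>' where "I' \<subseteq> I" "card I \<le> Suc (card I')"
    "dual_family G I' (\<lambda>i. p i [^] a i \<otimes> m [^] (b i :: int)) \<theta>'"
proof -
  let ?p = "\<lambda>i. p i [^] a i \<otimes> m [^] b i"
  have p: "p i \<in> carrier G" "\<theta> i \<in> hom G integer_group" if "i \<in> I" for i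
    using assms(2) that by (auto simp: dual_family_def)
  have dual: "\<theta> i (p j) \<noteq> 0 \<longleftrightarrow> i = j" if "i \<in> I" "j \<in> I" for i j
    using assms(2) that by (auto simp: dual_family_def)
  have \<theta>p: "\<theta> i (?p j) = a j * \<theta> i (p j) + b j * \<theta> i m" if "i \<in> I" "j \<in> I" for i j
    using that p assms(3) by (simp add: int_hom_simps[OF p(2)])
  show thesis
  proof (cases "\<forall>i\<in>I. \<theta> i m = 0")
    case True
    then have "dual_family G I ?p \<theta>"
      using p dual \<theta>p assms(3,4) by (auto simp: dual_family_def)
    then show thesis using that[of I] by simp
  next
    case False
    then obtain k where k: "k \<in> I" "\<theta> k m \<noteq> 0" by blast
    \<comment> \<open>Eliminates \<open>m\<close>; on the \<open>p j\<close> with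
      \<open>j \<noteq> k\<close> the second term vanishes by duality.\<close>
    define \<theta>' where "\<theta>' i x = \<theta> k m * \<theta> i x - \<theta> i m * \<theta> k x" for i x
    have "\<theta>' i \<in> hom G integer_group" if "i \<in> I" for i
      by (rule homI) (use that k p in \<open>auto simp: \<theta>'_def int_hom_simps algebra_simps\<close>)
    moreover have "\<theta>' i (?p j) = \<theta> k m * a j * \<theta> i (p j)" if "i \<in> I" "j \<in> I" "j \<noteq> k" for i j
      using dual[of k j] that k by (simp add: \<theta>'_def \<theta>p algebra_simps)
    ultimately have "dual_family G (I - {k}) ?p \<theta>'"
      using p dual k assms(3,4) by (simp add: dual_family_def)
    moreover have "card I \<le> Suc (card (I - {k}))" using card_Suc_Diff1[OF assms(1) k(1)] by simp
    ultimately show thesis using that[of "I - {k}"] by blast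
  qed
qed

text \<open>Elimination with a pivot \<open>p k\<close> on which \<open>\<tau>\<close> is nonzero.
  The new family stays in the subgroup generated by the old one, so that hypotheses about a subgroup
  containing the \<open>p i\<close> pass to it.\<close>

lemma dual_family_kernel:
  assumes "finite I" "dual_family G I p \<theta>" "\<tau> \<in> hom G integer_group"
  obtains I' p' \<theta>' where "I' \<subseteq> I" "card I \<le> Suc (card I')" "dual_family G I' p' \<theta>'"
    "\<And>i. i \<in> I' \<Longrightarrow> \<tau> (p' i) = 0" "\<And>i. i \<in> I' \<Longrightarrow> p' i \<in> generate G (p ` I)"
proof (cases "\<forall>i\<in>I. \<tau> (p i) = 0")
  case True
  then show thesis using that[of I p \<theta>] assms(2) by (simp add: generate.incl)
next
  case False
  then obtain k where k: "k \<in> I" "\<tau> (p k) \<noteq> 0" by blast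
  have p: "p i \<in> carrier G" if "i \<in> I" for i using assms(2) that by (auto simp: dual_family_def)
  have sub: "subgroup (generate G (p ` I)) G" using p by (intro generate_is_subgroup) auto
  let ?p = "\<lambda>i. p i [^] \<tau> (p k) \<otimes> p k [^] (- \<tau> (p i))"
  obtain I' \<theta>' where I': "I' \<subseteq> I" "card I \<le> Suc (card I')" "dual_family G I' ?p \<theta>'"
    by (rule dual_family_drop[OF assms(1,2) p[OF k(1)], of "\<lambda>_. \<tau> (p k)" "\<lambda>i. - \<tau> (p i)"])
      (use k in auto)
  have "\<tau> (?p i) = 0" if "i \<in> I'" for i
    using that I'(1) p k by (simp add: int_hom_simps[OF assms(3)] subset_iff)
  moreover have "?p i \<in> generate G (p ` I)" if "i \<in> I'" for i
    using that I'(1) k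
    by (intro subgroup.m_closed[OF sub] subgroup_int_pow_closed[OF sub] generate.incl) auto
  ultimately show thesis using that I' by blast
qed

lemma inv_conj_int_pow:
  assumes "g \<in> carrier G" "x \<in> carrier G"
  shows "(inv g \<otimes> x \<otimes> g) [^] (k::int) = inv g \<otimes> x [^] k \<otimes> g"
proof -
  interpret c: group_hom G G "\<lambda>x. inv g \<otimes> x \<otimes> inv (inv g)"
    using conj_hom[of "inv g"] assms by (simp add: group_hom_def group_hom_axioms_def is_group)
  show ?thesis using c.hom_int_pow[of x k] assms by simp
qed

lemma inv_conj_eq_one_iff:
  "g \<in> carrier G \<Longrightarrow> x \<in> carrier G \<Longrightarrow> inv g \<otimes> x \<otimes> g = \<one> \<longleftrightarrow> x = \<one>"
  using conj_eq_one_iff[of "inv g" x] by simp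

lemma hom_generate_into:
  assumes "group K" "h \<in> hom G K" "subgroup H K" "A \<subseteq> carrier G" "\<And>a. a \<in> A \<Longrightarrow> h a \<in> H"
    "x \<in> generate G A"
  shows "h x \<in> H"
proof -
  interpret h: group_hom G K h by (simp add: group_hom_def group_hom_axioms_def assms is_group)
  have "subgroup {x \<in> carrier G. h x \<in> H} G"
    by (rule subgroupI)
      (use assms(3) in \<open>auto simp: subgroup.m_closed subgroup.m_inv_closed subgroup.one_closed
        intro!: exI[of _ \<one>]\<close>)
  then have "generate G A \<subseteq> {x \<in> carrier G. h x \<in> H}"
    using assms by (intro generate_subgroup_incl) auto
  then show ?thesis using assms by auto
qed

end

section \<open>Growth of powers: elliptic against hyperbolic elements\<close>

context artin_amalgam
begin

lemma ends_pow: "ends x t (\<not> t) \<Longrightarrow> i > 0 \<Longrightarrow> ends (x [^] (i::nat)) t (\<not> t)"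
proof (induction i)
  case (Suc i)
  have x: "x \<in> carrier G" using Suc.prems ends_closed by auto
  show ?case
  proof (cases "i = 0")
    case True
    then show ?thesis using Suc.prems x by simp
  next
    case False
    then have "ends (x [^] i \<otimes> x) t (\<not> t)"
      using Suc by (intro ends_mult[where l = "\<not> t" and f' = t]) auto
    then show ?thesis by simp
  qed
qed simp

lemma length_lst_pow:
  assumes "ends h t (\<not> t)"
  shows "i \<le> length (lst (h [^] (i::nat)))"
proof (induction i)
  case (Suc i)
  have h: "h \<in> carrier G" using assms ends_closed by auto
  have "\<not> headed (\<not> t) (lst (h [^] i))"
  proof (cases "i = 0")
    case True
    then show ?thesis by (simp add: lst_def headed_def)
  next
    case False
    then show ?thesis using ends_pow[OF assms, of i] by (auto simp: headed_def ends_def)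
  qed
  then have "act h (lst (h [^] i)) = lst h @ conj_word (\<rho> h) (lst (h [^] i))"
    using h by (intro act_ends(1)[OF assms]) auto
  moreover have "lst (h [^] Suc i) = act h (lst (h [^] i))"
    unfolding lst_def by (rule act_pow_Suc[OF h words_Nil])
  moreover have "length (lst h) \<ge> 1" using assms by (cases "lst h") (auto simp: ends_def)
  ultimately show ?case using Suc by simp
qed simp

lemma length_act_le:
  assumes "g \<in> carrier G" "w \<in> words"
  shows "length (act g w) \<le> length (lst g) + length w"
proof -
  have *: "length (fmul u w) \<le> length u + length w" for u w
  proof (induction u)
    case (Cons p u)
    then show ?case using length_fcons_le(1)[of "fst p" "snd p" "fmul u w"] by (cases p) auto
  qed simp
  show ?thesis unfolding act_eq[OF assms] using *[of "lst g" "conj_word (\<rho> g) w"] by simp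
qed

text \<open>Normal forms of powers of a hyperbolic element grow linearly. Powers of a vertex group
  element have at most one syllable, so their conjugates by \<open>g\<close> stay within the bound
  \<open>B\<close>.\<close>

lemma conj_par_P_not_hyperbolic:
  assumes "g \<in> carrier G" "a \<in> par (P s)"
  shows "\<not> ends (inv g \<otimes> a \<otimes> g) t (\<not> t)"
proof
  assume e: "ends (inv g \<otimes> a \<otimes> g) t (\<not> t)"
  define B where "B = length (lst (inv g)) + (1 + length (lst g))"
  have a: "a \<in> carrier G" using assms par_P_closed by auto
  let ?a = "a [^] int (Suc B)"
  have pow: "?a \<in> par (P s)" by (rule subgroup_int_pow_closed[OF subgroup_par_P assms(2)])
  have "lst ?a = fcons s (?a \<otimes> inv (\<rho> ?a)) []"
    unfolding lst_def act_par[OF pow words_Nil] sact_def by simp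
  then have l: "length (lst ?a) \<le> 1" using length_fcons_le(1)[of s _ "[]"] by simp
  have "(inv g \<otimes> a \<otimes> g) [^] Suc B = (inv g \<otimes> a \<otimes> g) [^] int (Suc B)"
    by (rule int_pow_int[symmetric])
  also have "\<dots> = inv g \<otimes> ?a \<otimes> g" by (rule inv_conj_int_pow[OF assms(1) a])
  finally have "Suc B \<le> length (lst (inv g \<otimes> ?a \<otimes> g))" using length_lst_pow[OF e, of "Suc B"] by metis
  also have "lst (inv g \<otimes> ?a \<otimes> g) = act (inv g) (act ?a (lst g))"
    using assms a by (simp add: lst_mult act_mult)
  also have "length \<dots> \<le> length (lst (inv g)) + length (act ?a (lst g))"
    using assms a by (intro length_act_le) auto
  also have "\<dots> \<le> length (lst (inv g)) + (length (lst ?a) + length (lst g))"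
    using assms a by (intro add_left_mono length_act_le) auto
  also have "\<dots> \<le> B" using l by (simp add: B_def)
  finally show False by simp
qed

text \<open>\<open>centralizer_axis\<close> puts a product of a power of \<open>y\<close> and
  \<open>x [^] b\<close> into \<open>par S\<close>. If \<open>b\<close> were nonzero, that power of
  \<open>y\<close> would be an element of \<open>par S\<close> times a nontrivial power of
  \<open>x\<close>, hence hyperbolic, although it is conjugate into a vertex group.\<close>

lemma elliptic_fixes_axis:
  assumes "ends x t (\<not> t)" "g \<in> carrier G" "a \<in> par (P s)"
    and y: "y = inv g \<otimes> a \<otimes> g" and comm: "x \<otimes> y = y \<otimes> x"
  obtains j :: nat where "j > 0" "y [^] int j \<in> par S"
proof -
  have x: "x \<in> carrier G" using assms ends_closed by auto
  have a: "a \<in> carrier G" using assms par_P_closed by auto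
  have yc: "y \<in> carrier G" using a assms by simp
  obtain j :: nat and b :: int where j: "j > 0" "y [^] int j \<otimes> x [^] b \<in> par S"
    by (rule centralizer_axis[OF assms(1) yc comm])
  have "b = 0"
  proof (rule ccontr)
    assume "b \<noteq> 0"
    have "\<exists>s. ends (x [^] (- b)) s (\<not> s)"
    proof (cases "b > 0")
      case True
      have "x [^] (- b) = inv (x [^] nat b)" using True x int_pow_neg_int[of x "nat b"] by simp
      moreover have "ends (inv (x [^] nat b)) (\<not> t) (\<not> \<not> t)"
        using ends_inv[OF ends_pow[OF assms(1), of "nat b"]] True by simp
      ultimately have "ends (x [^] (- b)) (\<not> t) (\<not> \<not> t)" by simp
      then show ?thesis by blast
    next
      case False
      have "x [^] (- b) = x [^] nat (- b)" using False by (simp flip: int_pow_int)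
      then show ?thesis using ends_pow[OF assms(1), of "nat (- b)"] False \<open>b \<noteq> 0\<close> by auto
    qed
    then obtain s' where "ends (x [^] (- b)) s' (\<not> s')" by blast
    then have "ends ((y [^] int j \<otimes> x [^] b) \<otimes> x [^] (- b)) s' (\<not> s')"
      using ends_par_S_mult(1)[OF j(2)] by blast
    moreover have "(y [^] int j \<otimes> x [^] b) \<otimes> x [^] (- b) = y [^] int j"
      using x yc by (simp add: int_pow_neg m_assoc)
    moreover have "y [^] int j = inv g \<otimes> a [^] int j \<otimes> g"
      unfolding y by (rule inv_conj_int_pow[OF assms(2) a])
    moreover have "a [^] int j \<in> par (P s)" by (rule subgroup_int_pow_closed[OF subgroup_par_P assms(3)])
    ultimately show False using conj_par_P_not_hyperbolic[OF assms(2)] by metis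
  qed
  then show thesis using that j yc by simp
qed

end

context artin_group
begin

text \<open>\<open>retract T\<close> fixes \<open>inv g \<otimes> x \<otimes> g\<close>, and it
  turns conjugation by \<open>g\<close> into conjugation by \<open>retract T g\<close>. Retracting
  thus replaces conjugating a subgroup into \<open>par T\<close>, and unlike conjugation it maps
  other parabolic subgroups into themselves.\<close>

lemma retract_conj_injective:
  assumes "T \<subseteq> V" "g \<in> carrier G" "x \<in> carrier G" "inv g \<otimes> x \<otimes> g \<in> par T" "retract T x = \<one>"
  shows "x = \<one>"
proof -
  have "inv g \<otimes> x \<otimes> g = retract T (inv g \<otimes> x \<otimes> g)" using retract_id[OF assms(1) order_refl assms(4)] by simp
  also have "\<dots> = \<one>" using assms by simp
  finally show ?thesis using inv_conj_eq_one_iff assms by blast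
qed

lemma finite_sub_V: "U \<subseteq> V \<Longrightarrow> finite U"
  using finite_V finite_subset by blast

lemma subgroup_conj_par:
  assumes "g \<in> carrier G" "T \<subseteq> V"
  shows "subgroup {x \<in> carrier G. inv g \<otimes> x \<otimes> g \<in> par T} G"
proof -
  interpret T: subgroup "par T" G by (rule par_subgroup[OF assms(2)])
  show ?thesis
  proof (rule subgroupI)
    fix x y assume "x \<in> {x \<in> carrier G. inv g \<otimes> x \<otimes> g \<in> par T}" "y \<in> {x \<in> carrier G. inv g \<otimes> x \<otimes> g \<in> par T}"
    then show "x \<otimes> y \<in> {x \<in> carrier G. inv g \<otimes> x \<otimes> g \<in> par T}"
      using inv_conj_mult[OF assms(1), of x y, symmetric] by auto
  next
    fix x assume x: "x \<in> {x \<in> carrier G. inv g \<otimes> x \<otimes> g \<in> par T}"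
    have "inv g \<otimes> inv x \<otimes> g = inv (inv g \<otimes> x \<otimes> g)"
      using x assms(1) by (simp add: inv_mult_group m_assoc)
    then show "inv x \<in> {x \<in> carrier G. inv g \<otimes> x \<otimes> g \<in> par T}" using x by auto
  next
    show "{x \<in> carrier G. inv g \<otimes> x \<otimes> g \<in> par T} \<noteq> {}"
      using assms(1) by (auto intro!: exI[of _ \<one>])
  qed auto
qed

text \<open>Induction on \<open>W\<close>: passing to the kernel of the exponent sum of one vertex
  costs at most one member of the family and leaves the image in the parabolic subgroup of the
  remaining vertices.\<close>

lemma clique_rank:
  assumes "comm_group Z" "\<psi> \<in> hom Z G" "subgroup H Z" "\<And>x. x \<in> H \<Longrightarrow> \<psi> x = \<one> \<Longrightarrow> x = \<one>\<^bsub>Z\<^esub>"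
    and "clique W" "finite I" "dual_family Z I p \<theta>" "\<And>i. i \<in> I \<Longrightarrow> p i \<in> H"
    and "\<And>i. i \<in> I \<Longrightarrow> \<psi> (p i) \<in> par W"
  shows "card I \<le> card W"
proof -
  interpret Z: comm_group Z by fact
  interpret \<psi>: group_hom Z G \<psi>
    by (simp add: group_hom_def group_hom_axioms_def assms is_group Z.is_group)
  have "finite W" using assms(5) finite_sub_V by (simp add: clique_def)
  then show ?thesis using assms(5-9)
  proof (induction W arbitrary: I p \<theta> rule: finite_induct)
    case empty
    have False if "i \<in> I" for i
    proof -
      have "p i = \<one>\<^bsub>Z\<^esub>" using empty that assms(4) by (simp add: par_empty)
      moreover have "\<theta> i (p i) \<noteq> 0" "\<theta> i \<in> hom Z integer_group"
        using empty that by (auto simp: dual_family_def)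
      ultimately show False using Z.int_hom_simps(3) by metis
    qed
    then have "I = {}" by blast
    then show ?case by simp
  next
    case (insert z W)
    have "expo z \<circ> \<psi> \<in> hom Z integer_group" by (rule Group.hom_compose[OF \<psi>.homh expo_hom])
    then obtain I' p' \<theta>' where I': "I' \<subseteq> I" "card I \<le> Suc (card I')" "dual_family Z I' p' \<theta>'"
      "\<And>i. i \<in> I' \<Longrightarrow> (expo z \<circ> \<psi>) (p' i) = 0" "\<And>i. i \<in> I' \<Longrightarrow> p' i \<in> generate Z (p ` I)"
      using Z.dual_family_kernel[OF insert.prems(2,3)] by metis
    have V: "z \<in> V" "W \<subseteq> V" "insert z W \<subseteq> V" and z: "\<And>u. u \<in> W \<Longrightarrow> (z, u) \<in> R"
      using insert.prems(1) insert.hyps by (auto simp: clique_def)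
    have p: "p ` I \<subseteq> carrier Z" using insert.prems(3) by (auto simp: dual_family_def)
    have "generate Z (p ` I) \<subseteq> H"
      using insert.prems(4) by (intro Z.generate_subgroup_incl assms(3)) auto
    then have H: "p' i \<in> H" if "i \<in> I'" for i using I'(5)[OF that] by auto
    have "\<psi> (p' i) \<in> par (insert z W)" if "i \<in> I'" for i
      by (rule Z.hom_generate_into[OF is_group \<psi>.homh par_subgroup[OF V(3)] p _ I'(5)[OF that]])
        (use insert.prems(5) in auto)
    then have W: "\<psi> (p' i) \<in> par W" if "i \<in> I'" for i
      using par_insert_expo_zero[OF V(1,2) z] I'(4) that by simp
    have "card I' \<le> card W"
    proof (rule insert.IH)
      show "clique W" using insert.prems(1) by (rule clique_subset) auto
      show "finite I'" using I'(1) insert.prems(2) finite_subset by blast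
    qed (use I' H W in auto)
    then show ?case using I'(2) insert.hyps by simp
  qed
qed

text \<open>The abelian group acts on the tree of the splitting over \<open>link z\<close>. Either
  the family avoids \<open>z\<close> up to conjugation, or after losing at most one dimension it is
  conjugate into \<open>par (link z)\<close>; the lost dimension will be paid for by
  \<open>z\<close>. The marking elements \<open>q s\<close> must keep a nonzero exponent at
  \<open>s\<close>, so they are replaced by powers only.\<close>

lemma clique_extension_step:
  assumes Z: "comm_group Z" and \<psi>: "\<psi> \<in> hom Z G"
    and z: "z \<in> U" "U \<subseteq> V" "z \<notin> W" "W \<subseteq> U" "clique W" "S \<subseteq> W" "finite I" "dual_family Z I p \<theta>"
    and H: "subgroup H Z" "\<And>i. i \<in> I \<Longrightarrow> p i \<in> H" "\<And>s. s \<in> S \<Longrightarrow> q s \<in> H"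
      "\<And>x. x \<in> H \<Longrightarrow> \<psi> x = \<one> \<Longrightarrow> x = \<one>\<^bsub>Z\<^esub>"
    and pU: "\<And>i. i \<in> I \<Longrightarrow> \<psi> (p i) \<in> par U"
    and qW: "\<And>s. s \<in> S \<Longrightarrow> \<psi> (q s) \<in> par W" "\<And>s. s \<in> S \<Longrightarrow> expo s (\<psi> (q s)) \<noteq> 0"
  obtains g where "g \<in> carrier G"
      "\<And>i. i \<in> I \<Longrightarrow> inv g \<otimes> \<psi> (p i) \<otimes> g \<in> par (V - {z})"
      "\<And>s. s \<in> S \<Longrightarrow> inv g \<otimes> \<psi> (q s) \<otimes> g \<in> par (V - {z})"
  | g I' p' \<theta>' q' where "g \<in> carrier G" "I' \<subseteq> I" "card I \<le> Suc (card I')" "dual_family Z I' p' \<theta>'"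
      "\<And>i. i \<in> I' \<Longrightarrow> p' i \<in> H" "\<And>s. s \<in> S \<Longrightarrow> q' s \<in> H"
      "\<And>i. i \<in> I' \<Longrightarrow> inv g \<otimes> \<psi> (p' i) \<otimes> g \<in> par (link z)"
      "\<And>s. s \<in> S \<Longrightarrow> inv g \<otimes> \<psi> (q' s) \<otimes> g \<in> par (link z)"
      "\<And>i. i \<in> I' \<Longrightarrow> \<psi> (p' i) \<in> par U"
      "\<And>s. s \<in> S \<Longrightarrow> \<psi> (q' s) \<in> par W" "\<And>s. s \<in> S \<Longrightarrow> expo s (\<psi> (q' s)) \<noteq> 0"
proof -
  interpret Z: comm_group Z by fact
  interpret \<psi>: group_hom Z G \<psi>
    by (simp add: group_hom_def group_hom_axioms_def \<psi> is_group Z.is_group)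
  have zV: "z \<in> V" and WV: "W \<subseteq> V" and SV: "S \<subseteq> V" using z by auto
  interpret A: artin_amalgam V R G "star_split z" by (rule star_amalgam[OF zV])
  have AS: "A.S = link z" using link_sub[of z] by (auto simp: A.S_def star_split_def)
  have Hc: "x \<in> carrier Z" if "x \<in> H" for x using that H(1) subgroup.mem_carrier by metis
  define f where "f = case_sum (\<psi> \<circ> p) (\<psi> \<circ> q)"
  define c where "c = case_sum p q"
  have c: "c j \<in> H" "f j = \<psi> (c j)" "f j \<in> carrier G" if "j \<in> I <+> S" for j
    using that H(2,3) Hc by (auto simp: f_def c_def)
  have "f i \<otimes> f j = f j \<otimes> f i" if "i \<in> I <+> S" "j \<in> I <+> S" for i j
    using c[OF that(1)] c[OF that(2)] Hc Z.m_comm by (simp flip: \<psi>.hom_mult)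
  moreover have "finite (I <+> S)" using z(7) finite_sub_V[OF SV] by simp
  ultimately obtain g where g: "g \<in> carrier G"
    "(\<exists>t. \<forall>i\<in>I <+> S. inv g \<otimes> f i \<otimes> g \<in> par (star_split z t)) \<or>
      (\<exists>t. \<exists>i\<in>I <+> S. A.ends (inv g \<otimes> f i \<otimes> g) t (\<not> t))"
    using A.commuting_family_trichotomy[of "I <+> S" f] c(3) by metis
  have stable: "i \<in> I \<Longrightarrow> inv g \<otimes> \<psi> (p i) \<otimes> g \<in> par (star_split z t)"
      "s \<in> S \<Longrightarrow> inv g \<otimes> \<psi> (q s) \<otimes> g \<in> par (star_split z t)"
    if "\<forall>i\<in>I <+> S. inv g \<otimes> f i \<otimes> g \<in> par (star_split z t)" for t i s
    using that[rule_format, of "Inl i"] that[rule_format, of "Inr s"]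
    by (auto simp: f_def)
  from g(2) consider (ell) t where "\<forall>i\<in>I <+> S. inv g \<otimes> f i \<otimes> g \<in> par (star_split z t)"
    | (hyp) t i where "i \<in> I <+> S" "A.ends (inv g \<otimes> f i \<otimes> g) t (\<not> t)"
    by blast
  then consider (free) "\<forall>i\<in>I <+> S. inv g \<otimes> f i \<otimes> g \<in> par (star_split z False)"
    | (star) "\<forall>i\<in>I <+> S. inv g \<otimes> f i \<otimes> g \<in> par (star_split z True)"
    | (hyp) t i where "i \<in> I <+> S" "A.ends (inv g \<otimes> f i \<otimes> g) t (\<not> t)"
  proof cases
    case (ell t)
    then show thesis by (cases t) (simp_all add: that(1,2))
  qed (use that(3) in blast)
  then show thesis
  proof cases
    case free
    note st = stable[OF free]
    have "inv g \<otimes> \<psi> (p i) \<otimes> g \<in> par (V - {z})" if "i \<in> I" for i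
      using st(1)[OF that] by (simp add: star_split_def)
    moreover have "inv g \<otimes> \<psi> (q s) \<otimes> g \<in> par (V - {z})" if "s \<in> S" for s
      using st(2)[OF that] by (simp add: star_split_def)
    ultimately show thesis using that(1) g by blast
  next
    case star
    have St: "insert z (link z) \<subseteq> V" using zV link_sub[of z] by auto
    \<comment> \<open>In the star of \<open>z\<close>, \<open>gen z\<close> is the only direction
      outside the link, so it suffices to kill \<open>expo z\<close>; on the images of the
      \<open>q s\<close> it vanishes since \<open>z \<notin> W\<close>.\<close>
    have "expo z \<circ> \<psi> \<in> hom Z integer_group" by (rule Group.hom_compose[OF \<psi>.homh expo_hom])
    then obtain I' p' \<theta>' where I': "I' \<subseteq> I" "card I \<le> Suc (card I')" "dual_family Z I' p' \<theta>'"
      "\<And>i. i \<in> I' \<Longrightarrow> (expo z \<circ> \<psi>) (p' i) = 0" "\<And>i. i \<in> I' \<Longrightarrow> p' i \<in> generate Z (p ` I)"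
      using Z.dual_family_kernel[OF z(7,8)] by metis
    have pc: "p ` I \<subseteq> carrier Z" using z(8) by (auto simp: dual_family_def)
    have link: "inv g \<otimes> x \<otimes> g \<in> par (link z)"
      if "x \<in> carrier G" "inv g \<otimes> x \<otimes> g \<in> par (insert z (link z))" "expo z x = 0" for x
      by (rule par_insert_expo_zero[OF zV link_sub _ that(2)]) (use that g in \<open>auto simp: link_def\<close>)
    have H': "p' i \<in> H" if "i \<in> I'" for i
      using Z.generate_subgroup_incl[OF _ H(1), of "p ` I"] H(2) I'(5)[OF that] by blast
    have U': "\<psi> (p' i) \<in> par U" if "i \<in> I'" for i
      by (rule Z.hom_generate_into[OF is_group \<psi>.homh par_subgroup[OF z(2)] pc _ I'(5)[OF that]])
        (use pU in auto)
    have "\<psi> (p' i) \<in> {x \<in> carrier G. inv g \<otimes> x \<otimes> g \<in> par (insert z (link z))}" if "i \<in> I'" for i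
      by (rule Z.hom_generate_into[OF is_group \<psi>.homh subgroup_conj_par[OF g(1) St] pc _ I'(5)[OF that]])
        (use stable(1)[OF star] pc in \<open>auto simp: star_split_def\<close>)
    then have p': "inv g \<otimes> \<psi> (p' i) \<otimes> g \<in> par (link z)" if "i \<in> I'" for i
      using link I'(4) that by simp
    have q': "inv g \<otimes> \<psi> (q s) \<otimes> g \<in> par (link z)" if s: "s \<in> S" for s
    proof (rule link)
      show "\<psi> (q s) \<in> carrier G" using Hc H(3)[OF s] by simp
      show "inv g \<otimes> \<psi> (q s) \<otimes> g \<in> par (insert z (link z))"
        using stable(2)[OF star s] by (simp add: star_split_def)
      show "expo z (\<psi> (q s)) = 0" by (rule expo_par[OF WV qW(1)[OF s] z(3)])
    qed
    show thesis by (rule that(2)[of g I' p' \<theta>' q]) (use g I' H' U' H(3) p' q' qW in auto)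
  next
    case hyp
    \<comment> \<open>\<open>m\<close> is hyperbolic after conjugation by \<open>g\<close>. Some
      power of each \<open>p i\<close>, corrected by a power of \<open>m\<close>, fixes the base
      edge; the direction of \<open>m\<close> is the dimension lost.\<close>
    define m where "m = c i"
    define x where "x = inv g \<otimes> \<psi> m \<otimes> g"
    have m: "m \<in> H" "m \<in> carrier Z" using c hyp Hc by (auto simp: m_def)
    have x: "A.ends x t (\<not> t)" "x \<in> carrier G" using hyp c(2) g m by (auto simp: x_def m_def)
    have comm: "x \<otimes> (inv g \<otimes> \<psi> y \<otimes> g) = (inv g \<otimes> \<psi> y \<otimes> g) \<otimes> x" if "y \<in> carrier Z" for y
      using g(1) m that Z.m_comm[OF m(2) that] by (simp add: x_def inv_conj_mult flip: \<psi>.hom_mult)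
    have "\<exists>j b. j > (0::nat) \<and> inv g \<otimes> \<psi> (p i [^]\<^bsub>Z\<^esub> int j \<otimes>\<^bsub>Z\<^esub> m [^]\<^bsub>Z\<^esub> (b::int)) \<otimes> g \<in> par (link z)"
      if i: "i \<in> I" for i
    proof -
      have y: "p i \<in> carrier Z" using H(2)[OF i] Hc by auto
      obtain j :: nat and b :: int where
        "j > 0" "(inv g \<otimes> \<psi> (p i) \<otimes> g) [^] int j \<otimes> x [^] b \<in> par A.S"
        by (rule A.centralizer_axis[OF x(1) _ comm[OF y]]) (use g y in auto)
      then show ?thesis using g(1) y m(2)
        by (auto simp: x_def inv_conj_int_pow inv_conj_mult AS \<psi>.hom_int_pow intro!: exI[of _ j])
    qed
    then obtain a b where ab: "\<And>i. i \<in> I \<Longrightarrow> a i > (0::nat)"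
      "\<And>i. i \<in> I \<Longrightarrow> inv g \<otimes> \<psi> (p i [^]\<^bsub>Z\<^esub> int (a i) \<otimes>\<^bsub>Z\<^esub> m [^]\<^bsub>Z\<^esub> (b i :: int)) \<otimes> g \<in> par (link z)"
      by metis
    let ?p = "\<lambda>i. p i [^]\<^bsub>Z\<^esub> int (a i) \<otimes>\<^bsub>Z\<^esub> m [^]\<^bsub>Z\<^esub> b i"
    obtain I' \<theta>' where I': "I' \<subseteq> I" "card I \<le> Suc (card I')" "dual_family Z I' ?p \<theta>'"
      by (rule Z.dual_family_drop[OF z(7,8) m(2), of "\<lambda>i. int (a i)" b]) (use ab(1) in fastforce)
    have "\<exists>j. j > (0::nat) \<and> inv g \<otimes> \<psi> (q s [^]\<^bsub>Z\<^esub> int j) \<otimes> g \<in> par (link z)" if s: "s \<in> S" for s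
    proof -
      have y: "q s \<in> carrier Z" using H(3)[OF s] Hc by auto
      \<comment> \<open>The images of the \<open>q s\<close> lie in a vertex group, so they are
        elliptic and powers suffice without a correction by \<open>m\<close>.\<close>
      have "par W \<subseteq> par (star_split z False)"
        using z(3) WV by (intro par_mono) (auto simp: star_split_def)
      then have "\<psi> (q s) \<in> par (star_split z False)" using qW(1)[OF s] by blast
      then obtain j :: nat where "j > 0" "(inv g \<otimes> \<psi> (q s) \<otimes> g) [^] int j \<in> par A.S"
        by (rule A.elliptic_fixes_axis[OF x(1) g(1) _ refl comm[OF y]])
      then show ?thesis using g(1) y
        by (auto simp: inv_conj_int_pow AS \<psi>.hom_int_pow intro!: exI[of _ j])
    qed
    then obtain d where d: "\<And>s. s \<in> S \<Longrightarrow> d s > (0::nat)"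
      "\<And>s. s \<in> S \<Longrightarrow> inv g \<otimes> \<psi> (q s [^]\<^bsub>Z\<^esub> int (d s)) \<otimes> g \<in> par (link z)" by metis
    let ?q = "\<lambda>s. q s [^]\<^bsub>Z\<^esub> int (d s)"
    have U: "f j \<in> par U" if "j \<in> I <+> S" for j
      using that pU qW(1) par_mono[OF z(4)] by (auto simp: f_def)
    have "\<psi> m \<in> par U" using U[OF hyp(1)] c(2)[OF hyp(1)] by (simp add: m_def)
    then have pU': "\<psi> (?p i) \<in> par U" if "i \<in> I" for i
      using that H(2)[OF that] Hc m(2) pU par_subgroup[OF z(2)]
      by (simp add: \<psi>.hom_int_pow subgroup.m_closed subgroup_int_pow_closed)
    have qW': "\<psi> (?q s) \<in> par W" "expo s (\<psi> (?q s)) \<noteq> 0" if "s \<in> S" for s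
      using that H(3)[OF that] Hc qW d(1) par_subgroup[OF WV]
      by (auto simp: \<psi>.hom_int_pow subgroup_int_pow_closed)
    show thesis
      by (rule that(2)[of g I' ?p \<theta>' ?q])
        (use g I' ab(2) d(2) pU' qW' H m(1) in
          \<open>auto intro!: subgroup.m_closed[OF H(1)] Z.subgroup_int_pow_closed[OF H(1)]\<close>)
  qed
qed

text \<open>Induction on \<open>card U\<close>, removing a vertex \<open>z\<close> outside the
  clique \<open>W\<close>; for \<open>U = W\<close> the rank bound applies. Composing
  \<open>\<psi>\<close> with a retraction shrinks \<open>U\<close> to \<open>U - {z}\<close> or to
  its part in \<open>link z\<close>, and in the latter case \<open>z\<close> is added to the clique
  found. \<open>H\<close> shrinks as well, because the composite is injective only where elements
  are conjugate into the smaller parabolic subgroup.\<close>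

lemma clique_extension:
  assumes "comm_group Z"
    and "\<psi> \<in> hom Z G" "U \<subseteq> V" "W \<subseteq> U" "clique W" "S \<subseteq> W" "finite I" "dual_family Z I p \<theta>"
    and "subgroup H Z" "\<And>i. i \<in> I \<Longrightarrow> p i \<in> H" "\<And>s. s \<in> S \<Longrightarrow> q s \<in> H"
      "\<And>x. x \<in> H \<Longrightarrow> \<psi> x = \<one> \<Longrightarrow> x = \<one>\<^bsub>Z\<^esub>"
    and "\<And>i. i \<in> I \<Longrightarrow> \<psi> (p i) \<in> par U"
    and "\<And>s. s \<in> S \<Longrightarrow> \<psi> (q s) \<in> par W" "\<And>s. s \<in> S \<Longrightarrow> expo s (\<psi> (q s)) \<noteq> 0"
  shows "\<exists>K. S \<subseteq> K \<and> K \<subseteq> U \<and> clique K \<and> card I \<le> card K"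
  using assms(2-)
proof (induction "card U" arbitrary: U W I p \<theta> q \<psi> H rule: less_induct)
  case less
  interpret Z: comm_group Z by fact
  interpret \<psi>: group_hom Z G \<psi>
    by (simp add: group_hom_def group_hom_axioms_def less.prems(1) is_group Z.is_group)
  note prems = less.prems
  have finU: "finite U" using prems(2) by (rule finite_sub_V)
  have H: "x \<in> carrier Z" if "x \<in> H" for x using that prems(8) subgroup.mem_carrier by metis
  have tail: "retract T \<circ> \<psi> \<in> hom Z G" "subgroup (generate Z B) Z"
    "\<And>x. x \<in> generate Z B \<Longrightarrow> (retract T \<circ> \<psi>) x = \<one> \<Longrightarrow> x = \<one>\<^bsub>Z\<^esub>"
    if T: "T \<subseteq> V" "g \<in> carrier G" and B: "B \<subseteq> H" "\<And>x. x \<in> B \<Longrightarrow> inv g \<otimes> \<psi> x \<otimes> g \<in> par T" for T g B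
  proof -
    show "retract T \<circ> \<psi> \<in> hom Z G" by (rule Group.hom_compose[OF \<psi>.homh retract_hom])
    have Bc: "B \<subseteq> carrier Z" using B H by auto
    then show "subgroup (generate Z B) Z" by (rule Z.generate_is_subgroup)
    fix x assume x: "x \<in> generate Z B" "(retract T \<circ> \<psi>) x = \<one>"
    have "\<psi> x \<in> {y \<in> carrier G. inv g \<otimes> y \<otimes> g \<in> par T}"
      by (rule Z.hom_generate_into[OF is_group \<psi>.homh subgroup_conj_par[OF T(2,1)] Bc _ x(1)])
        (use B Bc in auto)
    then have "\<psi> x = \<one>" using retract_conj_injective[OF T] x(2) by simp
    moreover have "generate Z B \<subseteq> H" by (rule Z.generate_subgroup_incl[OF B(1) prems(8)])
    ultimately show "x = \<one>\<^bsub>Z\<^esub>" using x(1) prems(11) by blast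
  qed
  show ?case
  proof (cases "U = W")
    case True
    have "card I \<le> card W"
      by (rule clique_rank[OF assms(1) prems(1,8,11,4,6,7,9)]) (use prems True in auto)
    then show ?thesis using prems True by blast
  next
    case False
    then obtain z where z: "z \<in> U" "z \<notin> W" using prems(3) by blast
    then have zV: "z \<in> V" using prems(2) by auto
    show ?thesis
    proof (rule clique_extension_step[OF assms(1) prems(1) z(1) prems(2) z(2) prems(3-14)])
      fix g assume g: "g \<in> carrier G"
        "\<And>i. i \<in> I \<Longrightarrow> inv g \<otimes> \<psi> (p i) \<otimes> g \<in> par (V - {z})"
        "\<And>s. s \<in> S \<Longrightarrow> inv g \<otimes> \<psi> (q s) \<otimes> g \<in> par (V - {z})"
      let ?B = "p ` I \<union> q ` S"
      have t: "V - {z} \<subseteq> V" "?B \<subseteq> H" "\<And>x. x \<in> ?B \<Longrightarrow> inv g \<otimes> \<psi> x \<otimes> g \<in> par (V - {z})"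
        using g prems(9,10) by auto
      note tl = tail[OF t(1) g(1) t(2,3)]
      have W: "W \<subseteq> V - {z}" using prems z by auto
      have qW: "(retract (V - {z}) \<circ> \<psi>) (q s) = \<psi> (q s)" if "s \<in> S" for s
        using retract_id[OF _ W prems(13)[OF that]] prems(2,3) by auto
      have "\<exists>K. S \<subseteq> K \<and> K \<subseteq> U - {z} \<and> clique K \<and> card I \<le> card K"
      proof (rule less.hyps[OF _ tl(1) _ _ prems(4,5,6,7) tl(2) _ _ tl(3)])
        show "card (U - {z}) < card U" using z finU by (metis card_Diff1_less)
        show "(retract (V - {z}) \<circ> \<psi>) (p i) \<in> par (U - {z})" if "i \<in> I" for i
        proof -
          have "(V - {z}) \<inter> U = U - {z}" using prems(2) by auto
          then show ?thesis using retract_par[OF prems(2) prems(12)[OF that], of "V - {z}"] by simp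
        qed
      qed (use prems z qW in \<open>auto intro: generate.incl\<close>)
      then show ?thesis by blast
    next
      fix g I' p' \<theta>' q'
      assume g: "g \<in> carrier G" and I': "I' \<subseteq> I" "card I \<le> Suc (card I')" "dual_family Z I' p' \<theta>'"
        and H': "\<And>i. i \<in> I' \<Longrightarrow> p' i \<in> H" "\<And>s. s \<in> S \<Longrightarrow> q' s \<in> H"
        and link: "\<And>i. i \<in> I' \<Longrightarrow> inv g \<otimes> \<psi> (p' i) \<otimes> g \<in> par (link z)"
          "\<And>s. s \<in> S \<Longrightarrow> inv g \<otimes> \<psi> (q' s) \<otimes> g \<in> par (link z)"
        and pU: "\<And>i. i \<in> I' \<Longrightarrow> \<psi> (p' i) \<in> par U"
        and qW: "\<And>s. s \<in> S \<Longrightarrow> \<psi> (q' s) \<in> par W" "\<And>s. s \<in> S \<Longrightarrow> expo s (\<psi> (q' s)) \<noteq> 0"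
      let ?B = "p' ` I' \<union> q' ` S"
      have t: "?B \<subseteq> H" "\<And>x. x \<in> ?B \<Longrightarrow> inv g \<otimes> \<psi> x \<otimes> g \<in> par (link z)"
        using link H' by auto
      note tl = tail[OF link_sub g t]
      \<comment> \<open>Exponent sums ignore conjugation, so a nonzero exponent at \<open>s\<close>
        forces \<open>s\<close> into \<open>link z\<close>.\<close>
      have Slink: "s \<in> link z" if s: "s \<in> S" for s
      proof (rule ccontr)
        assume "s \<notin> link z"
        then have "expo s (inv g \<otimes> \<psi> (q' s) \<otimes> g) = 0"
          using expo_par[OF link_sub link(2)[OF s]] by simp
        then show False using qW(2)[OF s] g H H'(2)[OF s] by simp
      qed
      have "\<exists>K. S \<subseteq> K \<and> K \<subseteq> link z \<inter> U \<and> clique K \<and> card I' \<le> card K"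
      proof (rule less.hyps[OF _ tl(1) _ _ _ _ _ I'(3) tl(2) _ _ tl(3)])
        have "link z \<inter> U \<subset> U" using z(1) not_in_link[of z] by blast
        then show "card (link z \<inter> U) < card U" using finU by (rule psubset_card_mono[rotated])
        show "clique (link z \<inter> W)" using prems(4) by (rule clique_subset) auto
        show "finite I'" using I'(1) prems(6) finite_subset by blast
        show "(retract (link z) \<circ> \<psi>) (p' i) \<in> par (link z \<inter> U)" if "i \<in> I'" for i
          using retract_par[OF prems(2) pU[OF that]] by simp
        show "(retract (link z) \<circ> \<psi>) (q' s) \<in> par (link z \<inter> W)" if "s \<in> S" for s
          using retract_par[OF _ qW(1)[OF that]] prems(2,3) by auto
        show "expo s ((retract (link z) \<circ> \<psi>) (q' s)) \<noteq> 0" if "s \<in> S" for s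
          using qW(2)[OF that] Slink[OF that] H H'(2)[OF that] by (simp add: expo_retract)
      qed (use prems(2,3,5) Slink in \<open>auto intro: generate.incl\<close>)
      then obtain K where K: "S \<subseteq> K" "K \<subseteq> link z \<inter> U" "clique K" "card I' \<le> card K" by blast
      have "clique (insert z K)"
        using K zV R_sym by (auto simp: clique_def link_def)
      moreover have "card (insert z K) = Suc (card K)"
        using K(2) finU by (intro card_insert_disjoint) (auto intro: finite_subset)
      ultimately show ?thesis using K z I'(2) by (intro exI[of _ "insert z K"]) auto
    qed
  qed
qed

end

section \<open>Transfer of separating cliques\<close>

text \<open>The subgroup may fail to be normal. Pigeonhole on the cosets of the powers of
  \<open>g\<close> gives an exponent that depends on \<open>g\<close> but is at most the index; the
  factorial is a common multiple.\<close>

lemma (in group) finite_index_powers: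
  assumes "finite_index_subgroup H G"
  obtains k :: nat where "k > 0" "\<And>g. g \<in> carrier G \<Longrightarrow> g [^] k \<in> H"
proof -
  have H: "subgroup H G" "finite (rcosets H)" using assms by (auto simp: finite_index_subgroup_def)
  interpret H: subgroup H G by (rule H)
  let ?n = "card (rcosets H)"
  have "g [^] (fact ?n :: nat) \<in> H" if g: "g \<in> carrier G" for g
  proof -
    let ?f = "\<lambda>i::nat. H #> g [^] i"
    have "?f ` {..?n} \<subseteq> rcosets H" using g by (auto simp: RCOSETS_def)
    then have "card (?f ` {..?n}) \<le> ?n" by (rule card_mono[OF H(2)])
    then have "\<not> inj_on ?f {..?n}" using card_image by fastforce
    then obtain i j where ij: "i \<le> ?n" "j \<le> ?n" "?f i = ?f j" "i < j"
      unfolding inj_on_def by (metis atMost_iff nat_neq_iff)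
    have "g [^] j = g [^] (j - i) \<otimes> g [^] i" using g ij by (simp add: nat_pow_mult)
    moreover have "g [^] j \<in> H #> g [^] i"
      using ij g by (metis H(1) nat_pow_closed rcos_self)
    then obtain h where "h \<in> H" "g [^] j = h \<otimes> g [^] i" by (auto simp: r_coset_def)
    ultimately have "g [^] (j - i) \<in> H" using g by simp
    moreover have "(j - i) dvd (fact ?n :: nat)" using ij by (intro dvd_fact) auto
    then obtain c where "(fact ?n :: nat) = (j - i) * c" by (auto simp: dvd_def)
    ultimately show ?thesis
      using g subgroup_int_pow_closed[OF H(1), of "g [^] (j - i)" "int c"]
      by (simp add: nat_pow_pow int_pow_int)
  qed
  then show thesis using that[of "fact ?n"] by simp
qed

text \<open>\<open>C\<close> stands for a union of some but not all components of the complement of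
  \<open>S\<close>, which spares any notion of path.\<close>

definition (in artin_group) separating :: "'v set \<Rightarrow> bool" where
  "separating S \<longleftrightarrow> S \<subseteq> V \<and> (\<exists>C \<subseteq> V - S. C \<noteq> {} \<and> V - S - C \<noteq> {} \<and>
     (\<forall>u\<in>C. \<forall>v\<in>V - S - C. (u, v) \<notin> R))"

lemma (in artin_group) separating_link:
  assumes "v \<in> V" "V \<noteq> insert v (link v)"
  shows "separating (link v)"
  unfolding separating_def
  by (intro conjI exI[of _ "{v}"]) (use assms link_sub R_irrefl in \<open>auto simp: link_def\<close>)

text \<open>\<open>\<phi>\<close> runs from the second group to the first, so that \<open>H2\<close>
  acts on the tree of the splitting of \<open>G1\<close>. The exponent \<open>k\<close> serves both
  groups, \<open>A1.S\<close> is the separating subclique of \<open>K1\<close>, and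
  \<open>sides\<close> makes the splitting proper.\<close>

locale artin_commensuration =
  A1: artin_amalgam V1 R1 G1 P + A2: artin_group V2 R2 G2
  for V1 :: "'v set" and R1 G1 P and V2 :: "'w set" and R2 G2 +
  fixes H1 H2 \<phi> K1 and k :: nat
  assumes H1: "subgroup H1 G1" and H2: "subgroup H2 G2"
    and \<phi>: "\<phi> \<in> iso (G2\<lparr>carrier := H2\<rparr>) (G1\<lparr>carrier := H1\<rparr>)"
    and k: "k > 0" "\<And>g. g \<in> carrier G1 \<Longrightarrow> g [^]\<^bsub>G1\<^esub> k \<in> H1" "\<And>g. g \<in> carrier G2 \<Longrightarrow> g [^]\<^bsub>G2\<^esub> k \<in> H2"
    and K1: "A1.clique K1" "A1.S \<subseteq> K1"
    and sides: "P t - P (\<not> t) \<noteq> {}"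
begin

interpretation D: group "G2\<lparr>carrier := H2\<rparr>"
  by (rule A2.subgroup_imp_group[OF H2])

interpretation E: group "G1\<lparr>carrier := H1\<rparr>"
  by (rule A1.subgroup_imp_group[OF H1])

lemma \<phi>_hom: "\<phi> \<in> hom (G2\<lparr>carrier := H2\<rparr>) G1"
  using \<phi> subgroup.mem_carrier[OF H1] by (auto simp: iso_def hom_def)

interpretation \<phi>: group_hom "G2\<lparr>carrier := H2\<rparr>" G1 \<phi>
  by (simp add: group_hom_def group_hom_axioms_def \<phi>_hom D.is_group A1.is_group)

lemma \<phi>_closed: "x \<in> H2 \<Longrightarrow> \<phi> x \<in> carrier G1"
  using \<phi>.hom_closed by simp

lemma \<phi>_inj: "x \<in> H2 \<Longrightarrow> y \<in> H2 \<Longrightarrow> \<phi> x = \<phi> y \<Longrightarrow> x = y"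
  using \<phi> by (auto simp: iso_def bij_betw_def inj_on_def)

lemma \<phi>_surj: "y \<in> H1 \<Longrightarrow> \<exists>x\<in>H2. \<phi> x = y"
  using \<phi> by (auto simp: iso_def bij_betw_def)

lemma \<phi>_mult: "x \<in> H2 \<Longrightarrow> y \<in> H2 \<Longrightarrow> \<phi> (x \<otimes>\<^bsub>G2\<^esub> y) = \<phi> x \<otimes>\<^bsub>G1\<^esub> \<phi> y"
  using \<phi>.hom_mult[of x y] by simp

lemma \<phi>_one: "\<phi> \<one>\<^bsub>G2\<^esub> = \<one>\<^bsub>G1\<^esub>"
  using \<phi>.hom_one by simp

lemma \<phi>_inv: "x \<in> H2 \<Longrightarrow> \<phi> (inv\<^bsub>G2\<^esub> x) = inv\<^bsub>G1\<^esub> \<phi> x"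
  using \<phi>.hom_inv[of x] A2.m_inv_consistent[OF H2, of x] by simp

lemma \<phi>_int_pow: "x \<in> H2 \<Longrightarrow> \<phi> (x [^]\<^bsub>G2\<^esub> (i::int)) = \<phi> x [^]\<^bsub>G1\<^esub> i"
  using \<phi>.hom_int_pow[of x i] A2.int_pow_consistent[OF H2, of x i] by simp

lemma H2_closed: "x \<in> H2 \<Longrightarrow> x \<in> carrier G2"
  by (rule subgroup.mem_carrier[OF H2])

lemmas H2_intros = subgroup.m_closed[OF H2] subgroup.m_inv_closed[OF H2]
  A2.subgroup_int_pow_closed[OF H2] subgroup.one_closed[OF H2]

lemma \<phi>_commute_iff: "x \<in> H2 \<Longrightarrow> y \<in> H2 \<Longrightarrow> \<phi> x \<otimes>\<^bsub>G1\<^esub> \<phi> y = \<phi> y \<otimes>\<^bsub>G1\<^esub> \<phi> x \<longleftrightarrow> x \<otimes>\<^bsub>G2\<^esub> y = y \<otimes>\<^bsub>G2\<^esub> x"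
  using \<phi>_inj[of "x \<otimes>\<^bsub>G2\<^esub> y" "y \<otimes>\<^bsub>G2\<^esub> x"] by (auto simp: H2_intros simp flip: \<phi>_mult)

definition Q where "Q = {d \<in> H2. \<phi> d \<in> A1.par K1}"

lemma K1_sub: "K1 \<subseteq> V1"
  using K1 by (simp add: A1.clique_def)

lemma par_S_sub_K1: "A1.par A1.S \<subseteq> A1.par K1"
  by (rule A1.par_mono[OF K1(2)])

lemma Q_subgroup: "subgroup Q G2"
proof -
  interpret K: subgroup "A1.par K1" G1 by (rule A1.par_subgroup[OF K1_sub])
  show ?thesis
    unfolding Q_def
    by (rule A2.subgroupI)
      (auto simp: H2_intros H2_closed \<phi>_mult \<phi>_inv \<phi>_one intro!: exI[of _ "\<one>\<^bsub>G2\<^esub>"])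
qed

lemma Q_commute: "x \<in> Q \<Longrightarrow> y \<in> Q \<Longrightarrow> x \<otimes>\<^bsub>G2\<^esub> y = y \<otimes>\<^bsub>G2\<^esub> x"
  using A1.par_clique_commute[OF K1(1)] by (auto simp: Q_def simp flip: \<phi>_commute_iff)

lemma Q_comm_group: "comm_group (G2\<lparr>carrier := Q\<rparr>)"
  by (rule group.group_comm_groupI[OF A2.subgroup_imp_group[OF Q_subgroup]]) (simp add: Q_commute)

lemma \<phi>_hom_Q: "\<phi> \<in> hom (G2\<lparr>carrier := Q\<rparr>) G1"
  by (rule homI) (auto simp: Q_def \<phi>_closed \<phi>_mult)

text \<open>The group \<open>Q\<close> is abelian of rank \<open>card K1\<close>, which controls the size of the new clique from
  both sides.\<close>

lemma separating_clique_transfer: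
  assumes "g \<in> carrier G2" "A2.clique W" "S \<subseteq> W" "A2.separating S"
    and q: "\<And>s. s \<in> S \<Longrightarrow> q s \<in> A2.par W"
      "\<And>s s'. s \<in> S \<Longrightarrow> s' \<in> S \<Longrightarrow> A2.expo s (q s') \<noteq> 0 \<longleftrightarrow> s = s'"
      "\<And>s. s \<in> S \<Longrightarrow> g \<otimes>\<^bsub>G2\<^esub> q s \<otimes>\<^bsub>G2\<^esub> inv\<^bsub>G2\<^esub> g \<in> H2"
      "\<And>s. s \<in> S \<Longrightarrow> \<phi> (g \<otimes>\<^bsub>G2\<^esub> q s \<otimes>\<^bsub>G2\<^esub> inv\<^bsub>G2\<^esub> g) \<in> A1.par A1.S"
  shows "\<exists>K S. A2.clique K \<and> S \<subseteq> K \<and> card K = card K1 \<and> A2.separating S"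
proof -
  let ?Z = "G2\<lparr>carrier := Q\<rparr>"
  interpret Z: comm_group ?Z by (rule Q_comm_group)
  have WV: "W \<subseteq> V2" "S \<subseteq> V2" using assms(2,3) by (auto simp: A2.clique_def)
  have Qc: "d \<in> carrier G2" if "d \<in> Q" for d using that subgroup.mem_carrier[OF Q_subgroup] by auto
  have Q_self: "subgroup Q ?Z" using Z.subgroup_self by simp
  define \<psi> where "\<psi> d = inv\<^bsub>G2\<^esub> g \<otimes>\<^bsub>G2\<^esub> d \<otimes>\<^bsub>G2\<^esub> g" for d
  have \<psi>: "\<psi> \<in> hom ?Z G2"
    by (rule homI) (use assms(1) Qc in \<open>auto simp: \<psi>_def A2.inv_conj_mult\<close>)
  have \<psi>_inj: "d = \<one>\<^bsub>?Z\<^esub>" if "d \<in> Q" "\<psi> d = \<one>\<^bsub>G2\<^esub>" for d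
    using that A2.inv_conj_eq_one_iff[OF assms(1) Qc[OF that(1)]] by (simp add: \<psi>_def)
  define q' where "q' s = g \<otimes>\<^bsub>G2\<^esub> q s \<otimes>\<^bsub>G2\<^esub> inv\<^bsub>G2\<^esub> g" for s
  have q'Q: "q' s \<in> Q" if "s \<in> S" for s
    using q(3,4)[OF that] par_S_sub_K1 by (auto simp: q'_def Q_def)
  have \<psi>q': "\<psi> (q' s) = q s" if "s \<in> S" for s
    using assms(1) A2.par_closed[OF WV(1) q(1)[OF that]]
    by (simp add: \<psi>_def q'_def A2.m_assoc)
  have pk: "A1.gen u [^]\<^bsub>G1\<^esub> k \<in> H1" if "u \<in> K1" for u
    using that K1_sub by (intro k) auto
  \<comment> \<open>Preimages of the \<open>k\<close>-th powers of the generators of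
    \<open>K1\<close>. Exponent sums pulled back along \<open>\<phi>\<close> are dual to them, so
    \<open>Q\<close> has rank at least \<open>card K1\<close>.\<close>
  define p where "p u = inv_into H2 \<phi> (A1.gen u [^]\<^bsub>G1\<^esub> k)" for u
  have p: "p u \<in> H2" "\<phi> (p u) = A1.gen u [^]\<^bsub>G1\<^esub> k" if "u \<in> K1" for u
  proof -
    have "A1.gen u [^]\<^bsub>G1\<^esub> k \<in> \<phi> ` H2" using \<phi>_surj[OF pk[OF that]] by auto
    then show "p u \<in> H2" "\<phi> (p u) = A1.gen u [^]\<^bsub>G1\<^esub> k"
      unfolding p_def by (rule inv_into_into, rule f_inv_into_f)
  qed
  have pQ: "p u \<in> Q" if "u \<in> K1" for u
  proof -
    have "A1.gen u [^]\<^bsub>G1\<^esub> int k \<in> A1.par K1"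
      by (intro A1.subgroup_int_pow_closed A1.par_subgroup K1_sub A1.gen_in_par that)
    then show ?thesis using p[OF that] by (simp add: Q_def int_pow_int)
  qed
  have dual: "dual_family ?Z K1 p (\<lambda>u. A1.expo u \<circ> \<phi>)"
  proof -
    have "A1.expo u \<circ> \<phi> \<in> hom ?Z integer_group" for u
      by (rule Group.hom_compose[OF \<phi>_hom_Q A1.expo_hom])
    moreover have "A1.expo u (\<phi> (p v)) \<noteq> 0 \<longleftrightarrow> u = v" if "u \<in> K1" "v \<in> K1" for u v
      using that p k(1) K1_sub by (auto simp: A1.expo_gen subset_iff split: if_splits)
    ultimately show ?thesis using pQ by (simp add: dual_family_def)
  qed
  have fin: "finite K1" "finite S"
    using K1_sub A1.finite_sub_V A2.finite_sub_V WV by auto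
  have "\<exists>K. S \<subseteq> K \<and> K \<subseteq> V2 \<and> A2.clique K \<and> card K1 \<le> card K"
  proof (rule A2.clique_extension[OF Q_comm_group \<psi> order_refl WV(1) assms(2,3) fin(1) dual Q_self])
    show "\<psi> (p u) \<in> A2.par V2" if "u \<in> K1" for u
      using hom_in_carrier[OF \<psi>, of "p u"] pQ[OF that] by (simp add: A2.par_V)
    show "A2.expo s (\<psi> (q' s)) \<noteq> 0" if "s \<in> S" for s
      using \<psi>q'[OF that] q(2)[OF that that] by simp
  qed (use pQ q'Q \<psi>_inj \<psi>q' q(1) in auto)
  then obtain K where K: "S \<subseteq> K" "A2.clique K" "card K1 \<le> card K" by blast
  \<comment> \<open>Conversely \<open>\<phi>\<close> maps the marking elements into
    \<open>par K1\<close>, whose rank bounds \<open>card S\<close>; so a clique of exactly the right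
    size fits between \<open>S\<close> and \<open>K\<close>.\<close>
  have "card S \<le> card K1"
  proof (rule A1.clique_rank[OF Q_comm_group \<phi>_hom_Q Q_self _ K1(1) fin(2)])
    show "d = \<one>\<^bsub>?Z\<^esub>" if "d \<in> Q" "\<phi> d = \<one>\<^bsub>G1\<^esub>" for d
      using that \<phi>_inj[of d "\<one>\<^bsub>G2\<^esub>"] by (simp add: Q_def \<phi>_one H2_intros)
    have "A2.expo s \<circ> \<psi> \<in> hom ?Z integer_group" for s
      by (rule Group.hom_compose[OF \<psi> A2.expo_hom])
    then show "dual_family ?Z S q' (\<lambda>s. A2.expo s \<circ> \<psi>)"
      using q'Q \<psi>q' q(2) by (simp add: dual_family_def)
    show "q' s \<in> Q" "\<phi> (q' s) \<in> A1.par K1" if "s \<in> S" for s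
      using q'Q[OF that] by (auto simp: Q_def)
  qed
  moreover have "finite K" using K(2) A2.finite_sub_V by (simp add: A2.clique_def)
  ultimately obtain L where L: "S \<subseteq> L" "L \<subseteq> K" "card L = card K1"
    using exists_subset_between[of S "card K1" K] K by blast
  then show ?thesis using A2.clique_subset[OF K(2) L(2)] assms(4) by blast
qed

text \<open>A complete \<open>V2\<close> would make \<open>G2\<close> and hence \<open>H1\<close>
  commutative, but nontrivial powers of generators from strictly opposite sides of the splitting
  never commute.\<close>

lemma V2_not_clique: "\<not> A2.clique V2"
proof
  assume c: "A2.clique V2"
  obtain a b where ab: "a \<in> P True" "a \<notin> P False" "b \<in> P False" "b \<notin> P True"
    using sides[of True] sides[of False] by auto
  have V: "a \<in> V1" "b \<in> V1" using ab A1.P_sub by blast+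
  obtain x y where xy: "x \<in> H2" "y \<in> H2" "\<phi> x = A1.gen a [^]\<^bsub>G1\<^esub> k" "\<phi> y = A1.gen b [^]\<^bsub>G1\<^esub> k"
    using \<phi>_surj[OF k(2)] V by (metis A1.gen_closed)
  have "x \<otimes>\<^bsub>G2\<^esub> y = y \<otimes>\<^bsub>G2\<^esub> x"
    using A2.par_clique_commute[OF c] xy H2_closed by (simp add: A2.par_V)
  then have "\<phi> x \<otimes>\<^bsub>G1\<^esub> \<phi> y = \<phi> y \<otimes>\<^bsub>G1\<^esub> \<phi> x" by (rule iffD2[OF \<phi>_commute_iff[OF xy(1,2)]])
  moreover have "A1.ends (\<phi> x) True True" "A1.ends (\<phi> y) (\<not> True) (\<not> True)"
    using A1.ends_gen_pow[of a True "int k"] A1.ends_gen_pow[of b False "int k"] ab k(1) xy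
    by (auto simp: int_pow_int)
  ultimately show False using A1.ends_opposite_not_commute by blast
qed

definition conj_pow where "conj_pow g v = g \<otimes>\<^bsub>G2\<^esub> (A2.gen v [^]\<^bsub>G2\<^esub> int k) \<otimes>\<^bsub>G2\<^esub> inv\<^bsub>G2\<^esub> g"

lemma conj_int_pow:
  "g \<in> carrier G2 \<Longrightarrow> y \<in> carrier G2 \<Longrightarrow> (g \<otimes>\<^bsub>G2\<^esub> y \<otimes>\<^bsub>G2\<^esub> inv\<^bsub>G2\<^esub> g) [^]\<^bsub>G2\<^esub> (i::int) = g \<otimes>\<^bsub>G2\<^esub> (y [^]\<^bsub>G2\<^esub> i) \<otimes>\<^bsub>G2\<^esub> inv\<^bsub>G2\<^esub> g"
  using A2.inv_conj_int_pow[of "inv\<^bsub>G2\<^esub> g" y i] by simp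

lemma conj_mult:
  "\<lbrakk>g \<in> carrier G2; y \<in> carrier G2; z \<in> carrier G2\<rbrakk> \<Longrightarrow>
    (g \<otimes>\<^bsub>G2\<^esub> y \<otimes>\<^bsub>G2\<^esub> inv\<^bsub>G2\<^esub> g) \<otimes>\<^bsub>G2\<^esub> (g \<otimes>\<^bsub>G2\<^esub> z \<otimes>\<^bsub>G2\<^esub> inv\<^bsub>G2\<^esub> g) = g \<otimes>\<^bsub>G2\<^esub> (y \<otimes>\<^bsub>G2\<^esub> z) \<otimes>\<^bsub>G2\<^esub> inv\<^bsub>G2\<^esub> g"
  using A2.inv_conj_mult[of "inv\<^bsub>G2\<^esub> g" y z] by simp

lemma conj_inj:
  assumes "g \<in> carrier G2" "y \<in> carrier G2" "z \<in> carrier G2" "g \<otimes>\<^bsub>G2\<^esub> y \<otimes>\<^bsub>G2\<^esub> inv\<^bsub>G2\<^esub> g = g \<otimes>\<^bsub>G2\<^esub> z \<otimes>\<^bsub>G2\<^esub> inv\<^bsub>G2\<^esub> g"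
  shows "y = z"
proof -
  have "inv\<^bsub>G2\<^esub> g \<otimes>\<^bsub>G2\<^esub> (g \<otimes>\<^bsub>G2\<^esub> y \<otimes>\<^bsub>G2\<^esub> inv\<^bsub>G2\<^esub> g) \<otimes>\<^bsub>G2\<^esub> g = inv\<^bsub>G2\<^esub> g \<otimes>\<^bsub>G2\<^esub> (g \<otimes>\<^bsub>G2\<^esub> z \<otimes>\<^bsub>G2\<^esub> inv\<^bsub>G2\<^esub> g) \<otimes>\<^bsub>G2\<^esub> g"
    by (simp only: assms(4))
  then show ?thesis using assms(1-3) by (simp add: A2.m_assoc)
qed

lemma conj_pow_in_H2:
  assumes "g \<in> carrier G2" "v \<in> V2" shows "conj_pow g v \<in> H2"
proof -
  have "conj_pow g v = (g \<otimes>\<^bsub>G2\<^esub> A2.gen v \<otimes>\<^bsub>G2\<^esub> inv\<^bsub>G2\<^esub> g) [^]\<^bsub>G2\<^esub> k"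
    unfolding conj_pow_def int_pow_int[symmetric] using assms by (simp add: conj_int_pow)
  then show ?thesis using k(3) assms by simp
qed

lemma conj_pow_commute:
  assumes "g \<in> carrier G2" "(u, v) \<in> R2" shows "conj_pow g u \<otimes>\<^bsub>G2\<^esub> conj_pow g v = conj_pow g v \<otimes>\<^bsub>G2\<^esub> conj_pow g u"
proof -
  have "u \<in> V2" "v \<in> V2" using A2.R_in_V[OF assms(2)] by auto
  then show ?thesis
    using assms A2.commute_int_pow_int_pow[OF _ _ A2.gen_comm[OF assms(2)], of "int k" "int k"]
    by (simp add: conj_pow_def conj_mult)
qed

lemma conj_pow_commuteD:
  assumes "g \<in> carrier G2" "u \<in> V2" "v \<in> V2" "conj_pow g u \<otimes>\<^bsub>G2\<^esub> conj_pow g v = conj_pow g v \<otimes>\<^bsub>G2\<^esub> conj_pow g u" "u \<noteq> v"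
  shows "(u, v) \<in> R2"
proof -
  have "A2.gen u [^]\<^bsub>G2\<^esub> int k \<otimes>\<^bsub>G2\<^esub> A2.gen v [^]\<^bsub>G2\<^esub> int k = A2.gen v [^]\<^bsub>G2\<^esub> int k \<otimes>\<^bsub>G2\<^esub> A2.gen u [^]\<^bsub>G2\<^esub> int k"
    using conj_inj[OF assms(1)] assms by (simp add: conj_pow_def conj_mult)
  then show ?thesis using A2.commuting_powers[OF assms(2,3), of "int k" "int k"] k(1) assms(5) by auto
qed

lemma par_S_commute: "y \<in> A1.par A1.S \<Longrightarrow> z \<in> A1.par A1.S \<Longrightarrow> y \<otimes>\<^bsub>G1\<^esub> z = z \<otimes>\<^bsub>G1\<^esub> y"
  using A1.par_clique_commute[OF K1(1)] par_S_sub_K1 by auto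

lemma axis_case:
  assumes g: "g \<in> carrier G2" and v: "v \<in> V2" and e: "A1.ends (\<phi> (conj_pow g v)) t (\<not> t)"
  shows "\<exists>K S. A2.clique K \<and> S \<subseteq> K \<and> card K = card K1 \<and> A2.separating S"
proof -
  have "\<exists>j b. j > (0::nat) \<and> \<phi> (conj_pow g u [^]\<^bsub>G2\<^esub> int j \<otimes>\<^bsub>G2\<^esub> conj_pow g v [^]\<^bsub>G2\<^esub> (b::int)) \<in> A1.par A1.S"
    if u: "u \<in> A2.link v" for u
  proof -
    have uV: "u \<in> V2" "(v, u) \<in> R2" using u A2.link_sub by (auto simp: A2.link_def)
    have "\<phi> (conj_pow g v) \<otimes>\<^bsub>G1\<^esub> \<phi> (conj_pow g u) = \<phi> (conj_pow g u) \<otimes>\<^bsub>G1\<^esub> \<phi> (conj_pow g v)"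
      using conj_pow_commute[OF g uV(2)] conj_pow_in_H2[OF g] uV v by (simp add: \<phi>_commute_iff)
    then obtain j :: nat and b :: int where
      "j > 0" "\<phi> (conj_pow g u) [^]\<^bsub>G1\<^esub> int j \<otimes>\<^bsub>G1\<^esub> \<phi> (conj_pow g v) [^]\<^bsub>G1\<^esub> b \<in> A1.par A1.S"
      using A1.centralizer_axis[OF e] \<phi>_closed[OF conj_pow_in_H2[OF g uV(1)]] by metis
    then show ?thesis
      using conj_pow_in_H2[OF g] uV v by (auto simp: \<phi>_mult \<phi>_int_pow H2_intros)
  qed
  then obtain j b where jb: "\<And>u. u \<in> A2.link v \<Longrightarrow> j u > (0::nat)"
    "\<And>u. u \<in> A2.link v \<Longrightarrow> \<phi> (conj_pow g u [^]\<^bsub>G2\<^esub> int (j u) \<otimes>\<^bsub>G2\<^esub> conj_pow g v [^]\<^bsub>G2\<^esub> (b u :: int)) \<in> A1.par A1.S" by metis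
  \<comment> \<open>These exponents make \<open>g \<otimes> q u \<otimes> inv g\<close> the element
    just found; the factor \<open>k\<close> comes from \<open>conj_pow\<close>.\<close>
  define i where "i u = int k * int (j u)" for u
  define c where "c u = int k * b u" for u
  define q where "q u = A2.gen u [^]\<^bsub>G2\<^esub> i u \<otimes>\<^bsub>G2\<^esub> A2.gen v [^]\<^bsub>G2\<^esub> c u" for u
  have V: "u \<in> V2" "A2.gen u \<in> carrier G2" "(u, v) \<in> R2" if "u \<in> A2.link v" for u
    using that A2.link_sub A2.R_sym by (auto simp: A2.link_def)
  have gv: "A2.gen v \<in> carrier G2" using v by simp
  have q_conj: "g \<otimes>\<^bsub>G2\<^esub> q u \<otimes>\<^bsub>G2\<^esub> inv\<^bsub>G2\<^esub> g = conj_pow g u [^]\<^bsub>G2\<^esub> int (j u) \<otimes>\<^bsub>G2\<^esub> conj_pow g v [^]\<^bsub>G2\<^esub> b u" if "u \<in> A2.link v" for u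
    using V[OF that] gv g
    by (simp add: q_def conj_pow_def i_def c_def conj_int_pow conj_mult A2.int_pow_pow)
  have q_H2: "g \<otimes>\<^bsub>G2\<^esub> q u \<otimes>\<^bsub>G2\<^esub> inv\<^bsub>G2\<^esub> g \<in> H2" if "u \<in> A2.link v" for u
    unfolding q_conj[OF that] by (intro H2_intros conj_pow_in_H2 g v V that)
  have q_S: "\<phi> (g \<otimes>\<^bsub>G2\<^esub> q u \<otimes>\<^bsub>G2\<^esub> inv\<^bsub>G2\<^esub> g) \<in> A1.par A1.S" if "u \<in> A2.link v" for u
    unfolding q_conj[OF that] by (rule jb(2)[OF that])
  have q_c: "q u \<in> carrier G2" if "u \<in> A2.link v" for u using V[OF that] gv by (simp add: q_def)
  have q_comm: "q u \<otimes>\<^bsub>G2\<^esub> q w = q w \<otimes>\<^bsub>G2\<^esub> q u" if "u \<in> A2.link v" "w \<in> A2.link v" for u w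
  proof -
    have "(g \<otimes>\<^bsub>G2\<^esub> q u \<otimes>\<^bsub>G2\<^esub> inv\<^bsub>G2\<^esub> g) \<otimes>\<^bsub>G2\<^esub> (g \<otimes>\<^bsub>G2\<^esub> q w \<otimes>\<^bsub>G2\<^esub> inv\<^bsub>G2\<^esub> g) = (g \<otimes>\<^bsub>G2\<^esub> q w \<otimes>\<^bsub>G2\<^esub> inv\<^bsub>G2\<^esub> g) \<otimes>\<^bsub>G2\<^esub> (g \<otimes>\<^bsub>G2\<^esub> q u \<otimes>\<^bsub>G2\<^esub> inv\<^bsub>G2\<^esub> g)"
      by (rule iffD1[OF \<phi>_commute_iff par_S_commute]) (rule q_H2 q_S that)+
    then have "g \<otimes>\<^bsub>G2\<^esub> (q u \<otimes>\<^bsub>G2\<^esub> q w) \<otimes>\<^bsub>G2\<^esub> inv\<^bsub>G2\<^esub> g = g \<otimes>\<^bsub>G2\<^esub> (q w \<otimes>\<^bsub>G2\<^esub> q u) \<otimes>\<^bsub>G2\<^esub> inv\<^bsub>G2\<^esub> g"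
      unfolding conj_mult[OF g q_c[OF that(1)] q_c[OF that(2)]]
        conj_mult[OF g q_c[OF that(2)] q_c[OF that(1)]] .
    then show ?thesis by (rule conj_inj[OF g, rotated 2]) (intro A2.m_closed q_c that)+
  qed
  \<comment> \<open>Powers of \<open>gen v\<close> commute with everything here, so cancelling them
    turns commutation of \<open>q u\<close> and \<open>q w\<close> into commutation of powers of
    \<open>gen u\<close> and \<open>gen w\<close>, which means adjacency.\<close>
  have link_clique: "(u, w) \<in> R2" if uw: "u \<in> A2.link v" "w \<in> A2.link v" "u \<noteq> w" for u w
  proof -
    define U where "U = A2.gen u [^]\<^bsub>G2\<^esub> i u"
    define W where "W = A2.gen w [^]\<^bsub>G2\<^esub> i w"
    define B where "B = A2.gen v [^]\<^bsub>G2\<^esub> c u"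
    define C where "C = A2.gen v [^]\<^bsub>G2\<^esub> c w"
    have cl: "U \<in> carrier G2" "W \<in> carrier G2" "B \<in> carrier G2" "C \<in> carrier G2"
      using V[OF uw(1)] V[OF uw(2)] gv by (auto simp: U_def W_def B_def C_def)
    have BW: "B \<otimes>\<^bsub>G2\<^esub> W = W \<otimes>\<^bsub>G2\<^esub> B"
      unfolding B_def W_def by (rule A2.commute_int_pow_int_pow[OF V(2)[OF uw(2)] gv A2.gen_comm[OF V(3)[OF uw(2)]], symmetric])
    have CU: "C \<otimes>\<^bsub>G2\<^esub> U = U \<otimes>\<^bsub>G2\<^esub> C"
      unfolding C_def U_def by (rule A2.commute_int_pow_int_pow[OF V(2)[OF uw(1)] gv A2.gen_comm[OF V(3)[OF uw(1)]], symmetric])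
    have BC: "B \<otimes>\<^bsub>G2\<^esub> C = C \<otimes>\<^bsub>G2\<^esub> B"
      unfolding B_def C_def using gv by (simp add: A2.commute_int_pow_int_pow)
    have "(U \<otimes>\<^bsub>G2\<^esub> W) \<otimes>\<^bsub>G2\<^esub> (B \<otimes>\<^bsub>G2\<^esub> C) = U \<otimes>\<^bsub>G2\<^esub> (B \<otimes>\<^bsub>G2\<^esub> W) \<otimes>\<^bsub>G2\<^esub> C" unfolding BW using cl by (simp add: A2.m_assoc)
    also have "\<dots> = q u \<otimes>\<^bsub>G2\<^esub> q w" using cl by (simp add: q_def U_def W_def B_def C_def A2.m_assoc)
    also have "\<dots> = q w \<otimes>\<^bsub>G2\<^esub> q u" by (rule q_comm[OF uw(1,2)])
    also have "\<dots> = W \<otimes>\<^bsub>G2\<^esub> (C \<otimes>\<^bsub>G2\<^esub> U) \<otimes>\<^bsub>G2\<^esub> B" using cl by (simp add: q_def U_def W_def B_def C_def A2.m_assoc)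
    also have "\<dots> = (W \<otimes>\<^bsub>G2\<^esub> U) \<otimes>\<^bsub>G2\<^esub> (B \<otimes>\<^bsub>G2\<^esub> C)" unfolding CU BC using cl by (simp add: A2.m_assoc)
    finally have "U \<otimes>\<^bsub>G2\<^esub> W = W \<otimes>\<^bsub>G2\<^esub> U" using cl by simp
    moreover have "i u \<noteq> 0" "i w \<noteq> 0" using jb(1) uw k(1) by (auto simp: i_def)
    ultimately show ?thesis
      using A2.commuting_powers[OF V(1)[OF uw(1)] V(1)[OF uw(2)]] uw(3) by (auto simp: U_def W_def)
  qed
  have W: "A2.clique (insert v (A2.link v))"
    using v V(1,3) link_clique A2.R_sym by (auto simp: A2.clique_def)
  show ?thesis
  proof (rule separating_clique_transfer[OF g W, of "A2.link v" q])
    \<comment> \<open>The star of \<open>v\<close> is a clique and \<open>V2\<close> is not, so some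
      vertex lies outside the star.\<close>
    show "A2.separating (A2.link v)"
      using W V2_not_clique v by (intro A2.separating_link) auto
    show "q s \<in> A2.par (insert v (A2.link v))" if "s \<in> A2.link v" for s
    proof -
      have sub: "subgroup (A2.par (insert v (A2.link v))) G2"
        using v A2.link_sub by (intro A2.par_subgroup) auto
      show ?thesis unfolding q_def
        by (intro subgroup.m_closed[OF sub] A2.subgroup_int_pow_closed[OF sub] A2.gen_in_par)
          (use that in auto)
    qed
    show "A2.expo s (q s') \<noteq> 0 \<longleftrightarrow> s = s'" if "s \<in> A2.link v" "s' \<in> A2.link v" for s s'
    proof -
      have "s \<noteq> v" using that(1) by auto
      then have "A2.expo s (q s') = i s' * (if s' = s then 1 else 0)"
        using V[OF that(1)] V[OF that(2)] v by (simp add: q_def A2.expo_gen)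
      then show ?thesis using jb(1)[OF that(2)] k(1) by (auto simp: i_def)
    qed
  qed (use q_H2 q_S in auto)
qed

text \<open>\<open>g\<close> ranges over all of \<open>G2\<close> although only \<open>H2\<close>
  acts on the tree, since conjugates of \<open>k\<close>-th powers by any \<open>g\<close> lie in
  \<open>H2\<close>. This makes the side of the base edge a function \<open>\<sigma>\<close> on
  \<open>G2\<close>, whose constancy can be checked by multiplying with the generators of
  \<open>G2\<close>.\<close>

lemma elliptic_case:
  assumes ell: "\<And>g v. g \<in> carrier G2 \<Longrightarrow> v \<in> V2 \<Longrightarrow>
      \<phi> (conj_pow g v) \<in> A1.par A1.S \<or> (\<exists>t. A1.ends (\<phi> (conj_pow g v)) t t)"
  shows "\<exists>K S. A2.clique K \<and> S \<subseteq> K \<and> card K = card K1 \<and> A2.separating S"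
proof (rule ccontr)
  assume none: "\<nexists>K S. A2.clique K \<and> S \<subseteq> K \<and> card K = card K1 \<and> A2.separating S"
  define C where "C g = {v \<in> V2. \<phi> (conj_pow g v) \<in> A1.par A1.S}" for g
  have C_clique: "A2.clique (C g)" if g: "g \<in> carrier G2" for g
  proof -
    have "(u, v) \<in> R2" if "u \<in> C g" "v \<in> C g" "u \<noteq> v" for u v
      using that conj_pow_commuteD[OF g, of u v] par_S_commute[of "\<phi> (conj_pow g u)" "\<phi> (conj_pow g v)"] conj_pow_in_H2[OF g]
      by (auto simp: C_def \<phi>_commute_iff)
    then show ?thesis by (auto simp: A2.clique_def C_def)
  qed
  have not_sep: "\<not> A2.separating S" if g: "g \<in> carrier G2" and S: "S \<subseteq> C g" for g S
  proof
    assume sep: "A2.separating S"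
    have "A2.clique S" by (rule A2.clique_subset[OF C_clique[OF g] S])
    then have SV: "S \<subseteq> V2" by (rule A2.clique_in_V)
    have "\<exists>K S. A2.clique K \<and> S \<subseteq> K \<and> card K = card K1 \<and> A2.separating S"
    proof (rule separating_clique_transfer[OF g \<open>A2.clique S\<close> order_refl sep])
      show "A2.gen s [^]\<^bsub>G2\<^esub> int k \<in> A2.par S" if "s \<in> S" for s
        by (intro A2.subgroup_int_pow_closed A2.par_subgroup SV A2.gen_in_par that)
      show "A2.expo s (A2.gen s' [^]\<^bsub>G2\<^esub> int k) \<noteq> 0 \<longleftrightarrow> s = s'" if "s \<in> S" "s' \<in> S" for s s'
        using that SV k(1) by (auto simp: A2.expo_gen subset_iff)
      show "g \<otimes>\<^bsub>G2\<^esub> (A2.gen s [^]\<^bsub>G2\<^esub> int k) \<otimes>\<^bsub>G2\<^esub> inv\<^bsub>G2\<^esub> g \<in> H2" if "s \<in> S" for s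
        using conj_pow_in_H2[OF g, of s] that SV by (auto simp: conj_pow_def)
      show "\<phi> (g \<otimes>\<^bsub>G2\<^esub> (A2.gen s [^]\<^bsub>G2\<^esub> int k) \<otimes>\<^bsub>G2\<^esub> inv\<^bsub>G2\<^esub> g) \<in> A1.par A1.S" if "s \<in> S" for s
        using that S by (auto simp: C_def conj_pow_def)
    qed
    then show False using none by blast
  qed
  have "\<exists>t. \<forall>v\<in>V2 - C g. A1.ends (\<phi> (conj_pow g v)) t t" if g: "g \<in> carrier G2" for g
  proof (rule ccontr)
    assume n: "\<nexists>t. \<forall>v\<in>V2 - C g. A1.ends (\<phi> (conj_pow g v)) t t"
    let ?D = "{v \<in> V2 - C g. A1.ends (\<phi> (conj_pow g v)) True True}"
    have D: "A1.ends (\<phi> (conj_pow g v)) False False" if v: "v \<in> V2 - C g - ?D" for v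
    proof -
      obtain t where t: "A1.ends (\<phi> (conj_pow g v)) t t" using ell[OF g, of v] v by (auto simp: C_def)
      then show ?thesis using v by (cases t) auto
    qed
    have D1: "?D \<noteq> {}" using D n by blast
    have D2: "V2 - C g - ?D \<noteq> {}" using n by blast
    have D3: "(u, v) \<notin> R2" if "u \<in> ?D" "v \<in> V2 - C g - ?D" for u v
    proof
      assume r: "(u, v) \<in> R2"
      have "\<phi> (conj_pow g u) \<otimes>\<^bsub>G1\<^esub> \<phi> (conj_pow g v) = \<phi> (conj_pow g v) \<otimes>\<^bsub>G1\<^esub> \<phi> (conj_pow g u)"
        using conj_pow_commute[OF g r] conj_pow_in_H2[OF g] that by (simp add: \<phi>_commute_iff)
      then show False using A1.ends_opposite_not_commute[of _ True] D[OF that(2)] that(1) by auto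
    qed
    have D4: "C g \<subseteq> V2" "?D \<subseteq> V2 - C g" by (auto simp: C_def)
    have "A2.separating (C g)" unfolding A2.separating_def
      by (intro conjI exI[of _ ?D] ballI D1 D2 D3 D4)
    then show False using not_sep[OF g order_refl] by blast
  qed
  then obtain \<sigma> where \<sigma>: "\<And>g v. g \<in> carrier G2 \<Longrightarrow> v \<in> V2 - C g \<Longrightarrow> A1.ends (\<phi> (conj_pow g v)) (\<sigma> g) (\<sigma> g)"
    by metis
  have \<sigma>_gen: "\<sigma> (g \<otimes>\<^bsub>G2\<^esub> A2.gen a) = \<sigma> g" if g: "g \<in> carrier G2" and a: "a \<in> V2" for g a
  proof -
    \<comment> \<open>A vertex \<open>v\<close> in the star of \<open>a\<close> but outside
      \<open>C g\<close> is wanted: \<open>gen a\<close> commutes with \<open>gen v\<close>, so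
      \<open>conj_pow g v\<close>, and the side it reports, are the same for \<open>g\<close> and
      for \<open>g \<otimes> gen a\<close>.\<close>
    have "\<not> insert a (A2.link a) \<subseteq> C g"
    proof
      assume s: "insert a (A2.link a) \<subseteq> C g"
      then have "insert a (A2.link a) \<noteq> V2"
        using A2.clique_subset[OF C_clique[OF g] s] V2_not_clique by auto
      then have "A2.separating (A2.link a)" using a by (intro A2.separating_link) auto
      then show False using not_sep[OF g] s by auto
    qed
    then obtain v where v: "v = a \<or> (a, v) \<in> R2" "v \<notin> C g" by (auto simp: A2.link_def)
    have vV: "v \<in> V2" using v a A2.R_in_V by auto
    have ga: "g \<otimes>\<^bsub>G2\<^esub> A2.gen a \<in> carrier G2" using g a by simp
    have "A2.gen a \<otimes>\<^bsub>G2\<^esub> A2.gen v = A2.gen v \<otimes>\<^bsub>G2\<^esub> A2.gen a" using v A2.gen_comm by auto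
    then have "A2.gen a \<otimes>\<^bsub>G2\<^esub> (A2.gen v [^]\<^bsub>G2\<^esub> int k) = (A2.gen v [^]\<^bsub>G2\<^esub> int k) \<otimes>\<^bsub>G2\<^esub> A2.gen a"
      using a vV by (intro A2.commute_int_pow) auto
    then have "A2.gen a \<otimes>\<^bsub>G2\<^esub> (A2.gen v [^]\<^bsub>G2\<^esub> int k) \<otimes>\<^bsub>G2\<^esub> inv\<^bsub>G2\<^esub> A2.gen a = A2.gen v [^]\<^bsub>G2\<^esub> int k"
      using a vV by (simp add: A2.m_assoc)
    then have "conj_pow (g \<otimes>\<^bsub>G2\<^esub> A2.gen a) v = conj_pow g v"
      using A2.conj_conj[OF g, of "A2.gen a" "A2.gen v [^]\<^bsub>G2\<^esub> int k"] a vV by (simp add: conj_pow_def)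
    moreover from this have "v \<notin> C (g \<otimes>\<^bsub>G2\<^esub> A2.gen a)" using v(2) by (simp add: C_def)
    ultimately show ?thesis
      using \<sigma>[OF g, of v] \<sigma>[OF ga, of v] v(2) vV A1.ends_unique by (metis DiffI)
  qed
  have \<sigma>_const: "\<sigma> g = \<sigma> \<one>\<^bsub>G2\<^esub>" if "g \<in> carrier G2" for g
  proof -
    let ?H = "{h \<in> carrier G2. \<forall>g\<in>carrier G2. \<sigma> (g \<otimes>\<^bsub>G2\<^esub> h) = \<sigma> g}"
    have "subgroup ?H G2"
    proof (rule A2.subgroupI)
      fix h assume h: "h \<in> ?H"
      have "\<sigma> (g \<otimes>\<^bsub>G2\<^esub> inv\<^bsub>G2\<^esub> h) = \<sigma> g" if "g \<in> carrier G2" for g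
      proof -
        have "\<sigma> (g \<otimes>\<^bsub>G2\<^esub> inv\<^bsub>G2\<^esub> h \<otimes>\<^bsub>G2\<^esub> h) = \<sigma> (g \<otimes>\<^bsub>G2\<^esub> inv\<^bsub>G2\<^esub> h)" using h that by simp
        then show ?thesis using h that by (simp add: A2.m_assoc)
      qed
      then show "inv\<^bsub>G2\<^esub> h \<in> ?H" using h by simp
    next
      fix h h' assume "h \<in> ?H" "h' \<in> ?H"
      then show "h \<otimes>\<^bsub>G2\<^esub> h' \<in> ?H" by (simp flip: A2.m_assoc)
    qed (auto intro!: exI[of _ "\<one>\<^bsub>G2\<^esub>"])
    moreover have "A2.gen ` V2 \<subseteq> ?H" using \<sigma>_gen by auto
    ultimately have "A2.par V2 \<subseteq> ?H" by (rule A2.par_least)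
    then have "g \<in> ?H" using that A2.par_V by auto
    then have "\<sigma> (\<one>\<^bsub>G2\<^esub> \<otimes>\<^bsub>G2\<^esub> g) = \<sigma> \<one>\<^bsub>G2\<^esub>" by blast
    then show ?thesis using that by simp
  qed
  define t where "t = \<sigma> \<one>\<^bsub>G2\<^esub>"
  \<comment> \<open>Generators strictly on either side multiply to an element translating towards
    side \<open>t\<close>; its \<open>k\<close>-th power has a preimage \<open>d\<close> in
    \<open>H2\<close>.\<close>
  obtain a b where ab: "a \<in> P t" "a \<notin> P (\<not> t)" "b \<in> P (\<not> t)" "b \<notin> P t"
    using sides[of t] sides[of "\<not> t"] by auto
  have Vab: "a \<in> V1" "b \<in> V1" using ab A1.P_sub by blast+
  have "A1.ends (A1.gen a) t t" "A1.ends (A1.gen b) (\<not> t) (\<not> t)"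
    using A1.ends_gen_pow[of a t 1] A1.ends_gen_pow[of b "\<not> t" 1] ab Vab by auto
  then have "A1.ends (A1.gen a \<otimes>\<^bsub>G1\<^esub> A1.gen b) t (\<not> t)" by (rule A1.ends_mult) auto
  then have h: "A1.ends ((A1.gen a \<otimes>\<^bsub>G1\<^esub> A1.gen b) [^]\<^bsub>G1\<^esub> k) t (\<not> t)" by (rule A1.ends_pow) (rule k(1))
  obtain d where d: "d \<in> H2" "\<phi> d = (A1.gen a \<otimes>\<^bsub>G1\<^esub> A1.gen b) [^]\<^bsub>G1\<^esub> k"
    using \<phi>_surj k(2) Vab by (metis A1.gen_closed A1.m_closed)
  have e: "A1.ends (\<phi> d) t (\<not> t)" using h d(2) by simp
  have one: "\<one>\<^bsub>G2\<^esub> \<in> carrier G2" by simp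
  have "\<exists>i0. \<forall>i\<ge>i0. \<not> A1.ends (inv\<^bsub>G1\<^esub> (\<phi> d) [^]\<^bsub>G1\<^esub> (i::nat) \<otimes>\<^bsub>G1\<^esub> \<phi> (conj_pow \<one>\<^bsub>G2\<^esub> v) \<otimes>\<^bsub>G1\<^esub> \<phi> d [^]\<^bsub>G1\<^esub> i) t t" if "v \<in> V2" for v
    by (rule A1.eventually_conj_not_ends[OF e \<phi>_closed[OF conj_pow_in_H2[OF one that]]])
  then obtain i0 where i0: "\<And>v i. v \<in> V2 \<Longrightarrow> i \<ge> i0 v \<Longrightarrow>
      \<not> A1.ends (inv\<^bsub>G1\<^esub> (\<phi> d) [^]\<^bsub>G1\<^esub> (i::nat) \<otimes>\<^bsub>G1\<^esub> \<phi> (conj_pow \<one>\<^bsub>G2\<^esub> v) \<otimes>\<^bsub>G1\<^esub> \<phi> d [^]\<^bsub>G1\<^esub> i) t t" by metis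
  \<comment> \<open>After \<open>n\<close> steps along \<open>\<phi> d\<close> none of the finitely
    many conjugates lies on side \<open>t\<close> any more, whereas constancy of
    \<open>\<sigma>\<close> keeps them there unless they fix the base edge. So all of them fix it,
    and \<open>V2\<close> would be a clique.\<close>
  define n where "n = Max (insert 0 (i0 ` V2))"
  have n: "i0 v \<le> n" if "v \<in> V2" for v
    unfolding n_def using that A2.finite_V by (intro Max_ge) auto
  have dc: "d \<in> carrier G2" using d(1) by (rule H2_closed)
  define g where "g = inv\<^bsub>G2\<^esub> (d [^]\<^bsub>G2\<^esub> int n)"
  have g: "g \<in> carrier G2" "g \<in> H2" using d dc by (auto simp: g_def H2_intros)
  have "v \<in> C g" if v: "v \<in> V2" for v
  proof (rule ccontr)
    assume vC: "v \<notin> C g"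
    have xv: "conj_pow \<one>\<^bsub>G2\<^esub> v \<in> H2" by (rule conj_pow_in_H2[OF one v])
    have "conj_pow g v = g \<otimes>\<^bsub>G2\<^esub> conj_pow \<one>\<^bsub>G2\<^esub> v \<otimes>\<^bsub>G2\<^esub> d [^]\<^bsub>G2\<^esub> int n"
      using v dc by (simp add: conj_pow_def g_def)
    then have "\<phi> (conj_pow g v) = \<phi> g \<otimes>\<^bsub>G1\<^esub> \<phi> (conj_pow \<one>\<^bsub>G2\<^esub> v) \<otimes>\<^bsub>G1\<^esub> \<phi> (d [^]\<^bsub>G2\<^esub> int n)"
      using g xv d by (simp add: \<phi>_mult H2_intros)
    also have "\<phi> (d [^]\<^bsub>G2\<^esub> int n) = \<phi> d [^]\<^bsub>G1\<^esub> n" unfolding \<phi>_int_pow[OF d(1)] by (rule int_pow_int)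
    also have "\<phi> g = inv\<^bsub>G1\<^esub> (\<phi> d) [^]\<^bsub>G1\<^esub> n"
      unfolding g_def
      by (subst \<phi>_inv[OF H2_intros(3)[OF d(1)]], subst \<phi>_int_pow[OF d(1)], subst int_pow_int)
        (rule A1.nat_pow_inv[OF \<phi>_closed[OF d(1)], symmetric])
    finally have "\<not> A1.ends (\<phi> (conj_pow g v)) t t" using i0[OF v n[OF v]] by simp
    then show False using \<sigma>[OF g(1), of v] \<sigma>_const[OF g(1)] v vC by (simp add: t_def)
  qed
  then have "C g = V2" by (auto simp: C_def)
  then show False using C_clique[OF g(1)] V2_not_clique by simp
qed

lemma separating_clique_exists:
  "\<exists>K S. A2.clique K \<and> S \<subseteq> K \<and> card K = card K1 \<and> A2.separating S"
proof (cases "\<exists>g v t. g \<in> carrier G2 \<and> v \<in> V2 \<and> A1.ends (\<phi> (conj_pow g v)) t (\<not> t)")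
  case True
  then show ?thesis using axis_case by blast
next
  case False
  have "\<phi> (conj_pow g v) \<in> A1.par A1.S \<or> (\<exists>t. A1.ends (\<phi> (conj_pow g v)) t t)"
    if gv: "g \<in> carrier G2" "v \<in> V2" for g v
  proof -
    have "l = f" if "A1.ends (\<phi> (conj_pow g v)) f l" for f l
    proof (rule ccontr)
      assume "l \<noteq> f"
      then have "l = (\<not> f)" by simp
      then show False using False that gv by blast
    qed
    then show ?thesis using A1.par_S_or_ends[OF \<phi>_closed[OF conj_pow_in_H2[OF gv]]] by blast
  qed
  then show ?thesis by (rule elliptic_case)
qed

end

section \<open>Separating subgraphs of digraphs\<close>

text \<open>Arcs are symmetric, so a strongly connected component has no arc to the outside and can
  serve as \<open>C\<close>. Conversely a path starting in \<open>C\<close> never leaves it, so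
  \<open>a\<close> and \<open>b\<close> have different components.\<close>

lemma (in pseudo_graph) two_sccs_iff:
  "card sccs \<ge> 2 \<longleftrightarrow>
     (\<exists>C \<subseteq> verts G. C \<noteq> {} \<and> verts G - C \<noteq> {} \<and> (\<forall>u\<in>C. \<forall>v\<in>verts G - C. (u, v) \<notin> arcs_ends G))"
proof
  assume "card sccs \<ge> 2"
  then have two: "card sccs_verts \<ge> 2" by (simp add: card_sccs_verts)
  then have "\<not> card sccs_verts \<le> Suc 0" by simp
  then obtain C D where CD: "C \<in> sccs_verts" "D \<in> sccs_verts" "C \<noteq> D"
    using card_le_Suc0_iff_eq[OF finite_sccs_verts] by blast
  have "C \<inter> D = {}" "C \<noteq> {}" "D \<noteq> {}" "C \<subseteq> verts G" "D \<subseteq> verts G"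
    using sccs_verts_disjoint[OF CD] CD sccs_verts_subsets by (auto simp: sccs_verts_def)
  moreover have "(u, v) \<notin> arcs_ends G" if "u \<in> C" "v \<in> verts G - C" for u v
  proof
    assume "(u, v) \<in> arcs_ends G"
    then have "u \<rightarrow>\<^sup>* v" "v \<rightarrow>\<^sup>* u" by (auto intro: symmetric_reachable[OF sym_arcs])
    then show False using CD(1) that unfolding sccs_verts_def by blast
  qed
  ultimately show "\<exists>C \<subseteq> verts G. C \<noteq> {} \<and> verts G - C \<noteq> {} \<and>
      (\<forall>u\<in>C. \<forall>v\<in>verts G - C. (u, v) \<notin> arcs_ends G)"
    by (intro exI[of _ C]) blast
next
  assume "\<exists>C \<subseteq> verts G. C \<noteq> {} \<and> verts G - C \<noteq> {} \<and>
      (\<forall>u\<in>C. \<forall>v\<in>verts G - C. (u, v) \<notin> arcs_ends G)"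
  then obtain C a b where C: "C \<subseteq> verts G" "a \<in> C" "b \<in> verts G - C"
    "\<And>u v. u \<in> C \<Longrightarrow> v \<in> verts G - C \<Longrightarrow> (u, v) \<notin> arcs_ends G" by blast
  have "v \<in> C" if "a \<rightarrow>\<^sup>* v" for v
    using that
  proof (induction rule: reachable_induct)
    case (step u v)
    then show ?case using C(4) adj_in_verts(2) by blast
  qed (rule C(2))
  then have "b \<notin> scc_of a" using C(3) by (auto simp: scc_of_def)
  then have "scc_of a \<noteq> scc_of b" using in_scc_of_self C(3) by blast
  moreover have "{scc_of a, scc_of b} \<subseteq> sccs_verts" using C scc_of_in_sccs_verts by auto
  then have "card {scc_of a, scc_of b} \<le> card sccs_verts" by (rule card_mono[OF finite_sccs_verts])
  ultimately show "card sccs \<ge> 2" by (simp add: card_sccs_verts)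
qed

context graph
begin

lemma artin_group_raag: "artin_group (verts G) (arcs_ends G) (raag G)"
proof
  show "arcs_ends G \<subseteq> verts G \<times> verts G" using adj_in_verts by auto
  show "(v, u) \<in> arcs_ends G" if "(u, v) \<in> arcs_ends G" for u v
    using that by (rule arcs_ends_symmetric[OF sym_arcs])
  show "(u, u) \<notin> arcs_ends G" for u using adj_not_same by blast
  show "raag G = presented_group (verts G)
      {commutator (free_group (verts G)) (free_gen u) (free_gen v) | u v. (u, v) \<in> arcs_ends G}"
    by (rule raag_def)
qed simp

interpretation A: artin_group "verts G" "arcs_ends G" "raag G"
  by (rule artin_group_raag)

lemma arcs_ends_induce:
  "arcs_ends (G \<restriction> U) = {(u, v) \<in> arcs_ends G. u \<in> U \<and> v \<in> U}"
  by (auto simp: arcs_ends_conv)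

lemma graph_induce: "U \<subseteq> verts G \<Longrightarrow> graph (G \<restriction> U)"
proof -
  assume U: "U \<subseteq> verts G"
  interpret I: sym_digraph "G \<restriction> U"
    by (rule induced_graph_imp_graph[OF induced_induce[OF U]])
  show ?thesis
    by unfold_locales
      (use finite_subset[OF U finite_verts] no_loops no_multi_arcs in \<open>auto\<close>)
qed

lemma separates_iff:
  assumes "verts \<Lambda> \<subseteq> verts G"
  shows "separates \<Lambda> G \<longleftrightarrow> A.separating (verts \<Lambda>)"
proof -
  interpret I: graph "G \<restriction> (verts G - verts \<Lambda>)" by (rule graph_induce) auto
  have "(\<forall>u\<in>C. \<forall>v\<in>verts G - verts \<Lambda> - C. (u, v) \<notin> arcs_ends (G \<restriction> (verts G - verts \<Lambda>))) \<longleftrightarrow>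
      (\<forall>u\<in>C. \<forall>v\<in>verts G - verts \<Lambda> - C. (u, v) \<notin> arcs_ends G)"
    if "C \<subseteq> verts G - verts \<Lambda>" for C
    using that by (auto simp: arcs_ends_induce)
  then show ?thesis
    unfolding separates_def A.separating_def I.two_sccs_iff using assms
    by (simp cong: conj_cong)
qed

lemma complete_subgraph_clique:
  assumes "subgraph \<Lambda> G" "complete_digraph n \<Lambda>"
  shows "A.clique (verts \<Lambda>)" "card (verts \<Lambda>) = n"
proof -
  have sub: "verts \<Lambda> \<subseteq> verts G" "arcs \<Lambda> \<subseteq> arcs G" "compatible G \<Lambda>"
    using assms(1) by (auto simp: subgraph_def)
  have "arcs_ends \<Lambda> \<subseteq> arcs_ends G"
    using sub by (auto simp: arcs_ends_conv compatible_def)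
  then show "A.clique (verts \<Lambda>)" "card (verts \<Lambda>) = n"
    using assms(2) sub(1) by (auto simp: complete_digraph_def A.clique_def)
qed

lemma complete_induce:
  assumes "A.clique K" shows "complete_digraph (card K) (G \<restriction> K)"
proof -
  have K: "K \<subseteq> verts G" using assms by (rule A.clique_in_V)
  then show ?thesis
    using assms graph_induce[OF K] adj_not_same
    by (auto simp: complete_digraph_def arcs_ends_induce A.clique_def)
qed

end

theorem corollary1p2:
  fixes \<Gamma>\<^sub>1 :: "('a, 'b) pre_digraph" and \<Gamma>\<^sub>2 :: "('c, 'd) pre_digraph" and n :: nat
  assumes "graph \<Gamma>\<^sub>1" and "graph \<Gamma>\<^sub>2"
    and "commensurable (raag \<Gamma>\<^sub>1) (raag \<Gamma>\<^sub>2)"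
    and "\<exists>\<Lambda> \<Lambda>\<^sub>0. subgraph \<Lambda> \<Gamma>\<^sub>1 \<and> complete_digraph n \<Lambda> \<and>
           graph \<Lambda>\<^sub>0 \<and> subgraph \<Lambda>\<^sub>0 \<Lambda> \<and> separates \<Lambda>\<^sub>0 \<Gamma>\<^sub>1"
  shows "\<exists>\<Lambda> \<Lambda>\<^sub>0. subgraph \<Lambda> \<Gamma>\<^sub>2 \<and> complete_digraph n \<Lambda> \<and>
           graph \<Lambda>\<^sub>0 \<and> subgraph \<Lambda>\<^sub>0 \<Lambda> \<and> separates \<Lambda>\<^sub>0 \<Gamma>\<^sub>2"
proof -
  interpret \<Gamma>1: graph \<Gamma>\<^sub>1 by fact
  interpret \<Gamma>2: graph \<Gamma>\<^sub>2 by fact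
  interpret A1: artin_group "verts \<Gamma>\<^sub>1" "arcs_ends \<Gamma>\<^sub>1" "raag \<Gamma>\<^sub>1" by (rule \<Gamma>1.artin_group_raag)
  interpret A2: artin_group "verts \<Gamma>\<^sub>2" "arcs_ends \<Gamma>\<^sub>2" "raag \<Gamma>\<^sub>2" by (rule \<Gamma>2.artin_group_raag)
  obtain \<Lambda> \<Lambda>\<^sub>0 where \<Lambda>: "subgraph \<Lambda> \<Gamma>\<^sub>1" "complete_digraph n \<Lambda>" "subgraph \<Lambda>\<^sub>0 \<Lambda>" "separates \<Lambda>\<^sub>0 \<Gamma>\<^sub>1"
    using assms(4) by blast
  note K1 = \<Gamma>1.complete_subgraph_clique[OF \<Lambda>(1,2)]
  have S_sub: "verts \<Lambda>\<^sub>0 \<subseteq> verts \<Lambda>" "verts \<Lambda>\<^sub>0 \<subseteq> verts \<Gamma>\<^sub>1"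
    using \<Lambda>(1,3) by (auto simp: subgraph_def)
  then have "A1.separating (verts \<Lambda>\<^sub>0)" using \<Lambda>(4) by (simp add: \<Gamma>1.separates_iff)
  then obtain C where C: "C \<subseteq> verts \<Gamma>\<^sub>1 - verts \<Lambda>\<^sub>0" "C \<noteq> {}" "verts \<Gamma>\<^sub>1 - verts \<Lambda>\<^sub>0 - C \<noteq> {}"
    "\<And>u v. u \<in> C \<Longrightarrow> v \<in> verts \<Gamma>\<^sub>1 - verts \<Lambda>\<^sub>0 - C \<Longrightarrow> (u, v) \<notin> arcs_ends \<Gamma>\<^sub>1"
    unfolding A1.separating_def by blast
  \<comment> \<open>\<open>C\<close> may consist of several components; the two sides overlap
    exactly in the vertices of \<open>\<Lambda>\<^sub>0\<close>.\<close>
  define P where "P t = (if t then verts \<Lambda>\<^sub>0 \<union> C else verts \<Gamma>\<^sub>1 - C)" for t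
  obtain H\<^sub>1 H\<^sub>2 where H: "finite_index_subgroup H\<^sub>1 (raag \<Gamma>\<^sub>1)" "finite_index_subgroup H\<^sub>2 (raag \<Gamma>\<^sub>2)"
    and "(raag \<Gamma>\<^sub>1)\<lparr>carrier := H\<^sub>1\<rparr> \<cong> (raag \<Gamma>\<^sub>2)\<lparr>carrier := H\<^sub>2\<rparr>"
    using assms(3) by (auto simp: commensurable_def)
  then have sub: "subgroup H\<^sub>1 (raag \<Gamma>\<^sub>1)" "subgroup H\<^sub>2 (raag \<Gamma>\<^sub>2)"
    and "(raag \<Gamma>\<^sub>2)\<lparr>carrier := H\<^sub>2\<rparr> \<cong> (raag \<Gamma>\<^sub>1)\<lparr>carrier := H\<^sub>1\<rparr>"
    using group.iso_sym[OF A1.subgroup_imp_group] by (auto simp: finite_index_subgroup_def)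
  then obtain \<phi> where \<phi>: "\<phi> \<in> iso ((raag \<Gamma>\<^sub>2)\<lparr>carrier := H\<^sub>2\<rparr>) ((raag \<Gamma>\<^sub>1)\<lparr>carrier := H\<^sub>1\<rparr>)"
    by (auto simp: is_iso_def)
  obtain k\<^sub>1 where k1: "k\<^sub>1 > 0" "\<And>g. g \<in> carrier (raag \<Gamma>\<^sub>1) \<Longrightarrow> g [^]\<^bsub>raag \<Gamma>\<^sub>1\<^esub> (k\<^sub>1 :: nat) \<in> H\<^sub>1"
    using A1.finite_index_powers[OF H(1)] by blast
  obtain k\<^sub>2 where k2: "k\<^sub>2 > 0" "\<And>g. g \<in> carrier (raag \<Gamma>\<^sub>2) \<Longrightarrow> g [^]\<^bsub>raag \<Gamma>\<^sub>2\<^esub> (k\<^sub>2 :: nat) \<in> H\<^sub>2"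
    using A2.finite_index_powers[OF H(2)] by blast
  \<comment> \<open>The product of the two exponents serves both groups at once.\<close>
  interpret M: artin_commensuration "verts \<Gamma>\<^sub>1" "arcs_ends \<Gamma>\<^sub>1" "raag \<Gamma>\<^sub>1" P
    "verts \<Gamma>\<^sub>2" "arcs_ends \<Gamma>\<^sub>2" "raag \<Gamma>\<^sub>2" H\<^sub>1 H\<^sub>2 \<phi> "verts \<Lambda>" "k\<^sub>2 * k\<^sub>1"
  proof (intro artin_commensuration.intro artin_amalgam.intro artin_amalgam_axioms.intro
      artin_commensuration_axioms.intro A1.artin_group_axioms A2.artin_group_axioms sub \<phi> K1(1))
    show "P True \<union> P False = verts \<Gamma>\<^sub>1" using C(1) S_sub by (auto simp: P_def)
    show "(u, w) \<notin> arcs_ends \<Gamma>\<^sub>1" if "u \<in> P True - P False" "w \<in> P False - P True" for u w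
      by (rule C(4)) (use that S_sub in \<open>auto simp: P_def\<close>)
    show "P t - P (\<not> t) \<noteq> {}" for t using C by (cases t) (auto simp: P_def)
    have am: "artin_amalgam (verts \<Gamma>\<^sub>1) (arcs_ends \<Gamma>\<^sub>1) (raag \<Gamma>\<^sub>1) P"
      using A1.artin_group_axioms C S_sub
      by (auto simp: artin_amalgam_def artin_amalgam_axioms_def P_def)
    show "artin_amalgam.S P \<subseteq> verts \<Lambda>"
      unfolding artin_amalgam.S_def[OF am] using S_sub C(1) by (auto simp: P_def)
    show "k\<^sub>2 * k\<^sub>1 > 0" using k1 k2 by simp
    show "g [^]\<^bsub>raag \<Gamma>\<^sub>1\<^esub> (k\<^sub>2 * k\<^sub>1) \<in> H\<^sub>1" if "g \<in> carrier (raag \<Gamma>\<^sub>1)" for g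
      using k1(2)[of "g [^]\<^bsub>raag \<Gamma>\<^sub>1\<^esub> k\<^sub>2"] that by (simp add: A1.nat_pow_pow)
    show "g [^]\<^bsub>raag \<Gamma>\<^sub>2\<^esub> (k\<^sub>2 * k\<^sub>1) \<in> H\<^sub>2" if "g \<in> carrier (raag \<Gamma>\<^sub>2)" for g
      using k2(2)[of "g [^]\<^bsub>raag \<Gamma>\<^sub>2\<^esub> k\<^sub>1"] that by (simp add: A2.nat_pow_pow mult.commute)
  qed
  obtain K S where K: "A2.clique K" "S \<subseteq> K" "card K = n" "A2.separating S"
    using M.separating_clique_exists K1(2) by auto
  have V: "K \<subseteq> verts \<Gamma>\<^sub>2" "S \<subseteq> verts \<Gamma>\<^sub>2" using A2.clique_in_V[OF K(1)] K(2) by auto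
  have "subgraph (\<Gamma>\<^sub>2 \<restriction> S) (\<Gamma>\<^sub>2 \<restriction> K)"
    using K(2) V \<Gamma>2.wellformed_induce_subgraph by (auto simp: subgraph_def compatible_def)
  moreover have "separates (\<Gamma>\<^sub>2 \<restriction> S) \<Gamma>\<^sub>2" using V K(4) by (simp add: \<Gamma>2.separates_iff)
  ultimately show ?thesis
    using \<Gamma>2.subgraph_induce_subgraphI[OF V(1)] \<Gamma>2.complete_induce[OF K(1)] K(3)
      \<Gamma>2.graph_induce[OF V(2)] by blast
qed

end
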